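(* Let $N\ge 2$, $\alpha>1$, and $\epsilon>0$. For any loop $U:\mathbb{T}\to \mathrm{SU}(N)$ belonging to $\mathrm{Lip}_\alpha$, there exists a sequence of $\mathrm{SU}(N)$-valued polynomial loops $U_n(t)$ of degree $\le n$ such that $$\|U-U_n\|_C:=\max_{t\in\mathbb{T}}\|U(t)-U_n(t)\| \le C_{\alpha,\epsilon,N,U}\,(n+1)^{-(\alpha-\epsilon)},\qquad n\ge 0,$$ where the constant $C_{\alpha,\epsilon,N,U}$ depends only on $\alpha,\epsilon,N$ and $U$.
   Context: $\mathbb{T}$ denotes the circle (the torus $\mathbb{R}/2\pi\mathbb{Z}$), and a loop is a continuous map on $\mathbb{T}$. $\mathrm{Lip}_\alpha(\mathbb{T}\to\mathrm{SU}(N))$ denotes the loops whose matrix entries belong to the (generalized) Lipschitz class $\mathrm{Lip}_\alpha$ of order $\alpha$ on $\mathbb{T}$, i.e. the class characterized by $O(n^{-\alpha})$ best approximation by trigonometric polynomials of degree $\le n$. A polynomial loop of degree $\le n$ is a loop whose matrix entries are trigonometric polynomials of degree $\le n$ in $t$. The matrix norm $\|\cdot\|$ is the spectral norm. *)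

theory Defs
  imports "HOL-Analysis.Analysis"
begin

definition cadjoint :: "complex^'n^'n \<Rightarrow> complex^'n^'n" where
  "cadjoint A = (\<chi> i j. cnj (A $ j $ i))"

definition SU :: "(complex^'n^'n) set" where
  "SU = {A. A ** cadjoint A = mat 1 \<and> cadjoint A ** A = mat 1 \<and> det A = 1}"

definition spec_norm :: "complex^'n^'n \<Rightarrow> real" where
  "spec_norm A = onorm (\<lambda>x. A *v x)"

definition trig_poly :: "nat \<Rightarrow> (real \<Rightarrow> complex) \<Rightarrow> bool" where
  "trig_poly n p \<longleftrightarrow> (\<exists>c :: int \<Rightarrow> complex.
      \<forall>t. p t = (\<Sum>k\<in>{-int n..int n}. c k * exp (\<i> * of_int k * of_real t)))"

definition is_loop :: "(real \<Rightarrow> 'a::topological_space) \<Rightarrow> bool" where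
  "is_loop f \<longleftrightarrow> continuous_on UNIV f \<and> (\<forall>t. f (t + 2 * pi) = f t)"

text \<open>Generalized Lipschitz class Lip_alpha of a scalar loop: best uniform
  approximation by trigonometric polynomials of degree \<le> n is O(n^{-alpha})
  (written with (n+1) to include n = 0).\<close>
definition Lip :: "real \<Rightarrow> (real \<Rightarrow> complex) \<Rightarrow> bool" where
  "Lip \<alpha> f \<longleftrightarrow> is_loop f \<and> (\<exists>C. \<forall>n::nat. \<exists>p. trig_poly n p \<and>
      (\<forall>t. norm (f t - p t) \<le> C * (real n + 1) powr (-\<alpha>)))"

definition Lip_loop :: "real \<Rightarrow> (real \<Rightarrow> complex^'n^'n) \<Rightarrow> bool" where
  "Lip_loop \<alpha> U \<longleftrightarrow> is_loop U \<and> (\<forall>i j. Lip \<alpha> (\<lambda>t. U t $ i $ j))"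

definition poly_loop :: "nat \<Rightarrow> (real \<Rightarrow> complex^'n^'n) \<Rightarrow> bool" where
  "poly_loop n U \<longleftrightarrow> (\<forall>i j. trig_poly n (\<lambda>t. U t $ i $ j))"

end

theory Submission
  imports Defs
begin

text \<open>
  If \<open>|a| \<le> \<delta>\<close> is a trigonometric polynomial of degree \<open>n\<close> and \<open>n \<delta>\<close> is small, there is a polynomial
  \<open>b = 1 + O(n \<delta>\<^sup>2)\<close> of degree \<open>2 n\<close> with \<open>|a|\<^sup>2 + |b|\<^sup>2 = 1\<close>. Placing such pairs in \<open>SU(2)\<close> blocks and
  multiplying, every small \<open>su(N)\<close>-valued polynomial \<open>X\<close> of degree \<open>n\<close> yields a polynomial loop
  \<open>P = I + X + O(n \<delta>\<^sup>2)\<close> of degree \<open>O(n)\<close>. Used as a Newton correction, this turns an approximation of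
  degree \<open>n\<close> and error \<open>e\<close> into one of degree \<open>M n\<close> and error \<open>O(n e\<^sup>2 + n\<^bsup>-\<alpha>\<^esup>)\<close>; for \<open>\<alpha> > 1\<close> the iteration
  gives \<open>O(n\<^bsup>-\<alpha>\<^esup>)\<close> as soon as the loop is close enough to \<open>I\<close> in terms of its Lipschitz constant.
  A loop joined to \<open>I\<close> by a path of loops with bounded Lipschitz constants is a product of such loops.
  A column \<open>u\<close> of \<open>U\<close> misses a point of the sphere, since \<open>\<alpha> > 1\<close> makes the curve too thin to fill a
  cube, so an explicit unitary with first column \<open>u\<close> is joined to \<open>I\<close> in this way; splitting it off
  reduces the size of \<open>U\<close> by one.
\<close>

section \<open>Trigonometric polynomials\<close>

text \<open>The obstacle is that a trigonometric approximant of \<open>U\<close> leaves SU(N), while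
  the usual ways back (polar decomposition, exponential, Gram-Schmidt) destroy finite degree.
  Corrections are therefore multiplied on, each being an exact polynomial loop. The factor n in the
  error comes from passing from coefficients to the sup norm; a correction then pays off only for
  errors o(1/n), which is where alpha > 1 enters. The distance to I at which the iteration may start
  depends on the Lipschitz constant, so a large loop is cut along a path into quotients of
  neighbours, whose constants are bounded however fine the cut is. Hence every closure property of
  the Lipschitz class, division included, fixes its constant before the function is quantified, and
  the path is written with sums, products and quotients only. Its formula for a unitary with column
  u degenerates at one vector, the basis vector itself; a constant factor moves a vector missed by
  the loop to that place.\<close>

abbreviation (input) ek :: "int \<Rightarrow> real \<Rightarrow> complex" where
  "ek k t \<equiv> exp (\<i> * of_int k * of_real t)"

lemma norm_ek [simp]: "norm (ek k t) = 1"
  by (simp add: norm_exp_eq_Re)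

lemma trig_poly_ek: assumes "\<bar>k\<bar> \<le> int n" shows "trig_poly n (ek k)"
proof -
  have "ek k t = (\<Sum>j\<in>{-int n..int n}. (if j = k then 1 else 0) * ek j t)" for t
  proof -
    have "(\<Sum>j\<in>{-int n..int n}. (if j = k then 1 else 0) * ek j t)
        = (\<Sum>j\<in>{-int n..int n}. if j = k then ek k t else 0)"
      by (rule sum.cong) auto
    also have "\<dots> = ek k t" using assms by (auto simp: abs_le_iff)
    finally show ?thesis by simp
  qed
  thus ?thesis unfolding trig_poly_def by (intro exI[of _ "\<lambda>j. if j = k then 1 else 0"]) simp
qed

lemma trig_poly_zero: "trig_poly n (\<lambda>t. 0)"
  unfolding trig_poly_def by (intro exI[of _ "\<lambda>_. 0"]) simp

lemma trig_poly_add: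
  assumes "trig_poly n p" "trig_poly n q" shows "trig_poly n (\<lambda>t. p t + q t)"
proof -
  obtain c d where "\<forall>t. p t = (\<Sum>k\<in>{-int n..int n}. c k * ek k t)"
    "\<forall>t. q t = (\<Sum>k\<in>{-int n..int n}. d k * ek k t)"
    using assms unfolding trig_poly_def by blast
  thus ?thesis unfolding trig_poly_def
    by (intro exI[of _ "\<lambda>k. c k + d k"]) (simp add: ring_distribs sum.distrib)
qed

lemma trig_poly_cmul:
  assumes "trig_poly n p" shows "trig_poly n (\<lambda>t. z * p t)"
proof -
  obtain c where "\<forall>t. p t = (\<Sum>k\<in>{-int n..int n}. c k * ek k t)"
    using assms unfolding trig_poly_def by blast
  thus ?thesis unfolding trig_poly_def
    by (intro exI[of _ "\<lambda>k. z * c k"]) (simp add: sum_distrib_left mult.assoc)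
qed

lemma trig_poly_sum:
  assumes "\<And>i. i \<in> I \<Longrightarrow> trig_poly n (p i)"
  shows "trig_poly n (\<lambda>t. \<Sum>i\<in>I. p i t)"
proof (cases "finite I")
  case True thus ?thesis using assms
    by (induction I rule: finite_induct) (auto intro: trig_poly_zero trig_poly_add)
qed (simp add: trig_poly_zero)

lemma trig_poly_const: "trig_poly n (\<lambda>t. z)"
  using trig_poly_cmul[OF trig_poly_ek[of 0 n], of z] by simp

lemma trig_poly_minus: "trig_poly n p \<Longrightarrow> trig_poly n (\<lambda>t. - p t)"
  using trig_poly_cmul[of n p "-1"] by simp

lemma trig_poly_diff:
  "trig_poly n p \<Longrightarrow> trig_poly n q \<Longrightarrow> trig_poly n (\<lambda>t. p t - q t)"
  using trig_poly_add[of n p "\<lambda>t. - q t"] trig_poly_minus[of n q] by simp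

lemma trig_poly_mono:
  assumes "trig_poly n p" "n \<le> m" shows "trig_poly m p"
proof -
  obtain c where c: "\<forall>t. p t = (\<Sum>k\<in>{-int n..int n}. c k * ek k t)"
    using assms unfolding trig_poly_def by blast
  have "trig_poly m (\<lambda>t. \<Sum>k\<in>{-int n..int n}. c k * ek k t)"
    using assms(2) by (intro trig_poly_sum trig_poly_cmul trig_poly_ek) auto
  thus ?thesis using c by presburger
qed

lemma trig_poly_mult:
  assumes "trig_poly n p" "trig_poly m q" shows "trig_poly (n + m) (\<lambda>t. p t * q t)"
proof -
  obtain c d where c: "\<forall>t. p t = (\<Sum>k\<in>{-int n..int n}. c k * ek k t)"
    and d: "\<forall>t. q t = (\<Sum>k\<in>{-int m..int m}. d k * ek k t)"
    using assms unfolding trig_poly_def by blast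
  have "p t * q t = (\<Sum>k\<in>{-int n..int n}. \<Sum>l\<in>{-int m..int m}. (c k * d l) * ek (k + l) t)" for t
    by (simp add: c d sum_product exp_add ring_distribs mult_ac)
  moreover have "trig_poly (n + m) (\<lambda>t. \<Sum>k\<in>{-int n..int n}. \<Sum>l\<in>{-int m..int m}. (c k * d l) * ek (k + l) t)"
    by (intro trig_poly_sum trig_poly_cmul trig_poly_ek) auto
  ultimately show ?thesis by presburger
qed

lemma trig_poly_cnj:
  assumes "trig_poly n p" shows "trig_poly n (\<lambda>t. cnj (p t))"
proof -
  obtain c where c: "\<forall>t. p t = (\<Sum>k\<in>{-int n..int n}. c k * ek k t)"
    using assms unfolding trig_poly_def by blast
  have "cnj (p t) = (\<Sum>k\<in>{-int n..int n}. cnj (c k) * ek (-k) t)" for t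
    by (simp add: c exp_cnj)
  moreover have "trig_poly n (\<lambda>t. \<Sum>k\<in>{-int n..int n}. cnj (c k) * ek (-k) t)"
    by (intro trig_poly_sum trig_poly_cmul trig_poly_ek) auto
  ultimately show ?thesis by presburger
qed

lemma trig_poly_power:
  assumes "trig_poly n p" shows "trig_poly (k * n) (\<lambda>t. p t ^ k)"
proof (induction k)
  case 0 show ?case using trig_poly_const[of 0 1] by simp
next
  case (Suc k)
  show ?case using trig_poly_mult[OF assms Suc] by simp
qed

text \<open>A unimodular factor shifts all frequencies to 0..2n without changing the modulus; this
  is why degree n becomes m = 2 n wherever only nonnegative frequencies are used.\<close>

lemma trig_poly_nat:
  assumes "trig_poly n p"
  obtains c where "\<And>t. p t = ek (- int n) t * (\<Sum>k\<le>2*n. c k * ek (int k) t)"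
proof -
  obtain c where c: "\<forall>t. p t = (\<Sum>k\<in>{-int n..int n}. c k * ek k t)"
    using assms unfolding trig_poly_def by blast
  have "p t = ek (- int n) t * (\<Sum>k\<le>2*n. c (int k - int n) * ek (int k) t)" for t
  proof -
    have "p t = (\<Sum>k\<le>2*n. c (int k - int n) * ek (int k - int n) t)"
      unfolding c[rule_format]
      by (rule sum.reindex_bij_witness[of _ "\<lambda>k. int k - int n" "\<lambda>k. nat (k + int n)"]) auto
    also have "\<dots> = (\<Sum>k\<le>2*n. ek (- int n) t * (c (int k - int n) * ek (int k) t))"
      by (rule sum.cong) (auto simp: ring_distribs exp_diff exp_minus divide_inverse mult_ac)
    finally show ?thesis by (simp add: sum_distrib_left)
  qed
  thus ?thesis by (intro that[of "\<lambda>k. c (int k - int n)"])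
qed

lemma trig_poly_of_nat_sum: "trig_poly n (\<lambda>t. \<Sum>k\<le>n. c k * ek (int k) t)"
  by (intro trig_poly_sum trig_poly_cmul trig_poly_ek) auto

section \<open>Discrete orthogonality and a Parseval bound\<close>

lemma sum_roots_of_unity:
  assumes "0 < L" "\<bar>k\<bar> < int L" "k \<noteq> 0"
  shows "(\<Sum>l<L. ek k (2 * pi * real l / real L)) = 0"
proof -
  define z where "z = ek k (2 * pi / real L)"
  have p: "z ^ l = ek k (2 * pi * real l / real L)" for l
    by (simp add: z_def exp_of_nat_mult[symmetric] mult_ac)
  have zL: "z ^ L = 1"
  proof -
    have "z ^ L = exp (of_int (2*k) * (of_real pi * \<i>))" using p[of L] assms(1) by (simp add: mult_ac)
    thus ?thesis using exp_integer_2pi[of "of_int k"] by (simp add: mult_ac)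
  qed
  have "z \<noteq> 1"
  proof
    assume "z = 1"
    then obtain m :: int where m: "real_of_int k * (2 * pi / real L) = of_int (2 * m) * pi"
      unfolding z_def exp_eq_1 by auto
    hence "real_of_int k = of_int m * real L" using assms(1) by (simp add: field_simps)
    hence "k = m * int L" by (metis of_int_eq_iff of_int_mult of_int_of_nat_eq)
    hence "\<bar>k\<bar> = \<bar>m\<bar> * int L" by (simp add: abs_mult)
    moreover from this assms have "\<bar>m\<bar> \<ge> 1" by auto
    ultimately show False using assms(2) by (metis less_le_not_le mult_le_cancel_right1 of_nat_0_le_iff order_antisym_conv verit_comp_simplify1(3) zle_int)
  qed
  thus ?thesis using geometric_sum[of z L] zL p by simp
qed

text \<open>Averaging |f|^2 over equally spaced nodes replaces the integral: two frequencies differ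
  by at most m, so with m + 1 nodes the cross terms vanish exactly.\<close>

lemma parseval_le:
  assumes "\<And>t. norm (\<Sum>k\<le>m. c k * ek (int k) t) \<le> M"
  shows "(\<Sum>k\<le>m. (norm (c k))\<^sup>2) \<le> M\<^sup>2"
proof -
  define L where "L = Suc m"
  let ?t = "\<lambda>l. 2 * pi * real l / real L"
  let ?f = "\<lambda>t. \<Sum>k\<le>m. c k * ek (int k) t"
  have "(\<Sum>l<L. ?f (?t l) * cnj (?f (?t l)))
      = (\<Sum>l<L. \<Sum>j\<le>m. \<Sum>k\<le>m. c j * cnj (c k) * ek (int j - int k) (?t l))"
    by (rule sum.cong) (auto simp: sum_product exp_cnj exp_diff exp_minus ring_distribs divide_inverse mult_ac)
  also have "\<dots> = (\<Sum>j\<le>m. \<Sum>k\<le>m. c j * cnj (c k) * (\<Sum>l<L. ek (int j - int k) (?t l)))"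
    by (subst sum.swap, rule sum.cong, simp, subst sum.swap, rule sum.cong)
       (auto simp: sum_distrib_left)
  also have "\<dots> = (\<Sum>j\<le>m. \<Sum>k\<le>m. if k = j then c j * cnj (c j) * of_nat L else 0)"
  proof (intro sum.cong refl)
    fix j k assume "j \<in> {..m}" "k \<in> {..m}"
    show "c j * cnj (c k) * (\<Sum>l<L. ek (int j - int k) (?t l)) = (if k = j then c j * cnj (c j) * of_nat L else 0)"
    proof (cases "k = j")
      case False
      have "(\<Sum>l<L. ek (int j - int k) (?t l)) = 0"
        by (rule sum_roots_of_unity) (use False \<open>j \<in> _\<close> \<open>k \<in> _\<close> in \<open>auto simp: L_def\<close>)
      thus ?thesis using False by (metis mult_zero_right)
    qed simp
  qed
  also have "\<dots> = of_real (real L * (\<Sum>k\<le>m. (norm (c k))\<^sup>2))"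
    by (simp add: complex_norm_square sum_distrib_left mult_ac flip: of_real_power)
  finally have eq: "of_real (\<Sum>l<L. (norm (?f (?t l)))\<^sup>2) = (of_real (real L * (\<Sum>k\<le>m. (norm (c k))\<^sup>2)) :: complex)"
    by (simp only: of_real_sum complex_norm_square)
  have "real L * (\<Sum>k\<le>m. (norm (c k))\<^sup>2) = (\<Sum>l<L. (norm (?f (?t l)))\<^sup>2)"
    using eq[symmetric] of_real_eq_iff by blast
  also have "\<dots> \<le> (\<Sum>l<L. M\<^sup>2)"
    by (intro sum_mono power_mono assms) simp
  finally have "real L * (\<Sum>k\<le>m. (norm (c k))\<^sup>2) \<le> real L * M\<^sup>2" by simp
  thus ?thesis by (simp add: L_def)
qed

section \<open>Polynomial completion of a small entry\<close>

text \<open>For k <= m this is the coefficient of frequency k in |sum x_j e^(ijt)|^2; the negative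
  frequencies carry the conjugates.\<close>

definition autocorr :: "nat \<Rightarrow> (nat \<Rightarrow> complex) \<Rightarrow> nat \<Rightarrow> complex" where
  "autocorr m x k = (\<Sum>j\<le>m-k. x (j + k) * cnj (x j))"

text \<open>Weights for the analytic half of a real trigonometric polynomial: frequency 0 occurs in
  the half and again in its conjugate.\<close>

definition halfwt :: "nat \<Rightarrow> complex" where
  "halfwt k = (if k = 0 then 1/2 else 1)"

lemma norm_sq_autocorr:
  fixes x :: "nat \<Rightarrow> complex" and m :: nat
  defines "f \<equiv> \<lambda>t. \<Sum>k\<le>m. x k * ek (int k) t"
  shows "complex_of_real ((norm (f t))\<^sup>2)
    = (\<Sum>k\<le>m. halfwt k * autocorr m x k * ek (int k) t) + cnj (\<Sum>k\<le>m. halfwt k * autocorr m x k * ek (int k) t)"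
proof -
  define T where "T = (\<lambda>j l. x j * cnj (x l) * ek (int j - int l) t)"
  \<comment> \<open>The lower triangle with its diagonal halved, so that
    \<open>u j l + u l j = 1\<close>: the triangle and its conjugate transpose add up to the full
    square.\<close>
  define u :: "nat \<Rightarrow> nat \<Rightarrow> complex" where
    "u = (\<lambda>j l. if l < j then 1 else if l = j then 1/2 else 0)"
  have T': "cnj (T j l) = T l j" for j l
    by (simp add: T_def exp_cnj ring_distribs mult_ac)
  have "(\<Sum>k\<le>m. halfwt k * autocorr m x k * ek (int k) t)
      = (\<Sum>k\<le>m. \<Sum>j\<le>m-k. halfwt k * T (j + k) j)"
    by (simp add: autocorr_def T_def sum_distrib_left sum_distrib_right mult_ac)
  also have "\<dots> = (\<Sum>(k,j)\<in>(SIGMA k:{..m}. {..m-k}). halfwt k * T (j + k) j)"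
    by (rule sum.Sigma) auto
  also have "\<dots> = (\<Sum>(j,l)\<in>(SIGMA j:{..m}. {..j}). u j l * T j l)"
    by (rule sum.reindex_bij_witness[of _ "\<lambda>(j,l). (j - l, l)" "\<lambda>(k,j). (j + k, j)"])
       (auto simp: halfwt_def u_def)
  also have "\<dots> = (\<Sum>j\<le>m. \<Sum>l\<le>j. u j l * T j l)"
    by (rule sum.Sigma[symmetric]) auto
  also have "\<dots> = (\<Sum>j\<le>m. \<Sum>l\<le>m. u j l * T j l)"
    by (intro sum.cong refl sum.mono_neutral_left) (auto simp: u_def)
  finally have g: "(\<Sum>k\<le>m. halfwt k * autocorr m x k * ek (int k) t) = (\<Sum>j\<le>m. \<Sum>l\<le>m. u j l * T j l)" .
  have cu: "cnj (u j l) = u j l" for j l by (simp add: u_def)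
  have "cnj (\<Sum>j\<le>m. \<Sum>l\<le>m. u j l * T j l) = (\<Sum>j\<le>m. \<Sum>l\<le>m. u j l * T l j)"
    by (simp add: T' cu)
  also have "\<dots> = (\<Sum>j\<le>m. \<Sum>l\<le>m. u l j * T j l)"
    by (rule sum.swap)
  finally have "(\<Sum>j\<le>m. \<Sum>l\<le>m. u j l * T j l) + cnj (\<Sum>j\<le>m. \<Sum>l\<le>m. u j l * T j l)
      = (\<Sum>j\<le>m. \<Sum>l\<le>m. (u j l + u l j) * T j l)"
    by (simp add: sum.distrib ring_distribs)
  also have "\<dots> = (\<Sum>j\<le>m. \<Sum>l\<le>m. T j l)"
    by (intro sum.cong refl) (auto simp: u_def)
  also have "\<dots> = f t * cnj (f t)"
    by (simp add: f_def T_def sum_product exp_cnj exp_diff exp_minus ring_distribs divide_inverse mult_ac)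
  finally show ?thesis unfolding complex_norm_square g by simp
qed

lemma autocorr_norm_le:
  assumes "\<And>j. j \<le> m \<Longrightarrow> norm (x j) \<le> r" "k \<le> m"
  shows "norm (autocorr m x k) \<le> real (m + 1) * r\<^sup>2"
proof -
  have r: "r \<ge> 0" using assms(1)[of 0] norm_ge_zero order_trans by blast
  have "norm (autocorr m x k) \<le> (\<Sum>j\<le>m-k. r * r)"
    unfolding autocorr_def using assms r
    by (intro sum_norm_le) (auto simp: norm_mult intro!: mult_mono)
  also have "\<dots> = real (m - k + 1) * r\<^sup>2" by (simp add: power2_eq_square)
  also have "\<dots> \<le> real (m + 1) * r\<^sup>2" by (intro mult_right_mono) auto
  finally show ?thesis .
qed

lemma autocorr_diff_le:
  assumes "\<And>j. j \<le> m \<Longrightarrow> norm (x j) \<le> r" "\<And>j. j \<le> m \<Longrightarrow> norm (y j) \<le> r"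
    "\<And>j. j \<le> m \<Longrightarrow> norm (x j - y j) \<le> d" "k \<le> m"
  shows "norm (autocorr m x k - autocorr m y k) \<le> 2 * real (m + 1) * r * d"
proof -
  have r: "r \<ge> 0" "d \<ge> 0" using assms(1,3)[of 0] norm_ge_zero order_trans by blast+
  have "norm (autocorr m x k - autocorr m y k) =
      norm (\<Sum>j\<le>m-k. (x (j + k) - y (j+k)) * cnj (x j) + y (j+k) * cnj (x j - y j))"
    unfolding autocorr_def by (simp add: sum_subtractf[symmetric] algebra_simps)
  also have "\<dots> \<le> (\<Sum>j\<le>m-k. d * r + r * d)"
    using assms r
    by (intro sum_norm_le order_trans[OF norm_triangle_ineq] add_mono)
       (auto simp: norm_mult simp flip: complex_cnj_diff intro!: mult_mono)
  also have "\<dots> = real (m - k + 1) * (2 * r * d)" by (simp add: algebra_simps)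
  also have "\<dots> \<le> real (m + 1) * (2 * r * d)" using r by (intro mult_right_mono) auto
  finally show ?thesis by (simp add: mult_ac)
qed

text \<open>A sup bound controls the sum of the squared coefficients, so x y <= (x^2 + y^2) / 2
  suffices and no factor m + 1 appears, unlike for sequences bounded only termwise.\<close>

lemma autocorr_parseval_le:
  assumes "\<And>t. norm (\<Sum>k\<le>m. c k * ek (int k) t) \<le> M" "k \<le> m"
  shows "norm (autocorr m c k) \<le> M\<^sup>2"
proof -
  have P: "(\<Sum>k\<le>m. (norm (c k))\<^sup>2) \<le> M\<^sup>2" using parseval_le[OF assms(1)] .
  have "norm (autocorr m c k) \<le> (\<Sum>j\<le>m-k. ((norm (c (j+k)))\<^sup>2 + (norm (c j))\<^sup>2) / 2)"
    unfolding autocorr_def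
  proof (intro sum_norm_le)
    fix j
    show "norm (c (j + k) * cnj (c j)) \<le> ((norm (c (j+k)))\<^sup>2 + (norm (c j))\<^sup>2) / 2"
      using sum_squares_bound[of "norm (c (j+k))" "norm (c j)"] by (simp add: norm_mult)
  qed
  also have "\<dots> = ((\<Sum>j\<le>m-k. (norm (c (j+k)))\<^sup>2) + (\<Sum>j\<le>m-k. (norm (c j))\<^sup>2)) / 2"
    by (simp add: sum.distrib sum_divide_distrib[symmetric])
  also have "(\<Sum>j\<le>m-k. (norm (c (j+k)))\<^sup>2) = (\<Sum>j\<in>{k..m}. (norm (c j))\<^sup>2)"
    by (rule sum.reindex_bij_witness[of _ "\<lambda>j. j - k" "\<lambda>j. j + k"]) (use assms(2) in auto)
  also have "\<dots> \<le> (\<Sum>j\<le>m. (norm (c j))\<^sup>2)" by (intro sum_mono2) auto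
  also have "(\<Sum>j\<le>m-k. (norm (c j))\<^sup>2) \<le> (\<Sum>j\<le>m. (norm (c j))\<^sup>2)" by (intro sum_mono2) auto
  finally show ?thesis using P by simp
qed

text \<open>Picard iteration from 0 with rate 1/2 in the sup norm. The contraction hypothesis speaks
  of an arbitrary common bound \<open>d\<close>, so no supremum of a family is ever formed, and
  limits are taken coordinate by coordinate.\<close>

lemma coordinatewise_contraction_fixpoint:
  fixes F :: "('i \<Rightarrow> 'a::banach) \<Rightarrow> 'i \<Rightarrow> 'a"
  assumes r: "0 \<le> r"
    and ball: "\<And>x k. (\<And>j. norm (x j) \<le> r) \<Longrightarrow> norm (F x k) \<le> r"
    and contr: "\<And>x y d k. (\<And>j. norm (x j) \<le> r) \<Longrightarrow> (\<And>j. norm (y j) \<le> r) \<Longrightarrow>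
      (\<And>j. norm (x j - y j) \<le> d) \<Longrightarrow> norm (F x k - F y k) \<le> d / 2"
  obtains x where "\<And>k. norm (x k) \<le> r" "F x = x"
proof -
  define X where "X = (\<lambda>i. (F ^^ i) (\<lambda>_. 0))"
  have XS: "X (Suc i) = F (X i)" for i by (simp add: X_def)
  have Xr: "norm (X i k) \<le> r" for i k
    using r by (induction i arbitrary: k) (simp add: X_def, simp add: XS ball)
  have geo: "norm (X i k - X (i + p) k) \<le> 2 * r * (1/2) ^ i" for i p k
  proof (induction i arbitrary: k)
    case 0 show ?case using norm_triangle_ineq4[of "X 0 k" "X p k"] Xr[of 0 k] Xr[of p k] by simp
  next
    case (Suc i)
    have "norm (F (X i) k - F (X (i + p)) k) \<le> 2 * r * (1/2) ^ i / 2" by (intro contr Xr Suc)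
    thus ?case by (simp add: XS)
  qed
  have lim0: "(\<lambda>i. 2 * r * (1/2) ^ i) \<longlonglongrightarrow> 0"
    by (intro tendsto_mult_right_zero LIMSEQ_realpow_zero) auto
  have "convergent (\<lambda>i. X i k)" for k
  proof (intro Cauchy_convergent metric_CauchyI)
    fix e :: real assume "e > 0"
    then obtain M where M: "\<And>i. i \<ge> M \<Longrightarrow> norm (2 * r * (1/2) ^ i) < e / 2"
      using LIMSEQ_D[OF lim0, of "e/2"] by auto
    have *: "dist (X M k) (X i k) < e / 2" if "i \<ge> M" for i
      using geo[of M k "i - M"] M[of M] that by (simp add: dist_norm)
    show "\<exists>M. \<forall>m\<ge>M. \<forall>n\<ge>M. dist (X m k) (X n k) < e"
      using * dist_triangle_half_r by blast
  qed
  then obtain l where l: "\<And>k. (\<lambda>i. X i k) \<longlonglongrightarrow> l k"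
    unfolding convergent_def by metis
  have lr: "norm (l k) \<le> r" for k
    by (rule Lim_norm_ubound[OF _ l]) (auto simp: Xr)
  have ld: "norm (X i k - l k) \<le> 2 * r * (1/2) ^ i" for i k
  proof (rule Lim_norm_ubound)
    show "(\<lambda>p. X i k - X (i + p) k) \<longlonglongrightarrow> X i k - l k"
      using LIMSEQ_ignore_initial_segment[OF l[of k], of i] by (intro tendsto_intros) (simp add: add.commute)
  qed (auto simp: geo)
  have "F l k = l k" for k
  proof -
    have "norm (F l k - l k) \<le> 2 * r * (1/2) ^ i" for i
    proof -
      have "norm (F l k - l k) \<le> norm (F (X i) k - F l k) + norm (X (Suc i) k - l k)"
        using norm_triangle_ineq[of "F l k - F (X i) k" "F (X i) k - l k"] by (simp add: XS norm_minus_commute)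
      also have "\<dots> \<le> (2 * r * (1/2) ^ i) / 2 + 2 * r * (1/2) ^ Suc i"
        by (intro add_mono contr Xr lr ld)
      finally show ?thesis by simp
    qed
    hence "norm (F l k - l k) \<le> 0" by (intro LIMSEQ_le_const[OF lim0]) auto
    thus ?thesis by simp
  qed
  thus ?thesis using that lr by blast
qed

text \<open>A complementary polynomial \<open>b\<close> close to \<open>1\<close> is found as \<open>b = 1 + \<beta>\<close>, where the
  coefficients of \<open>\<beta>\<close> (nonnegative frequencies only) are a fixed point of the contraction
  \<open>\<beta> \<mapsto> - P\<^sub>+ (\<bar>a\<bar>\<^sup>2 + \<bar>\<beta>\<bar>\<^sup>2)\<close>, with \<open>P\<^sub>+\<close> halving the constant term.\<close>

lemma trig_poly_completion:
  assumes a: "trig_poly n a" and d: "\<And>t. norm (a t) \<le> d" and small: "8 * real (2 * n + 1) * d\<^sup>2 \<le> 1"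
  obtains b where "trig_poly (2 * n) b" "\<And>t. (norm (a t))\<^sup>2 + (norm (b t))\<^sup>2 = 1"
    "\<And>t. norm (b t - 1) \<le> 2 * real (2 * n + 1) * d\<^sup>2"
proof -
  define m where "m = 2 * n"
  obtain c where c: "\<And>t. a t = ek (- int n) t * (\<Sum>k\<le>m. c k * ek (int k) t)"
    using trig_poly_nat[OF a] unfolding m_def by blast
  have na: "norm (\<Sum>k\<le>m. c k * ek (int k) t) = norm (a t)" for t
    unfolding c norm_mult norm_ek by simp
  define s where "s = d\<^sup>2"
  \<comment> \<open>Twice the Parseval bound \<open>s\<close> for the autocorrelation of
    \<open>c\<close>: the quadratic term (m + 1) r^2 = 4 (m + 1) s * s stays below \<open>s\<close>,
    so the ball of radius \<open>r\<close> is mapped into itself.\<close>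
  define r where "r = 2 * s"
  have s0: "s \<ge> 0" by (simp add: s_def)
  have sm: "8 * real (m + 1) * s \<le> 1" using small by (simp add: m_def s_def)
  have sm4: "4 * real (m + 1) * s \<le> 1/2" using sm by (simp add: algebra_simps)
  have A: "norm (autocorr m c k) \<le> s" if "k \<le> m" for k
    unfolding s_def by (rule autocorr_parseval_le) (use d na that in auto)
  define F where "F = (\<lambda>\<beta> k. if k \<le> m then - halfwt k * (autocorr m c k + autocorr m \<beta> k) else 0)"
  have hw: "norm (halfwt k) \<le> 1" for k by (simp add: halfwt_def)
  have Fb: "norm (F \<beta> k) \<le> r" if "\<And>j. norm (\<beta> j) \<le> r" for \<beta> k
  proof (cases "k \<le> m")
    case True
    have "norm (F \<beta> k) \<le> 1 * norm (autocorr m c k + autocorr m \<beta> k)"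
      using True hw unfolding F_def by (simp add: norm_mult mult_left_le_one_le)
    also have "\<dots> \<le> s + real (m + 1) * r\<^sup>2"
      using norm_triangle_ineq[of "autocorr m c k" "autocorr m \<beta> k"] A[OF True]
        autocorr_norm_le[of m \<beta> r k] that True by simp
    also have "real (m + 1) * r\<^sup>2 = (4 * real (m + 1) * s) * s"
      by (simp add: r_def power2_eq_square)
    also have "\<dots> \<le> 1 * s" using sm4 s0 by (intro mult_right_mono) auto
    finally show ?thesis by (simp add: r_def)
  qed (use s0 in \<open>auto simp: F_def r_def\<close>)
  have Fc: "norm (F x k - F y k) \<le> d' / 2"
    if "\<And>j. norm (x j) \<le> r" "\<And>j. norm (y j) \<le> r" "\<And>j. norm (x j - y j) \<le> d'" for x y d' k
  proof (cases "k \<le> m")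
    case True
    have d': "d' \<ge> 0" using that(3) norm_ge_zero order_trans by blast
    have "norm (F x k - F y k) = norm (halfwt k) * norm (autocorr m x k - autocorr m y k)"
      unfolding F_def using True by (simp add: norm_mult[symmetric] algebra_simps norm_minus_commute)
    also have "\<dots> \<le> norm (autocorr m x k - autocorr m y k)"
      using hw by (simp add: mult_left_le_one_le)
    also have "\<dots> \<le> 2 * real (m + 1) * r * d'"
      using that True by (intro autocorr_diff_le) auto
    also have "\<dots> = (4 * real (m + 1) * s) * d'" by (simp add: r_def)
    also have "\<dots> \<le> 1/2 * d'" using sm4 d' by (intro mult_right_mono) auto
    finally show ?thesis by simp
  next
    case False
    have "d' \<ge> 0" using that(3) norm_ge_zero order_trans by blast
    thus ?thesis using False by (simp add: F_def)
  qed
  obtain \<beta> where \<beta>: "\<And>k. norm (\<beta> k) \<le> r" "F \<beta> = \<beta>"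
    by (rule coordinatewise_contraction_fixpoint[of r F]) (use Fb Fc s0 in \<open>auto simp: r_def\<close>)
  have fixp: "\<beta> k = - halfwt k * (autocorr m c k + autocorr m \<beta> k)" if "k \<le> m" for k
    using fun_cong[OF \<beta>(2), of k] that unfolding F_def by simp
  define g where "g = (\<lambda>t. \<Sum>k\<le>m. \<beta> k * ek (int k) t)"
  \<comment> \<open>The fixed point equation added to its conjugate. It reads 2 Re g = - |a|^2 -
    |g|^2, which is |a|^2 + |1 + g|^2 = 1.\<close>
  have gg: "g t + cnj (g t) = - complex_of_real ((norm (a t))\<^sup>2) - complex_of_real ((norm (g t))\<^sup>2)" for t
  proof -
    define G where "G = (\<lambda>x. \<Sum>k\<le>m. halfwt k * autocorr m x k * ek (int k) t)"
    have "g t = - G c - G \<beta>"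
      unfolding g_def G_def sum_negf[symmetric] sum_subtractf[symmetric]
      by (rule sum.cong) (auto simp: fixp algebra_simps)
    moreover have "complex_of_real ((norm (a t))\<^sup>2) = G c + cnj (G c)"
      using norm_sq_autocorr[where x=c and m=m and t=t] unfolding na G_def .
    moreover have "complex_of_real ((norm (g t))\<^sup>2) = G \<beta> + cnj (G \<beta>)"
      using norm_sq_autocorr[where x=\<beta> and m=m and t=t] unfolding g_def G_def .
    moreover have "(- G c - G \<beta>) + cnj (- G c - G \<beta>) = - (G c + cnj (G c)) - (G \<beta> + cnj (G \<beta>))"
      by simp
    ultimately show ?thesis by metis
  qed
  have nb: "(norm (a t))\<^sup>2 + (norm (1 + g t))\<^sup>2 = 1" for t
  proof -
    have "complex_of_real ((norm (1 + g t))\<^sup>2) = 1 + (g t + cnj (g t)) + complex_of_real ((norm (g t))\<^sup>2)"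
      unfolding complex_norm_square by (simp add: algebra_simps)
    also have "\<dots> = complex_of_real (1 - (norm (a t))\<^sup>2)" using gg by simp
    finally show ?thesis by (metis add.commute diff_add_cancel of_real_eq_iff)
  qed
  show ?thesis
  proof (rule that[of "\<lambda>t. 1 + g t"])
    show "trig_poly (2 * n) (\<lambda>t. 1 + g t)"
      unfolding g_def m_def by (intro trig_poly_add trig_poly_const trig_poly_of_nat_sum)
    fix t
    show "(norm (a t))\<^sup>2 + (norm (1 + g t))\<^sup>2 = 1" by (rule nb)
    \<comment> \<open>Each of the 2 n + 1 coefficients is only known to be at most \<open>r\<close>;
      this sum is the source of the factor n in the error.\<close>
    have "norm (g t) \<le> (\<Sum>k\<le>m. r)" unfolding g_def
      using \<beta>(1) by (intro sum_norm_le) (simp add: norm_mult)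
    thus "norm (1 + g t - 1) \<le> 2 * real (2 * n + 1) * d\<^sup>2"
      by (simp add: r_def m_def s_def algebra_simps)
  qed
qed

section \<open>Special unitary matrices\<close>

text \<open>The norm of the matrix type is the Frobenius norm. It dominates the spectral norm, so
  all estimates are made in it and converted at the very end.\<close>

lemma norm_le_entries:
  fixes A :: "complex^'n^'m"
  assumes "\<And>i j. norm (A $ i $ j) \<le> e"
  shows "norm A \<le> real (CARD('m) * CARD('n)) * e"
proof -
  have "norm A \<le> (\<Sum>i\<in>UNIV. norm (A $ i))"
    unfolding norm_vec_def by (rule L2_set_le_sum) simp
  also have "\<dots> \<le> (\<Sum>i\<in>(UNIV::'m set). \<Sum>j\<in>(UNIV::'n set). e)"
  proof (rule sum_mono)
    fix i
    have "norm (A $ i) \<le> (\<Sum>j\<in>UNIV. norm (A $ i $ j))"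
      unfolding norm_vec_def by (rule L2_set_le_sum) simp
    also have "\<dots> \<le> (\<Sum>j\<in>(UNIV::'n set). e)" by (intro sum_mono assms)
    finally show "norm (A $ i) \<le> (\<Sum>j\<in>(UNIV::'n set). e)" .
  qed
  finally show ?thesis by simp
qed

lemma norm_entry_le:
  fixes A :: "complex^'n^'m" shows "norm (A $ i $ j) \<le> norm A"
  by (rule order_trans[OF Finite_Cartesian_Product.norm_nth_le Finite_Cartesian_Product.norm_nth_le])

text \<open>Row i of A B combines the rows of B with coefficients from row i of A; Cauchy-Schwarz
  then bounds it by the Frobenius norm of B.\<close>

lemma norm_matrix_mult_le:
  fixes A B :: "complex^'n^'n"
  shows "norm (A ** B) \<le> norm A * norm B"
proof -
  have row: "norm ((A ** B) $ i) \<le> norm (A $ i) * norm B" for i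
  proof -
    have "(A ** B) $ i = (\<Sum>k\<in>UNIV. A $ i $ k *s B $ k)"
      by (simp add: matrix_matrix_mult_def vec_eq_iff)
    hence "norm ((A ** B) $ i) \<le> (\<Sum>k\<in>UNIV. norm (A $ i $ k *s B $ k))"
      by (simp add: norm_sum)
    also have "\<dots> = (\<Sum>k\<in>UNIV. \<bar>norm (A $ i $ k)\<bar> * \<bar>norm (B $ k)\<bar>)"
      by (simp add: norm_vec_def norm_mult L2_set_right_distrib)
    also have "\<dots> \<le> norm (A $ i) * norm B"
      unfolding norm_vec_def[of "A $ i"] norm_vec_def[of B] by (rule L2_set_mult_ineq)
    finally show ?thesis .
  qed
  have "norm (A ** B) = L2_set (\<lambda>i. norm ((A ** B) $ i)) UNIV" by (simp add: norm_vec_def)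
  also have "\<dots> \<le> L2_set (\<lambda>i. norm (A $ i) * norm B) UNIV"
    by (rule L2_set_mono) (auto simp: row)
  also have "\<dots> = norm A * norm B"
    unfolding norm_vec_def[of A] by (simp add: L2_set_left_distrib)
  finally show ?thesis .
qed

section \<open>Adjoints and the group SU(N)\<close>

lemma cadjoint_mult: "cadjoint (A ** B) = cadjoint B ** cadjoint (A :: complex^'n^'n)"
  by (simp add: cadjoint_def matrix_matrix_mult_def vec_eq_iff mult.commute)

lemma cadjoint_cadjoint [simp]: "cadjoint (cadjoint A) = A"
  by (simp add: cadjoint_def vec_eq_iff)

lemma cadjoint_mat_1 [simp]: "cadjoint (mat 1) = mat 1"
  by (simp add: cadjoint_def vec_eq_iff mat_def)

lemma cadjoint_add: "cadjoint (A + B) = cadjoint A + cadjoint B"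
  by (simp add: cadjoint_def vec_eq_iff)

lemma cadjoint_nth [simp]: "cadjoint A $ i $ j = cnj (A $ j $ i)"
  by (simp add: cadjoint_def)

lemma norm_cadjoint [simp]: "norm (cadjoint A) = norm A"
proof -
  have "(norm A)\<^sup>2 = (\<Sum>i\<in>UNIV. \<Sum>j\<in>UNIV. (norm (A $ i $ j))\<^sup>2)" for A :: "complex^'n^'n"
    by (simp add: norm_vec_def L2_set_def sum_nonneg)
  note sq = this
  have "(norm (cadjoint A))\<^sup>2 = (norm A)\<^sup>2"
    unfolding sq by (subst sum.swap) simp
  thus ?thesis by simp
qed

lemma det_cadjoint: "det (cadjoint A) = cnj (det A)"
proof -
  have "det (cadjoint A) = det (transpose (\<chi> i j. cnj (A $ i $ j)))"
    by (rule arg_cong[where f = det]) (simp add: transpose_def cadjoint_def)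
  also have "\<dots> = det (\<chi> i j. cnj (A $ i $ j))" by (rule det_transpose)
  also have "\<dots> = cnj (det A)" by (simp add: det_def)
  finally show ?thesis .
qed

lemma SU_I:
  assumes "A ** cadjoint A = mat 1" "det A = 1" shows "A \<in> SU"
  using assms matrix_left_right_inverse[of A "cadjoint A"] by (simp add: SU_def)

lemma SU_mult: assumes "A \<in> SU" "B \<in> SU" shows "A ** B \<in> SU"
proof (rule SU_I)
  have "A ** B ** cadjoint (A ** B) = A ** (B ** cadjoint B) ** cadjoint A"
    by (simp add: cadjoint_mult matrix_mul_assoc)
  thus "A ** B ** cadjoint (A ** B) = mat 1" using assms by (simp add: SU_def)
qed (use assms in \<open>simp add: SU_def det_mul\<close>)

lemma SU_cadjoint: "A \<in> SU \<Longrightarrow> cadjoint A \<in> SU"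
  by (simp add: SU_def det_cadjoint)

lemma SU_mat_1: "mat 1 \<in> SU" by (simp add: SU_def)

lemma SU_cancel_left: "A \<in> SU \<Longrightarrow> A ** (cadjoint A ** B) = B"
  "A \<in> SU \<Longrightarrow> cadjoint A ** (A ** B) = B"
  by (simp_all add: SU_def matrix_mul_assoc)

lemma unitary_entry_le:
  assumes "A ** cadjoint A = mat 1" shows "norm (A $ i $ j) \<le> 1"
proof -
  have "(A ** cadjoint A) $ i $ i = 1" using assms by (simp add: mat_def)
  hence "(\<Sum>k\<in>UNIV. of_real ((norm (A $ i $ k))\<^sup>2)) = (1 :: complex)"
    by (simp only: complex_norm_square) (simp add: matrix_matrix_mult_def)
  hence s: "(\<Sum>k\<in>UNIV. (norm (A $ i $ k))\<^sup>2) = 1"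
    by (metis of_real_eq_1_iff of_real_sum)
  have "(norm (A $ i $ j))\<^sup>2 \<le> 1"
    unfolding s[symmetric] by (rule member_le_sum) auto
  thus ?thesis by (simp add: power_le_one_iff)
qed

lemma SU_entry_le: "A \<in> SU \<Longrightarrow> norm (A $ i $ j) \<le> 1"
  by (rule unitary_entry_le) (simp add: SU_def)

text \<open>One crude constant for the entrywise norm comparison and for the norm of a unitary. What
  matters is that it is independent of the degree and of the loop.\<close>

definition dim2 :: "'n itself \<Rightarrow> real" where
  "dim2 _ = real (CARD('n) * CARD('n))"

lemma dim2_ge_1: "dim2 TYPE('n::finite) \<ge> 1"
proof -
  have "CARD('n) * CARD('n) \<ge> 1" using zero_less_card_finite by (simp add: Suc_leI)
  thus ?thesis unfolding dim2_def by linarith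
qed

lemma SU_norm_le: "(A :: complex^'n^'n) \<in> SU \<Longrightarrow> norm A \<le> dim2 TYPE('n)"
  using norm_le_entries[of A 1] SU_entry_le[of A] by (simp add: dim2_def)

lemma poly_loop_mult:
  assumes "poly_loop n A" "poly_loop m B" shows "poly_loop (n + m) (\<lambda>t. A t ** B t)"
  using assms unfolding poly_loop_def
  by (auto simp: matrix_matrix_mult_def intro!: trig_poly_sum trig_poly_mult)

lemma poly_loop_cadjoint: "poly_loop n A \<Longrightarrow> poly_loop n (\<lambda>t. cadjoint (A t))"
  unfolding poly_loop_def by (auto intro: trig_poly_cnj)

lemma poly_loop_const: "poly_loop n (\<lambda>t. A)"
  unfolding poly_loop_def by (auto intro: trig_poly_const)

lemma poly_loop_diff: "poly_loop n A \<Longrightarrow> poly_loop n B \<Longrightarrow> poly_loop n (\<lambda>t. A t - B t)"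
  unfolding poly_loop_def by (auto intro: trig_poly_diff)

lemma poly_loop_mono: "poly_loop n A \<Longrightarrow> n \<le> m \<Longrightarrow> poly_loop m A"
  unfolding poly_loop_def by (auto intro: trig_poly_mono)

text \<open>An SU(2) block with rows (b, a) and (- cnj a, cnj b), embedded in coordinates i and
  j.\<close>

definition rotation :: "'n \<Rightarrow> 'n \<Rightarrow> complex \<Rightarrow> complex \<Rightarrow> complex^'n^'n" where
  "rotation i j a b = (\<chi> k l.
     if k = i then (if l = i then b else if l = j then a else 0)
     else if k = j then (if l = i then - cnj a else if l = j then cnj b else 0)
     else if k = l then 1 else 0)"

text \<open>The tangent direction of \<open>rotation i j a b\<close> at a = 0, b = 1: an
  off-diagonal element of su(N).\<close>

definition skew :: "'n \<Rightarrow> 'n \<Rightarrow> complex \<Rightarrow> complex^'n^'n" where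
  "skew i j a = (\<chi> k l. if k = i \<and> l = j then a else if k = j \<and> l = i then - cnj a else 0)"

lemma sum_split2:
  fixes f :: "'n::finite \<Rightarrow> 'a::comm_monoid_add"
  assumes "i \<noteq> j" shows "sum f UNIV = f i + (f j + sum f (- {i, j}))"
proof -
  have "sum f UNIV = sum f ({i, j} \<union> - {i, j})" by simp
  also have "\<dots> = sum f {i, j} + sum f (- {i, j})" by (rule sum.union_disjoint) auto
  finally show ?thesis using assms by (simp add: add.assoc)
qed

lemma rotation_unitary:
  fixes i j :: "'n::finite"
  assumes ij: "i \<noteq> j" and ab: "(norm a)\<^sup>2 + (norm b)\<^sup>2 = 1"
  shows "rotation i j a b ** cadjoint (rotation i j a b) = mat 1"
proof -
  have ab': "a * cnj a + b * cnj b = 1"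
    using ab by (metis complex_norm_square of_real_1 of_real_add)
  have "(\<Sum>p\<in>UNIV. rotation i j a b $ k $ p * cnj (rotation i j a b $ l $ p)) = (if k = l then 1 else 0)" for k l
  proof -
    have "(\<Sum>p\<in>- {i,j}. rotation i j a b $ k $ p * cnj (rotation i j a b $ l $ p))
       = (\<Sum>p\<in>- {i,j}. if p = k then (if k = l then 1 else 0) else 0)"
      by (rule sum.cong) (auto simp: rotation_def)
    thus ?thesis unfolding sum_split2[OF ij] using ij ab'
      by (auto simp: rotation_def algebra_simps)
  qed
  thus ?thesis by (simp add: vec_eq_iff matrix_matrix_mult_def mat_def)
qed

text \<open>The block arises from diag(b, 1/b) by two row operations; its last entry 1/b - |a|^2/b
  equals cnj b because |a|^2 + |b|^2 = 1.\<close>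

lemma det_rotation:
  fixes i j :: "'n::finite"
  assumes ij: "i \<noteq> j" and ab: "(norm a)\<^sup>2 + (norm b)\<^sup>2 = 1" and b: "b \<noteq> 0"
  shows "det (rotation i j a b) = 1"
proof -
  have ab': "a * cnj a + b * cnj b = 1"
    using ab by (metis complex_norm_square of_real_1 of_real_add)
  define D :: "complex^'n^'n" where
    "D = (\<chi> k l. if k = l then (if k = i then b else if k = j then 1 / b else 1) else 0)"
  define A where "A = (\<chi> k. if k = i then row i D + (a * b) *s row j D else row k D)"
  define B where "B = (\<chi> k. if k = j then row j A + (- cnj a / b) *s row i A else row k A)"
  have "B = rotation i j a b"
    using ij b ab' by (auto simp: vec_eq_iff B_def A_def D_def rotation_def row_def field_simps)
  moreover have "det B = det A" unfolding B_def by (rule det_row_operation) (use ij in auto)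
  moreover have "det A = det D" unfolding A_def by (rule det_row_operation[OF ij])
  moreover have "det D = 1"
  proof -
    have "det D = (\<Prod>k\<in>UNIV. D $ k $ k)" by (rule det_diagonal) (simp add: D_def)
    also have "\<dots> = (\<Prod>k\<in>{i, j}. D $ k $ k)"
      by (rule prod.mono_neutral_right) (auto simp: D_def)
    also have "\<dots> = 1" using ij b by (simp add: D_def)
    finally show ?thesis .
  qed
  ultimately show ?thesis by simp
qed

lemma rotation_SU:
  assumes "i \<noteq> j" "(norm a)\<^sup>2 + (norm b)\<^sup>2 = 1" "b \<noteq> 0"
  shows "rotation i j a b \<in> SU"
  using assms by (intro SU_I rotation_unitary det_rotation)

lemma rotation_skew_norm:
  fixes i j :: "'n::finite"
  assumes "i \<noteq> j" "norm (b - 1) \<le> e"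
  shows "norm (rotation i j a b - (mat 1 + skew i j a)) \<le> dim2 TYPE('n) * e"
  unfolding dim2_def
proof (rule norm_le_entries)
  fix k l
  have "e \<ge> 0" using assms(2) norm_ge_zero order_trans by blast
  moreover have "norm (cnj b - 1) \<le> e"
    using assms(2) by (metis complex_cnj_diff complex_cnj_one complex_mod_cnj)
  ultimately show "norm ((rotation i j a b - (mat 1 + skew i j a)) $ k $ l) \<le> e"
    using assms by (auto simp: rotation_def skew_def mat_def)
qed

lemma poly_loop_rotation:
  assumes "trig_poly n a" "trig_poly n b"
  shows "poly_loop n (\<lambda>t. rotation i j (a t) (b t))"
  unfolding poly_loop_def
proof (intro allI)
  fix k l
  show "trig_poly n (\<lambda>t. rotation i j (a t) (b t) $ k $ l)"
    by (cases "k = i"; cases "l = i"; cases "k = j"; cases "l = j"; cases "k = l")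
       (use assms in \<open>auto simp: rotation_def intro: trig_poly_const trig_poly_cnj trig_poly_minus\<close>)
qed

section \<open>Polynomial loops with prescribed derivative at the identity\<close>

text \<open>\<open>P\<close> is a polynomial substitute for exp X: exactly special unitary, of
  degree a fixed multiple of \<open>n\<close>, correct to first order. \<open>n\<close> and
  \<open>d\<close> stand for the degree and size of \<open>X\<close>; \<open>M\<close> and
  \<open>C\<close> are what must stay uniform in them.\<close>

definition realizable :: "nat \<Rightarrow> real \<Rightarrow> nat \<Rightarrow> real \<Rightarrow> (real \<Rightarrow> complex^'n^'n) \<Rightarrow> bool" where
  "realizable n d M C X \<longleftrightarrow> (\<exists>P. poly_loop (M * n) P \<and> (\<forall>t. P t \<in> SU) \<and>
     (\<forall>t. norm (P t - (mat 1 + X t)) \<le> C * (real n + 1) * d\<^sup>2))"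

lemma realizable_zero: "realizable n d 0 0 (\<lambda>t. 0)"
  unfolding realizable_def by (intro exI[of _ "\<lambda>t. mat 1"]) (simp add: poly_loop_const SU_mat_1)

lemma norm_mat_1_le: "norm (mat 1 :: complex^'n^'n) \<le> dim2 TYPE('n)"
  by (rule SU_norm_le[OF SU_mat_1])

lemma matrix_diff_ldistrib: "(A :: complex^'n^'n) ** (B - C) = A ** B - A ** C"
  using matrix_add_ldistrib[of A "B - C" C] by (simp add: algebra_simps)

lemma matrix_add_rdistrib: "((A :: complex^'n^'n) + B) ** C = A ** C + B ** C"
  by (simp add: matrix_matrix_mult_def vec_eq_iff sum.distrib distrib_right)

lemma matrix_diff_rdistrib: "((A :: complex^'n^'n) - B) ** C = A ** C - B ** C"
  using matrix_add_rdistrib[of "A - B" B C] by (simp add: algebra_simps)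

text \<open>The product of the two realizing loops is I + X + Y up to X Y, which is quadratic in
  \<open>d\<close>, and the two given errors, each multiplied by a bounded factor.\<close>

lemma realizable_add:
  fixes X Y :: "real \<Rightarrow> complex^'n^'n"
  assumes X: "realizable n d M C X" and Y: "realizable n d M' C' Y"
    and bX: "\<And>t. norm (X t) \<le> B * d" and bY: "\<And>t. norm (Y t) \<le> B' * d"
    and d: "0 \<le> d" "(real n + 1) * d \<le> 1" and nn: "0 \<le> B" "0 \<le> B'" "0 \<le> C" "0 \<le> C'"
  shows "realizable n d (M + M') (C * dim2 TYPE('n) + (dim2 TYPE('n) + B) * C' + B * B') (\<lambda>t. X t + Y t)"
proof -
  let ?D = "dim2 TYPE('n)"
  have d1: "d \<le> 1" using d(2) mult_right_mono[OF _ d(1), of 1 "real n + 1"] by simp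
  obtain P where P: "poly_loop (M * n) P" "\<And>t. P t \<in> SU"
     "\<And>t. norm (P t - (mat 1 + X t)) \<le> C * (real n + 1) * d\<^sup>2" using X unfolding realizable_def by blast
  obtain Q where Q: "poly_loop (M' * n) Q" "\<And>t. Q t \<in> SU"
     "\<And>t. norm (Q t - (mat 1 + Y t)) \<le> C' * (real n + 1) * d\<^sup>2" using Y unfolding realizable_def by blast
  have "norm (P t ** Q t - (mat 1 + (X t + Y t)))
      \<le> (C * ?D + (?D + B) * C' + B * B') * (real n + 1) * d\<^sup>2" for t
  proof -
    have eq: "P t ** Q t - (mat 1 + (X t + Y t)) = (P t - (mat 1 + X t)) ** Q t
        + (mat 1 + X t) ** (Q t - (mat 1 + Y t)) + X t ** Y t"
      by (simp add: matrix_diff_ldistrib matrix_diff_rdistrib matrix_add_ldistrib matrix_add_rdistrib algebra_simps)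
    have 1: "norm ((P t - (mat 1 + X t)) ** Q t) \<le> (C * (real n + 1) * d\<^sup>2) * ?D"
      using norm_matrix_mult_le by (rule order_trans) (intro mult_mono P Q SU_norm_le, use nn in auto)
    have "norm (mat 1 + X t) \<le> ?D + B * d"
      using norm_triangle_ineq[of "mat 1" "X t"] norm_mat_1_le[where 'n='n] bX[of t] by linarith
    also have "\<dots> \<le> ?D + B" using nn d1 by (simp add: mult_left_le)
    finally have 2: "norm ((mat 1 + X t) ** (Q t - (mat 1 + Y t))) \<le> (?D + B) * (C' * (real n + 1) * d\<^sup>2)"
      using norm_matrix_mult_le[of "mat 1 + X t"] Q(3)[of t] nn dim2_ge_1[where 'n='n]
      by (meson mult_mono norm_ge_zero order_trans)
    have "norm (X t ** Y t) \<le> (B * d) * (B' * d)"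
      using norm_matrix_mult_le by (rule order_trans) (intro mult_mono bX bY, use nn d in auto)
    also have "\<dots> = B * B' * d\<^sup>2 * 1" by (simp add: power2_eq_square)
    also have "\<dots> \<le> B * B' * d\<^sup>2 * (real n + 1)" using nn by (intro mult_left_mono) auto
    finally have 3: "norm (X t ** Y t) \<le> B * B' * d\<^sup>2 * (real n + 1)" .
    show ?thesis unfolding eq
      using norm_triangle_ineq[of "(P t - (mat 1 + X t)) ** Q t + (mat 1 + X t) ** (Q t - (mat 1 + Y t))" "X t ** Y t"]
        norm_triangle_ineq[of "(P t - (mat 1 + X t)) ** Q t" "(mat 1 + X t) ** (Q t - (mat 1 + Y t))"] 1 2 3
      by (simp add: algebra_simps)
  qed
  moreover have "poly_loop ((M + M') * n) (\<lambda>t. P t ** Q t)"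
    using poly_loop_mult[OF P(1) Q(1)] by (simp add: algebra_simps)
  ultimately show ?thesis unfolding realizable_def
    by (intro exI[of _ "\<lambda>t. P t ** Q t"]) (use P(2) Q(2) in \<open>auto intro: SU_mult\<close>)
qed

text \<open>The order of quantifiers is the point: the constants come before \<open>n\<close>,
  \<open>d\<close> and the summands, hence do not depend on them.\<close>

lemma realizable_sum:
  fixes F :: "'i set"
  assumes "finite F" "0 \<le> B" "0 \<le> C"
  shows "\<exists>M' C' B'. 0 \<le> C' \<and> 0 \<le> B' \<and> (\<forall>n d (X :: 'i \<Rightarrow> real \<Rightarrow> complex^'n^'n). 0 \<le> d \<longrightarrow> (real n + 1) * d \<le> 1 \<longrightarrow>
     (\<forall>i\<in>F. realizable n d M C (X i) \<and> (\<forall>t. norm (X i t) \<le> B * d)) \<longrightarrow>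
     realizable n d M' C' (\<lambda>t. \<Sum>i\<in>F. X i t) \<and> (\<forall>t. norm (\<Sum>i\<in>F. X i t) \<le> B' * d))"
  using assms(1)
proof (induction F rule: finite_induct)
  case empty
  show ?case by (intro exI[of _ 0]) (simp add: realizable_zero)
next
  case (insert x F)
  then obtain M' C' B' where IH: "0 \<le> C'" "0 \<le> B'"
    "\<forall>n d (X :: 'i \<Rightarrow> real \<Rightarrow> complex^'n^'n). 0 \<le> d \<longrightarrow> (real n + 1) * d \<le> 1 \<longrightarrow>
     (\<forall>i\<in>F. realizable n d M C (X i) \<and> (\<forall>t. norm (X i t) \<le> B * d)) \<longrightarrow>
     realizable n d M' C' (\<lambda>t. \<Sum>i\<in>F. X i t) \<and> (\<forall>t. norm (\<Sum>i\<in>F. X i t) \<le> B' * d)"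
    by blast
  let ?C = "C * dim2 TYPE('n) + (dim2 TYPE('n) + B) * C' + B * B'"
  have "0 \<le> ?C" using assms IH(1,2) dim2_ge_1[where 'n='n] by simp
  moreover have "realizable n d (M + M') ?C (\<lambda>t. \<Sum>i\<in>insert x F. X i t) \<and>
      (\<forall>t. norm (\<Sum>i\<in>insert x F. X i t) \<le> (B + B') * d)"
    if "0 \<le> d" "(real n + 1) * d \<le> 1"
      "\<forall>i\<in>insert x F. realizable n d M C (X i) \<and> (\<forall>t. norm (X i t) \<le> B * d)"
    for n d and X :: "'i \<Rightarrow> real \<Rightarrow> complex^'n^'n"
  proof -
    have F: "realizable n d M' C' (\<lambda>t. \<Sum>i\<in>F. X i t)" "\<And>t. norm (\<Sum>i\<in>F. X i t) \<le> B' * d"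
      using IH(3)[rule_format, of d n X] that by auto
    have "realizable n d (M + M') ?C (\<lambda>t. X x t + (\<Sum>i\<in>F. X i t))"
      by (rule realizable_add[OF _ F(1) _ F(2)]) (use that assms IH in auto)
    moreover have "norm (X x t + (\<Sum>i\<in>F. X i t)) \<le> (B + B') * d" for t
      using norm_triangle_ineq[of "X x t" "\<Sum>i\<in>F. X i t"] F(2)[of t] that(3)
      by (simp add: algebra_simps) (smt (verit))
    ultimately show ?thesis using insert.hyps by simp
  qed
  ultimately show ?case using assms IH(1,2)
    by (intro exI[of _ "M + M'"] exI[of _ ?C] exI[of _ "B + B'"]) auto
qed

lemma realizable_conjugate:
  fixes X :: "real \<Rightarrow> complex^'n^'n"
  assumes X: "realizable n d M C X" and T: "T \<in> SU" and "0 \<le> C"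
  shows "realizable n d M ((dim2 TYPE('n))\<^sup>2 * C) (\<lambda>t. T ** X t ** cadjoint T)"
proof -
  let ?D = "dim2 TYPE('n)"
  obtain P where P: "poly_loop (M * n) P" "\<And>t. P t \<in> SU"
     "\<And>t. norm (P t - (mat 1 + X t)) \<le> C * (real n + 1) * d\<^sup>2" using X unfolding realizable_def by blast
  have "norm (T ** P t ** cadjoint T - (mat 1 + T ** X t ** cadjoint T)) \<le> ?D\<^sup>2 * C * (real n + 1) * d\<^sup>2" for t
  proof -
    have "T ** P t ** cadjoint T - (mat 1 + T ** X t ** cadjoint T) = T ** (P t - (mat 1 + X t)) ** cadjoint T"
      using T by (simp add: SU_def matrix_diff_ldistrib matrix_diff_rdistrib matrix_add_ldistrib matrix_add_rdistrib algebra_simps)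
    also have "norm \<dots> \<le> norm (T ** (P t - (mat 1 + X t))) * norm T"
      using norm_matrix_mult_le[of "T ** (P t - (mat 1 + X t))" "cadjoint T"] by simp
    also have "\<dots> \<le> (norm T * norm (P t - (mat 1 + X t))) * norm T"
      by (intro mult_right_mono norm_matrix_mult_le) auto
    also have "\<dots> \<le> (?D * (C * (real n + 1) * d\<^sup>2)) * ?D"
      using T dim2_ge_1[where 'n='n] by (intro mult_mono SU_norm_le P(3)) (auto simp: assms)
    finally show ?thesis by (simp add: power2_eq_square mult_ac)
  qed
  moreover have "poly_loop (M * n) (\<lambda>t. T ** P t ** cadjoint T)"
    using poly_loop_mult[OF poly_loop_mult[OF poly_loop_const[of 0 T] P(1)] poly_loop_const[of 0 "cadjoint T"]]
    by simp
  ultimately show ?thesis unfolding realizable_def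
    by (intro exI[of _ "\<lambda>t. T ** P t ** cadjoint T"]) (use P(2) T in \<open>auto intro: SU_mult SU_cadjoint\<close>)
qed

text \<open>The completion b = 1 + O(n d^2) of \<open>a\<close> makes the rotation correct to first
  order. The bound 16 (n + 1) d <= 1 yields both the smallness needed for the completion and d <=
  1/16, hence |a| < 1 and \<open>b\<close> has no zeros.\<close>

lemma realizable_skew:
  fixes i j :: "'n::finite"
  assumes a: "trig_poly n a" and bd: "\<And>t. norm (a t) \<le> d" and d: "0 \<le> d" "16 * (real n + 1) * d \<le> 1"
    and ij: "i \<noteq> j"
  shows "realizable n d 2 (4 * dim2 TYPE('n)) (\<lambda>t. skew i j (a t))"
proof -
  have "16 * d \<le> 16 * (real n + 1) * d" using d(1) by (intro mult_right_mono) auto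
  hence d1: "d \<le> 1/16" using d(2) by linarith
  have "8 * real (2 * n + 1) * d\<^sup>2 \<le> (16 * (real n + 1) * d) * d"
    using d(1) by (simp add: power2_eq_square algebra_simps)
  also have "\<dots> \<le> 1 * 1" using d d1 by (intro mult_mono) auto
  finally have "8 * real (2 * n + 1) * d\<^sup>2 \<le> 1" by simp
  from trig_poly_completion[OF a bd this] obtain b where b: "trig_poly (2 * n) b"
    "\<And>t. (norm (a t))\<^sup>2 + (norm (b t))\<^sup>2 = 1" "\<And>t. norm (b t - 1) \<le> 2 * real (2 * n + 1) * d\<^sup>2" by metis
  have b0: "b t \<noteq> 0" for t
  proof
    assume "b t = 0"
    hence "(norm (a t))\<^sup>2 = 1" using b(2)[of t] by simp
    hence "norm (a t) = 1" by (simp add: power2_eq_1_iff) (smt (verit) norm_ge_zero)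
    thus False using bd[of t] d1 by simp
  qed
  have "norm (rotation i j (a t) (b t) - (mat 1 + skew i j (a t))) \<le> dim2 TYPE('n) * (4 * (real n + 1) * d\<^sup>2)" for t
  proof (rule rotation_skew_norm[OF ij])
    have "2 * real (2 * n + 1) * d\<^sup>2 \<le> 4 * (real n + 1) * d\<^sup>2"
      by (intro mult_right_mono) auto
    thus "norm (b t - 1) \<le> 4 * (real n + 1) * d\<^sup>2" using b(3)[of t] by linarith
  qed
  moreover have "poly_loop (2 * n) (\<lambda>t. rotation i j (a t) (b t))"
    using b(1) trig_poly_mono[OF a, of "2*n"] by (intro poly_loop_rotation) auto
  ultimately show ?thesis unfolding realizable_def
    by (intro exI[of _ "\<lambda>t. rotation i j (a t) (b t)"]) (use rotation_SU[OF ij b(2) b0] in \<open>auto simp: mult_ac\<close>)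
qed

text \<open>Diagonal directions are out of reach of diagonal polynomial loops, since a unimodular
  trigonometric polynomial is a monomial. They are obtained as conjugates of real off-diagonal
  directions by a constant rotation that diagonalizes the real skew block.\<close>

lemma conj_skew:
  fixes i j :: "'n::finite"
  assumes ij: "i \<noteq> j"
  defines "T \<equiv> rotation i j (\<i> / of_real (sqrt 2)) (1 / of_real (sqrt 2))"
  shows "T \<in> SU"
    "T ** skew i j (of_real y) ** cadjoint T =
      (\<chi> k l. if k = l then (if k = i then - \<i> * of_real y else if k = j then \<i> * of_real y else 0) else 0)"
proof -
  show "T \<in> SU" unfolding T_def
    by (intro rotation_SU ij) (auto simp: norm_divide power_divide)
  have s2: "complex_of_real (sqrt 2) * complex_of_real (sqrt 2) = 2"
    by (metis of_real_mult of_real_numeral real_sqrt_mult_self abs_numeral)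
  have en: "(T ** skew i j (of_real y) ** cadjoint T) $ k $ l =
     (T $ k $ i * cnj (T $ l $ j) - T $ k $ j * cnj (T $ l $ i)) * of_real y" for k l
  proof -
    have r: "(T ** skew i j (of_real y)) $ k $ q =
        (if q = j then T $ k $ i * of_real y else if q = i then - T $ k $ j * of_real y else 0)" for q
      using ij unfolding matrix_matrix_mult_def vec_lambda_beta sum_split2[OF ij]
      by (auto simp: skew_def intro!: sum.neutral)
    have "(T ** skew i j (of_real y) ** cadjoint T) $ k $ l
        = (\<Sum>q\<in>UNIV. (T ** skew i j (of_real y)) $ k $ q * cnj (T $ l $ q))"
      by (simp add: matrix_matrix_mult_def[of "T ** skew i j (of_real y)"])
    moreover have "(\<Sum>q\<in>- {i, j}. (if q = j then T $ k $ i * of_real y else if q = i then - T $ k $ j * of_real y else 0) * cnj (T $ l $ q)) = 0"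
      by (rule sum.neutral) auto
    ultimately show ?thesis using ij unfolding r sum_split2[OF ij]
      by (simp add: algebra_simps)
  qed
  show "T ** skew i j (of_real y) ** cadjoint T =
      (\<chi> k l. if k = l then (if k = i then - \<i> * of_real y else if k = j then \<i> * of_real y else 0) else 0)"
    unfolding vec_eq_iff en using ij s2 by (auto simp: T_def rotation_def field_simps)
qed

lemma norm_skew_le:
  fixes i j :: "'n::finite"
  assumes "norm a \<le> d" shows "norm (skew i j a) \<le> dim2 TYPE('n) * d"
  unfolding dim2_def
proof (rule norm_le_entries)
  have "0 \<le> d" using assms norm_ge_zero order_trans by blast
  thus "norm (skew i j a $ k $ l) \<le> d" for k l using assms by (simp add: skew_def)
qed

lemma skew_nth_eq_0:
  "\<not> (p = i \<and> q = j) \<Longrightarrow> \<not> (p = j \<and> q = i) \<Longrightarrow> skew i j a $ p $ q = 0"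
  unfolding skew_def vec_lambda_beta by (simp only: if_False)

text \<open>An off-diagonal entry is split evenly between the ordered pairs (k, l) and (l, k), whose
  contributions agree by skew symmetry. On the diagonal each k other than \<open>k0\<close>
  contributes X_kk at k and - X_kk at \<open>k0\<close>; trace zero makes the latter add up to the
  entry at \<open>k0\<close>.\<close>

lemma skew_hermitian_decomposition:
  fixes X :: "complex^'n^'n" and k0 :: 'n
  assumes ah: "\<And>k l. X $ k $ l = - cnj (X $ l $ k)" and tr: "(\<Sum>k\<in>UNIV. X $ k $ k) = 0"
  defines "T \<equiv> \<lambda>k. rotation k0 k (\<i> / of_real (sqrt 2)) (1 / of_real (sqrt 2))"
  shows "X = (\<Sum>(k,l)\<in>{(k,l). k \<noteq> l}. skew k l (X $ k $ l / 2))
    + (\<Sum>k\<in>-{k0}. T k ** skew k0 k (- \<i> * X $ k $ k) ** cadjoint (T k))"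
proof -
  have re: "Re (X $ k $ k) = 0" for k using ah[of k k] by (simp add: complex_eq_iff)
  have di: "- \<i> * X $ k $ k = of_real (Im (X $ k $ k))" for k
    using re[of k] by (simp add: complex_eq_iff)
  have xk: "\<i> * of_real (Im (X $ k $ k)) = X $ k $ k" for k
    using re[of k] by (simp add: complex_eq_iff)
  have "((\<Sum>(k,l)\<in>{(k,l). k \<noteq> l}. skew k l (X $ k $ l / 2))
    + (\<Sum>k\<in>-{k0}. T k ** skew k0 k (- \<i> * X $ k $ k) ** cadjoint (T k))) $ p $ q = X $ p $ q" for p q
  proof (cases "p = q")
    case False
    have "(\<Sum>k\<in>-{k0}. (T k ** skew k0 k (- \<i> * X $ k $ k) ** cadjoint (T k)) $ p $ q) = 0"
    proof (intro sum.neutral ballI)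
      fix k assume "k \<in> - {k0}"
      hence "k0 \<noteq> k" by auto
      thus "(T k ** skew k0 k (- \<i> * X $ k $ k) ** cadjoint (T k)) $ p $ q = 0"
        unfolding T_def di conj_skew(2)[OF \<open>k0 \<noteq> k\<close>] using False by simp
    qed
    moreover have "(\<Sum>kl\<in>{(k,l). k \<noteq> l}. (case kl of (k, l) \<Rightarrow> skew k l (X $ k $ l / 2)) $ p $ q)
      = (\<Sum>kl\<in>{(p,q), (q,p)}. (case kl of (k, l) \<Rightarrow> skew k l (X $ k $ l / 2)) $ p $ q)"
    proof (intro sum.mono_neutral_right ballI)
      fix kl assume kl: "kl \<in> {(k,l). k \<noteq> l} - {(p,q), (q,p)}"
      obtain a b where ab: "kl = (a, b)" by (cases kl)
      have "\<not> (p = a \<and> q = b)" "\<not> (p = b \<and> q = a)" using kl ab by auto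
      thus "(case kl of (k, l) \<Rightarrow> skew k l (X $ k $ l / 2)) $ p $ q = 0"
        unfolding ab prod.case by (rule skew_nth_eq_0)
    qed (use False in auto)
    moreover have "\<dots> = X $ p $ q"
    proof -
      have "cnj (X $ q $ p) = - X $ p $ q" using ah[of p q] by (metis minus_minus)
      thus ?thesis using False by (simp add: skew_def)
    qed
    ultimately show ?thesis by simp
  next
    case True
    have "(\<Sum>kl\<in>{(k,l). k \<noteq> l}. (case kl of (k, l) \<Rightarrow> skew k l (X $ k $ l / 2)) $ p $ q) = 0"
      by (rule sum.neutral) (auto simp: skew_def True)
    moreover have "(\<Sum>k\<in>-{k0}. (T k ** skew k0 k (- \<i> * X $ k $ k) ** cadjoint (T k)) $ p $ q)
       = (\<Sum>k\<in>-{k0}. if p = k0 then - X $ k $ k else if p = k then X $ k $ k else 0)"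
    proof (rule sum.cong)
      fix k assume "k \<in> - {k0}"
      hence "k0 \<noteq> k" by auto
      thus "(T k ** skew k0 k (- \<i> * X $ k $ k) ** cadjoint (T k)) $ p $ q
          = (if p = k0 then - X $ k $ k else if p = k then X $ k $ k else 0)"
        unfolding T_def di conj_skew(2)[OF \<open>k0 \<noteq> k\<close>] using xk[of k] True by simp
    qed simp
    moreover have "\<dots> = X $ p $ p"
    proof (cases "p = k0")
      case True
      have "(\<Sum>k\<in>UNIV. X $ k $ k) = X $ k0 $ k0 + (\<Sum>k\<in>-{k0}. X $ k $ k)"
        using sum.remove[of UNIV k0 "\<lambda>k. X $ k $ k"] by (simp add: Compl_eq_Diff_UNIV)
      thus ?thesis using True tr by (simp add: sum_negf neg_eq_iff_add_eq_0 add.commute)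
    qed auto
    ultimately show ?thesis using True by simp
  qed
  thus ?thesis by (simp add: vec_eq_iff)
qed

lemma realizable_su:
  "\<exists>M C. 0 \<le> C \<and> (\<forall>n d (X :: real \<Rightarrow> complex^'n^'n). 0 \<le> d \<longrightarrow> 16 * (real n + 1) * d \<le> 1 \<longrightarrow>
     poly_loop n X \<longrightarrow> (\<forall>t k l. X t $ k $ l = - cnj (X t $ l $ k)) \<longrightarrow> (\<forall>t. (\<Sum>k\<in>UNIV. X t $ k $ k) = 0) \<longrightarrow>
     (\<forall>t. norm (X t) \<le> d) \<longrightarrow> realizable n d M C X)"
proof -
  let ?D = "dim2 TYPE('n)"
  have D1: "?D \<ge> 1" by (rule dim2_ge_1)
  \<comment> \<open>An arbitrary reference coordinate, at which the trace is balanced.\<close>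
  define k0 :: 'n where "k0 = undefined"
  define T where "T = (\<lambda>k. rotation k0 k (\<i> / of_real (sqrt 2)) (1 / of_real (sqrt 2)))"
  obtain M1 C1 B1 where 1: "0 \<le> C1" "0 \<le> B1" "\<forall>n d (X :: 'n \<times> 'n \<Rightarrow> real \<Rightarrow> complex^'n^'n). 0 \<le> d \<longrightarrow> (real n + 1) * d \<le> 1 \<longrightarrow>
     (\<forall>i\<in>{(k,l). k \<noteq> l}. realizable n d 2 (4 * ?D) (X i) \<and> (\<forall>t. norm (X i t) \<le> ?D * d)) \<longrightarrow>
     realizable n d M1 C1 (\<lambda>t. \<Sum>i\<in>{(k,l). k \<noteq> l}. X i t) \<and> (\<forall>t. norm (\<Sum>i\<in>{(k,l). k \<noteq> l}. X i t) \<le> B1 * d)"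
    using realizable_sum[where 'n='n, of "{(k,l). k \<noteq> (l::'n)}" "?D" "4 * ?D" 2] D1 by auto
  obtain M2 C2 B2 where 2: "0 \<le> C2" "0 \<le> B2" "\<forall>n d (X :: 'n \<Rightarrow> real \<Rightarrow> complex^'n^'n). 0 \<le> d \<longrightarrow> (real n + 1) * d \<le> 1 \<longrightarrow>
     (\<forall>i\<in>-{k0}. realizable n d 2 (?D\<^sup>2 * (4 * ?D)) (X i) \<and> (\<forall>t. norm (X i t) \<le> ?D ^ 3 * d)) \<longrightarrow>
     realizable n d M2 C2 (\<lambda>t. \<Sum>i\<in>-{k0}. X i t) \<and> (\<forall>t. norm (\<Sum>i\<in>-{k0}. X i t) \<le> B2 * d)"
    using realizable_sum[where 'n='n, of "-{k0}" "?D ^ 3" "?D\<^sup>2 * (4 * ?D)" 2] D1 by auto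
  let ?C = "C1 * ?D + (?D + B1) * C2 + B1 * B2"
  have "realizable n d (M1 + M2) ?C X"
    if d: "0 \<le> d" "16 * (real n + 1) * d \<le> 1" and X: "poly_loop n X"
      and ah: "\<forall>t k l. X t $ k $ l = - cnj (X t $ l $ k)" and tr: "\<forall>t. (\<Sum>k\<in>UNIV. X t $ k $ k) = 0"
      and bd: "\<forall>t. norm (X t) \<le> d"
    for n d and X :: "real \<Rightarrow> complex^'n^'n"
  proof -
    have "0 \<le> (real n + 1) * d" using d by auto
    hence d': "(real n + 1) * d \<le> 1" using d by linarith
    have e: "norm (X t $ k $ l) \<le> d" for t k l using norm_entry_le bd order_trans by blast
    have tp: "trig_poly n (\<lambda>t. X t $ k $ l)" for k l using X by (simp add: poly_loop_def)
    define Y where "Y = (\<lambda>(k,l) t. skew k l (X t $ k $ l / 2))"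
    define Z where "Z = (\<lambda>k t. T k ** skew k0 k (- \<i> * X t $ k $ k) ** cadjoint (T k))"
    have Y: "realizable n d 2 (4 * ?D) (Y (k,l)) \<and> (\<forall>t. norm (Y (k,l) t) \<le> ?D * d)" if "k \<noteq> l" for k l
    proof -
      have h: "norm (X t $ k $ l / 2) \<le> d" for t using e[of t k l] d by (simp add: norm_divide)
      have "realizable n d 2 (4 * ?D) (\<lambda>t. skew k l (X t $ k $ l / 2))"
        by (rule realizable_skew) (use d h that trig_poly_cmul[OF tp, of "1/2" k l] in auto)
      thus ?thesis using norm_skew_le[OF h, of k l] by (simp add: Y_def)
    qed
    have Z: "realizable n d 2 (?D\<^sup>2 * (4 * ?D)) (Z k) \<and> (\<forall>t. norm (Z k t) \<le> ?D ^ 3 * d)" if "k \<noteq> k0" for k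
    proof -
      have h: "norm (- \<i> * X t $ k $ k) \<le> d" for t using e[of t k k] by (simp add: norm_mult)
      have TSU: "T k \<in> SU" using conj_skew(1)[of k0 k] that by (simp add: T_def)
      have "realizable n d 2 (4 * ?D) (\<lambda>t. skew k0 k (- \<i> * X t $ k $ k))"
        by (rule realizable_skew) (use d h that trig_poly_cmul[OF tp, of "- \<i>" k k] in auto)
      from realizable_conjugate[OF this TSU] D1
      have r: "realizable n d 2 (?D\<^sup>2 * (4 * ?D)) (Z k)" by (simp add: Z_def)
      have "norm (Z k t) \<le> ?D ^ 3 * d" for t
      proof -
        have "norm (Z k t) \<le> norm (T k ** skew k0 k (- \<i> * X t $ k $ k)) * norm (T k)"
          unfolding Z_def using norm_matrix_mult_le[of "T k ** skew k0 k (- \<i> * X t $ k $ k)" "cadjoint (T k)"] by simp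
        also have "\<dots> \<le> (norm (T k) * norm (skew k0 k (- \<i> * X t $ k $ k))) * norm (T k)"
          by (intro mult_right_mono norm_matrix_mult_le) auto
        also have "\<dots> \<le> (?D * (?D * d)) * ?D"
          using TSU D1 d h by (intro mult_mono SU_norm_le norm_skew_le) auto
        finally show ?thesis by (simp add: power3_eq_cube mult_ac)
      qed
      with r show ?thesis by blast
    qed
    have rY: "realizable n d M1 C1 (\<lambda>t. \<Sum>i\<in>{(k,l). k \<noteq> l}. Y i t)" "\<And>t. norm (\<Sum>i\<in>{(k,l). k \<noteq> l}. Y i t) \<le> B1 * d"
      using 1(3)[rule_format, of d n Y] d d' Y by auto
    have rZ: "realizable n d M2 C2 (\<lambda>t. \<Sum>i\<in>-{k0}. Z i t)" "\<And>t. norm (\<Sum>i\<in>-{k0}. Z i t) \<le> B2 * d"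
      using 2(3)[rule_format, of d n Z] d d' Z by auto
    have "realizable n d (M1 + M2) ?C (\<lambda>t. (\<Sum>i\<in>{(k,l). k \<noteq> l}. Y i t) + (\<Sum>i\<in>-{k0}. Z i t))"
      by (rule realizable_add[OF rY(1) rZ(1) rY(2) rZ(2)]) (use d d' 1 2 in auto)
    also have "(\<lambda>t. (\<Sum>i\<in>{(k,l). k \<noteq> l}. Y i t) + (\<Sum>i\<in>-{k0}. Z i t)) = X"
    proof
      fix t
      show "(\<Sum>i\<in>{(k,l). k \<noteq> l}. Y i t) + (\<Sum>i\<in>-{k0}. Z i t) = X t"
        using skew_hermitian_decomposition[OF ah[rule_format] tr[rule_format], of t k0]
        unfolding Y_def Z_def T_def split_def by (rule sym)
    qed
    finally show ?thesis .
  qed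
  note main = this
  show ?thesis
    by (intro exI[of _ "M1 + M2"] exI[of _ ?C] conjI allI impI, use 1 2 D1 in simp, rule main)
qed

section \<open>Lipschitz classes with explicit constants\<close>

abbreviation (input) rate :: "real \<Rightarrow> nat \<Rightarrow> real" where
  "rate \<alpha> n \<equiv> (real n + 1) powr (-\<alpha>)"

lemma rate_le_1: "0 \<le> \<alpha> \<Longrightarrow> rate \<alpha> n \<le> 1"
  using powr_mono2'[of "-\<alpha>" 1 "real n + 1"] by simp

lemma rate_antimono: "0 \<le> \<alpha> \<Longrightarrow> n \<le> m \<Longrightarrow> rate \<alpha> m \<le> rate \<alpha> n"
  by (rule powr_mono2') auto

text \<open>Multiplying the degree by a bounded factor costs a constant only; this pays for every
  growth of degree caused by products and corrections.\<close>

lemma rate_scale: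
  assumes "0 \<le> \<alpha>" "0 < M" "real m + 1 \<le> M * (real n + 1)"
  shows "rate \<alpha> n \<le> M powr \<alpha> * rate \<alpha> m"
proof -
  have "rate \<alpha> n = M powr \<alpha> * (M * (real n + 1)) powr (-\<alpha>)"
  proof -
    have "(M * (real n + 1)) powr (-\<alpha>) = M powr (-\<alpha>) * rate \<alpha> n" by (rule powr_mult)
    thus ?thesis using assms by (simp add: powr_minus)
  qed
  also have "\<dots> \<le> M powr \<alpha> * rate \<alpha> m"
    using assms by (intro mult_left_mono powr_mono2') auto
  finally show ?thesis .
qed

lemma rate_half: "0 \<le> \<alpha> \<Longrightarrow> rate \<alpha> (n div 2) \<le> 2 powr \<alpha> * rate \<alpha> n"
  by (rule rate_scale) auto

lemma rate_tendsto_0: "0 < \<alpha> \<Longrightarrow> (\<lambda>n. rate \<alpha> n) \<longlonglongrightarrow> 0"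
proof (rule tendsto_neg_powr)
  show "filterlim (\<lambda>n. real n + 1) at_top sequentially"
    using filterlim_compose[OF filterlim_real_sequentially filterlim_Suc] by (simp add: add.commute)
qed simp

lemma rate_eventually_le:
  assumes "0 < \<alpha>" "0 < e" obtains m where "\<And>n. m \<le> n \<Longrightarrow> K * rate \<alpha> n \<le> e"
proof -
  have "(\<lambda>n. K * rate \<alpha> n) \<longlonglongrightarrow> K * 0" by (intro tendsto_mult_left rate_tendsto_0 assms)
  hence "eventually (\<lambda>n. K * rate \<alpha> n < e) sequentially" using assms order_tendstoD(2) by fastforce
  then obtain m where "\<And>n. m \<le> n \<Longrightarrow> K * rate \<alpha> n < e" unfolding eventually_sequentially by blast
  thus ?thesis using that less_imp_le by blast
qed

lemma geometric_bracket:
  assumes "2 \<le> M" "1 \<le> n0" "n0 \<le> (n::nat)"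
  obtains k where "M ^ k * n0 \<le> n" "n < M ^ Suc k * n0"
proof -
  have "n < M ^ n * n0"
  proof -
    have "n < 2 ^ n" by (rule less_exp)
    also have "\<dots> \<le> M ^ n * 1" using assms by (simp add: power_mono)
    also have "\<dots> \<le> M ^ n * n0" using assms by (intro mult_left_mono) auto
    finally show ?thesis .
  qed
  define k where "k = (LEAST k. n < M ^ k * n0)"
  have k: "n < M ^ k * n0" unfolding k_def by (rule LeastI) fact
  have "k \<noteq> 0" using k assms by (cases k) auto
  then obtain j where j: "k = Suc j" by (cases k) auto
  have "\<not> n < M ^ j * n0" using not_less_Least[of j "\<lambda>k. n < M ^ k * n0"] j by (simp add: k_def)
  thus ?thesis using that[of j] k j by simp
qed

text \<open>The iterations reach only the degrees M^k n0. A degree in between inherits from the last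
  of these below it, at the price of M^alpha. It is stated for a predicate because both the matrix
  approximation and the scalar inverse use it.\<close>

lemma rate_from_geometric_steps:
  fixes P :: "nat \<Rightarrow> real \<Rightarrow> bool"
  assumes mono: "\<And>n m e e'. P n e \<Longrightarrow> n \<le> m \<Longrightarrow> e \<le> e' \<Longrightarrow> P m e'"
    and "0 \<le> \<alpha>" "2 \<le> M" "1 \<le> n0" "0 \<le> D"
    and start: "P n0 (D * rate \<alpha> n0)"
    and step: "\<And>n. n0 \<le> n \<Longrightarrow> P n (D * rate \<alpha> n) \<Longrightarrow> P (M * n) (D * rate \<alpha> (M * n))"
    and n: "n0 \<le> n"
  shows "P n (D * real M powr \<alpha> * rate \<alpha> n)"
proof -
  have pow: "P (M ^ k * n0) (D * rate \<alpha> (M ^ k * n0))" for k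
  proof (induction k)
    case 0 show ?case using start by simp
  next
    case (Suc k)
    have "n0 \<le> M ^ k * n0" using assms(3) by simp
    from step[OF this Suc] show ?case by (simp add: mult.assoc)
  qed
  obtain k where k: "M ^ k * n0 \<le> n" "n < M ^ Suc k * n0"
    using geometric_bracket[OF assms(3,4) n] by blast
  have "n + 1 \<le> M * (M ^ k * n0 + 1)" using k(2) by simp
  hence "real n + 1 \<le> real M * (real (M ^ k * n0) + 1)"
    by (metis of_nat_1 of_nat_add of_nat_le_iff of_nat_mult)
  hence "rate \<alpha> (M ^ k * n0) \<le> real M powr \<alpha> * rate \<alpha> n"
    using assms by (intro rate_scale) auto
  hence "D * rate \<alpha> (M ^ k * n0) \<le> D * real M powr \<alpha> * rate \<alpha> n"
    using \<open>0 \<le> D\<close> by (metis mult.assoc mult_left_mono)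
  thus ?thesis using mono[OF pow k(1)] by blast
qed

text \<open>One constant serves for the sup norm and for the rate, so that products can be estimated
  and whole families of functions bounded uniformly.\<close>

definition lip_bound :: "real \<Rightarrow> real \<Rightarrow> (real \<Rightarrow> complex) \<Rightarrow> bool" where
  "lip_bound \<alpha> K f \<longleftrightarrow> (\<forall>t. norm (f t) \<le> K) \<and>
     (\<forall>n. \<exists>p. trig_poly n p \<and> (\<forall>t. norm (f t - p t) \<le> K * rate \<alpha> n))"

lemma lip_boundI:
  "(\<And>t. norm (f t) \<le> K) \<Longrightarrow> (\<And>n. \<exists>p. trig_poly n p \<and> (\<forall>t. norm (f t - p t) \<le> K * rate \<alpha> n)) \<Longrightarrow> lip_bound \<alpha> K f"
  by (simp add: lip_bound_def)

lemma lip_bound_norm: "lip_bound \<alpha> K f \<Longrightarrow> norm (f t) \<le> K"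
  by (simp add: lip_bound_def)

lemma lip_bound_nonneg: "lip_bound \<alpha> K f \<Longrightarrow> 0 \<le> K"
  using lip_bound_norm norm_ge_zero order_trans by blast

lemma lip_boundE:
  assumes "lip_bound \<alpha> K f"
  obtains p where "trig_poly n p" "\<And>t. norm (f t - p t) \<le> K * rate \<alpha> n"
  using assms unfolding lip_bound_def by blast

lemma lip_bound_mono: assumes "lip_bound \<alpha> K f" "K \<le> L" shows "lip_bound \<alpha> L f"
proof (rule lip_boundI)
  show "norm (f t) \<le> L" for t using lip_bound_norm[OF assms(1)] assms(2) order_trans by blast
  fix n
  obtain p where "trig_poly n p" "\<And>t. norm (f t - p t) \<le> K * rate \<alpha> n" using lip_boundE[OF assms(1)] by blast
  moreover have "K * rate \<alpha> n \<le> L * rate \<alpha> n" using assms(2) by (intro mult_right_mono) auto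
  ultimately show "\<exists>p. trig_poly n p \<and> (\<forall>t. norm (f t - p t) \<le> L * rate \<alpha> n)"
    by (meson order_trans)
qed

lemma Lip_imp_lip_bound:
  assumes "Lip \<alpha> f" obtains K where "lip_bound \<alpha> K f"
proof -
  obtain C where C: "\<And>n. \<exists>p. trig_poly n p \<and> (\<forall>t. norm (f t - p t) \<le> C * rate \<alpha> n)"
    using assms unfolding Lip_def by auto
  \<comment> \<open>An approximant of degree 0 is a constant, so \<open>f\<close> is
    bounded.\<close>
  obtain p where p: "trig_poly 0 p" "\<And>t. norm (f t - p t) \<le> C" using C[of 0] by auto
  then obtain c where c: "\<And>t. p t = c" unfolding trig_poly_def by auto
  have C0: "0 \<le> C" using p(2) norm_ge_zero order_trans by blast
  have "lip_bound \<alpha> (C + norm c) f"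
  proof (rule lip_boundI)
    show "norm (f t) \<le> C + norm c" for t
      using p(2)[of t] norm_triangle_ineq2[of "f t" "p t"] by (simp add: c)
    fix n
    obtain p where "trig_poly n p" "\<And>t. norm (f t - p t) \<le> C * rate \<alpha> n" using C by blast
    moreover have "C * rate \<alpha> n \<le> (C + norm c) * rate \<alpha> n" by (intro mult_right_mono) auto
    ultimately show "\<exists>p. trig_poly n p \<and> (\<forall>t. norm (f t - p t) \<le> (C + norm c) * rate \<alpha> n)"
      by (meson order_trans)
  qed
  thus ?thesis using that by blast
qed

lemma lip_bound_const: "norm c \<le> K \<Longrightarrow> lip_bound \<alpha> K (\<lambda>t. c)"
proof (rule lip_boundI, assumption)
  fix n assume "norm c \<le> K"
  hence "0 \<le> K" using norm_ge_zero order_trans by blast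
  thus "\<exists>p. trig_poly n p \<and> (\<forall>t. norm (c - p t) \<le> K * rate \<alpha> n)"
    by (intro exI[of _ "\<lambda>t. c"]) (simp add: trig_poly_const)
qed

lemma lip_bound_cnj: assumes "lip_bound \<alpha> K f" shows "lip_bound \<alpha> K (\<lambda>t. cnj (f t))"
proof (rule lip_boundI)
  show "norm (cnj (f t)) \<le> K" for t using lip_bound_norm[OF assms] by simp
  fix n
  obtain p where "trig_poly n p" "\<And>t. norm (f t - p t) \<le> K * rate \<alpha> n" using lip_boundE[OF assms] by blast
  thus "\<exists>p. trig_poly n p \<and> (\<forall>t. norm (cnj (f t) - p t) \<le> K * rate \<alpha> n)"
    by (intro exI[of _ "\<lambda>t. cnj (p t)"]) (metis complex_cnj_diff complex_mod_cnj trig_poly_cnj)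
qed

lemma lip_bound_cmul:
  assumes "lip_bound \<alpha> K f" "norm c \<le> L" shows "lip_bound \<alpha> (L * K) (\<lambda>t. c * f t)"
proof (rule lip_boundI)
  have K: "0 \<le> K" by (rule lip_bound_nonneg[OF assms(1)])
  have L: "0 \<le> L" using assms(2) norm_ge_zero order_trans by blast
  show "norm (c * f t) \<le> L * K" for t
    using lip_bound_norm[OF assms(1)] assms(2) L by (simp add: norm_mult mult_mono)
  fix n
  obtain p where p: "trig_poly n p" "\<And>t. norm (f t - p t) \<le> K * rate \<alpha> n" using lip_boundE[OF assms(1)] by blast
  have "norm (c * f t - c * p t) \<le> L * K * rate \<alpha> n" for t
  proof -
    have "norm (c * f t - c * p t) = norm c * norm (f t - p t)" by (simp add: norm_mult flip: right_diff_distrib)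
    also have "\<dots> \<le> L * (K * rate \<alpha> n)" using assms(2) p(2) L by (intro mult_mono) auto
    finally show ?thesis by simp
  qed
  thus "\<exists>q. trig_poly n q \<and> (\<forall>t. norm (c * f t - q t) \<le> L * K * rate \<alpha> n)"
    using trig_poly_cmul[OF p(1)] by blast
qed

lemma lip_bound_add:
  assumes "lip_bound \<alpha> K f" "lip_bound \<alpha> L g" shows "lip_bound \<alpha> (K + L) (\<lambda>t. f t + g t)"
proof (rule lip_boundI)
  show "norm (f t + g t) \<le> K + L" for t
    using lip_bound_norm[OF assms(1), of t] lip_bound_norm[OF assms(2), of t] norm_triangle_ineq[of "f t" "g t"] by linarith
  fix n
  obtain p where p: "trig_poly n p" "\<And>t. norm (f t - p t) \<le> K * rate \<alpha> n" using lip_boundE[OF assms(1)] by blast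
  obtain q where q: "trig_poly n q" "\<And>t. norm (g t - q t) \<le> L * rate \<alpha> n" using lip_boundE[OF assms(2)] by blast
  have "norm (f t + g t - (p t + q t)) \<le> (K + L) * rate \<alpha> n" for t
    using norm_triangle_ineq[of "f t - p t" "g t - q t"] p(2)[of t] q(2)[of t]
    by (simp add: distrib_right add_diff_add)
  thus "\<exists>r. trig_poly n r \<and> (\<forall>t. norm (f t + g t - r t) \<le> (K + L) * rate \<alpha> n)"
    using trig_poly_add[OF p(1) q(1)] by blast
qed

lemma lip_bound_sum:
  assumes "finite I" "\<And>i. i \<in> I \<Longrightarrow> lip_bound \<alpha> K (f i)"
  shows "lip_bound \<alpha> (real (card I) * K) (\<lambda>t. \<Sum>i\<in>I. f i t)"
  using assms
proof (induction I rule: finite_induct)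
  case empty show ?case using lip_bound_const[of 0 0] by simp
next
  case (insert x I)
  show ?case using lip_bound_add[of \<alpha> K "f x"] insert by (simp add: distrib_right)
qed

lemma lip_bound_mult:
  assumes f: "lip_bound \<alpha> K f" and g: "lip_bound \<alpha> L g" and \<alpha>: "0 \<le> \<alpha>"
  shows "lip_bound \<alpha> (3 * 2 powr \<alpha> * K * L) (\<lambda>t. f t * g t)"
proof (rule lip_boundI)
  have K: "0 \<le> K" "0 \<le> L" using lip_bound_nonneg assms by blast+
  have "1 \<le> 2 powr \<alpha>" using \<alpha> by (simp add: ge_one_powr_ge_zero)
  hence "1 * (K * L) \<le> 3 * 2 powr \<alpha> * (K * L)" using K by (intro mult_right_mono) auto
  moreover have "norm (f t * g t) \<le> K * L" for t
    using lip_bound_norm[OF f, of t] lip_bound_norm[OF g, of t] K by (simp add: norm_mult mult_mono)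
  ultimately show "norm (f t * g t) \<le> 3 * 2 powr \<alpha> * K * L" for t
    by (metis (no_types, opaque_lifting) mult.assoc mult_1 order_trans)
  fix n :: nat
  \<comment> \<open>Half the degree for each factor, so that the product has degree
    \<open>n\<close>. The 3 in the constant is 1 + 2, from |g| <= L and |p| <= 2 K.\<close>
  define m where "m = n div 2"
  obtain p where p: "trig_poly m p" "\<And>t. norm (f t - p t) \<le> K * rate \<alpha> m" using lip_boundE[OF f] by blast
  obtain q where q: "trig_poly m q" "\<And>t. norm (g t - q t) \<le> L * rate \<alpha> m" using lip_boundE[OF g] by blast
  have "norm (f t * g t - p t * q t) \<le> 3 * 2 powr \<alpha> * K * L * rate \<alpha> n" for t
  proof -
    have "K * rate \<alpha> m \<le> K" using rate_le_1[OF \<alpha>] K by (simp add: mult_left_le)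
    hence "norm (p t) \<le> 2 * K"
      using norm_triangle_ineq2[of "p t" "f t"] p(2)[of t] lip_bound_norm[OF f, of t] by (simp add: norm_minus_commute)
    have "f t * g t - p t * q t = (f t - p t) * g t + p t * (g t - q t)" by (simp add: algebra_simps)
    hence "norm (f t * g t - p t * q t) \<le> norm (f t - p t) * norm (g t) + norm (p t) * norm (g t - q t)"
      by (metis norm_mult norm_triangle_ineq)
    also have "\<dots> \<le> (K * rate \<alpha> m) * L + (2 * K) * (L * rate \<alpha> m)"
      using p(2) q(2) \<open>norm (p t) \<le> 2 * K\<close> lip_bound_norm[OF g] K by (intro add_mono mult_mono) auto
    also have "\<dots> = 3 * K * L * rate \<alpha> m" by simp
    also have "\<dots> \<le> 3 * K * L * (2 powr \<alpha> * rate \<alpha> n)"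
      unfolding m_def using K rate_half[OF \<alpha>] by (intro mult_left_mono) auto
    finally show ?thesis by (simp add: mult_ac)
  qed
  moreover have "trig_poly n (\<lambda>t. p t * q t)"
    by (rule trig_poly_mono[OF trig_poly_mult[OF p(1) q(1)]]) (simp add: m_def)
  ultimately show "\<exists>r. trig_poly n r \<and> (\<forall>t. norm (f t * g t - r t) \<le> 3 * 2 powr \<alpha> * K * L * rate \<alpha> n)"
    by blast
qed

lemma lip_bound_prod:
  assumes "finite I" "0 \<le> \<alpha>"
  shows "\<exists>L. \<forall>f. (\<forall>i\<in>I. lip_bound \<alpha> K (f i)) \<longrightarrow> lip_bound \<alpha> L (\<lambda>t. \<Prod>i\<in>I. f i t)"
  using assms(1)
proof (induction I rule: finite_induct)
  case empty show ?case using lip_bound_const[of 1 1] by (intro exI[of _ 1]) simp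
next
  case (insert x I)
  then obtain L where "\<forall>f. (\<forall>i\<in>I. lip_bound \<alpha> K (f i)) \<longrightarrow> lip_bound \<alpha> L (\<lambda>t. \<Prod>i\<in>I. f i t)" by blast
  thus ?case using insert.hyps lip_bound_mult[OF _ _ assms(2), of K _ L]
    by (intro exI[of _ "3 * 2 powr \<alpha> * K * L"]) auto
qed

text \<open>Preconditioned iteration for 1/f. A polynomial \<open>r\<close> of fixed degree makes |1
  - f r| small; replacing q by q + r (1 - s q), with \<open>s\<close> an approximant of
  \<open>f\<close> of the current degree, contracts the error while at most tripling the degree. All
  constants depend only on K, c and alpha.\<close>

lemma lip_bound_inverse:
  assumes \<alpha>: "0 < \<alpha>" and c: "0 < c"
  shows "\<exists>L. \<forall>f. lip_bound \<alpha> K f \<longrightarrow> (\<forall>t. c \<le> Re (f t)) \<longrightarrow> lip_bound \<alpha> L (\<lambda>t. 1 / f t)"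
proof (cases "c \<le> K")
  case False
  \<comment> \<open>For c > K the hypotheses contradict each other, as c <= Re f <= |f| <=
    K.\<close>
  have "\<not> (lip_bound \<alpha> K f \<and> (\<forall>t. c \<le> Re (f t)))" for f
    using False lip_bound_norm[of \<alpha> K f 0] complex_Re_le_cmod[of "f 0"] by (auto intro!: exI[of _ 0])
  thus ?thesis by blast
next
  case cK: True
  \<comment> \<open>Per step the error is multiplied by 2 * \<open>\<theta>\<close>, half of the
    factor 3^-alpha by which the rate may drop when the degree triples; the other half is left for
    the fresh approximation error of \<open>f\<close>.\<close>
  define \<theta> where "\<theta> = 3 powr (-\<alpha>) / 4"
  have \<theta>: "0 < \<theta>" by (simp add: \<theta>_def)
  \<comment> \<open>This value minimizes 1 - c/B + 4 K^2/B^2, the bound for |1 - p/B|^2 when Re p >=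
    c/2 and |p| <= 2 K. The minimum is the square of \<open>\<rho>\<close>.\<close>
  define B where "B = 8 * K\<^sup>2 / c"
  define \<rho> where "\<rho> = sqrt (1 - c\<^sup>2 / (16 * K\<^sup>2))"
  have K: "0 < K" using c cK by linarith
  have B: "0 < B" using c K by (simp add: B_def)
  have "c\<^sup>2 \<le> K\<^sup>2" using c cK by (intro power_mono) auto
  hence "c\<^sup>2 \<le> 16 * K\<^sup>2" using zero_le_power2[of K] by linarith
  hence "c\<^sup>2 / (16 * K\<^sup>2) \<le> 1" using K by (simp add: divide_le_eq)
  hence \<rho>: "0 \<le> \<rho>" "\<rho>\<^sup>2 = 1 - c\<^sup>2 / (16 * K\<^sup>2)" by (auto simp: \<rho>_def)
  have "\<rho>\<^sup>2 < 1\<^sup>2" unfolding \<rho>(2) using c K by simp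
  hence \<rho>1: "\<rho> < 1" by (rule power2_less_imp_less) simp
  obtain l where l: "\<rho> ^ l < \<theta> / 2" using real_arch_pow_inv[OF _ \<rho>1, of "\<theta>/2"] \<theta> by auto
  obtain m where m: "\<And>n. m \<le> n \<Longrightarrow> K * rate \<alpha> n \<le> min (c / 2) (\<theta> * c / 8)"
    using rate_eventually_le[OF \<alpha>, of "min (c / 2) (\<theta> * c / 8)" K] \<theta> c by auto
  \<comment> \<open>From here on \<open>f\<close> is approximated well enough and the degree m * l
    of \<open>r\<close> is at most n, so that m * l + 2 n <= 3 n.\<close>
  define n0 where "n0 = Suc (m + m * l)"
  define C where "C = 4 * K / c\<^sup>2"
  \<comment> \<open>The first summand absorbs the term with \<open>C\<close> in each step; the
    second makes the zero polynomial good enough at degree \<open>n0\<close>.\<close>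
  define D where "D = 2 * 3 powr \<alpha> * C + 1 / (c * rate \<alpha> n0)"
  have C0: "0 \<le> C" using K by (simp add: C_def)
  have D: "0 \<le> D" using c C0 by (simp add: D_def)
  have "lip_bound \<alpha> (D * real 3 powr \<alpha>) (\<lambda>t. 1 / f t)" if f: "lip_bound \<alpha> K f" and re: "\<forall>t. c \<le> Re (f t)" for f
  proof -
    have fc: "c \<le> norm (f t)" for t using re complex_Re_le_cmod order_trans by blast
    have f0: "f t \<noteq> 0" for t using fc[of t] c by auto
    have if1: "norm (1 / f t) \<le> 1 / c" for t using fc[of t] c by (simp add: norm_divide frac_le)
    obtain p where p: "trig_poly m p" "\<And>t. norm (f t - p t) \<le> K * rate \<alpha> m" using lip_boundE[OF f] by blast
    have fp: "norm (f t - p t) \<le> c / 2" "norm (f t - p t) \<le> \<theta> * c / 8" for t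
      using p(2)[of t] m[of m] by auto
    have rep: "c / 2 \<le> Re (p t)" for t
      using fp(1)[of t] re[rule_format, of t] complex_Re_le_cmod[of "f t - p t"] by simp
    have np: "norm (p t) \<le> 2 * K" for t
      using fp(1)[of t] lip_bound_norm[OF f, of t] norm_triangle_ineq2[of "p t" "f t"] cK c
      by (simp add: norm_minus_commute)
    have pc: "c / 2 \<le> norm (p t)" for t using rep complex_Re_le_cmod order_trans by blast
    define w where "w = (\<lambda>t. 1 - (1 / of_real B) * p t)"
    have w: "norm (w t) \<le> \<rho>" for t
    proof (rule power2_le_imp_le[OF _ \<rho>(1)])
      have "(norm (w t))\<^sup>2 = 1 - 2 * Re (p t) / B + (norm (p t))\<^sup>2 / B\<^sup>2"
        unfolding cmod_power2 w_def using B by (simp add: power2_eq_square field_simps)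
      also have "\<dots> \<le> 1 - 2 * (c / 2) / B + (2 * K)\<^sup>2 / B\<^sup>2"
        using rep[of t] np[of t] B by (intro add_mono diff_mono divide_right_mono power_mono) auto
      also have "\<dots> = 1 - c\<^sup>2 / (16 * K\<^sup>2)"
        using c K by (simp add: B_def power2_eq_square field_simps)
      finally show "(norm (w t))\<^sup>2 \<le> \<rho>\<^sup>2" using \<rho>(2) by simp
    qed
    \<comment> \<open>The Neumann series of 1/p = (1/B) / (1 - w), cut off after l terms.\<close>
    define r where "r = (\<lambda>t. (1 / of_real B) * (\<Sum>k<l. w t ^ k))"
    have tw: "trig_poly m w" unfolding w_def by (intro trig_poly_diff trig_poly_const trig_poly_cmul p(1))
    have tr: "trig_poly (m * l) r"
      unfolding r_def by (intro trig_poly_cmul trig_poly_sum trig_poly_mono[OF trig_poly_power[OF tw]]) auto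
    have pr: "p t * r t = 1 - w t ^ l" for t
    proof -
      have "p t * r t = ((1 / of_real B) * p t) * (\<Sum>k<l. w t ^ k)" by (simp add: r_def)
      also have "(1 / of_real B) * p t = 1 - w t" by (simp add: w_def)
      finally show ?thesis unfolding one_diff_power_eq .
    qed
    have wl: "norm (w t ^ l) \<le> \<rho> ^ l" for t using w[of t] by (simp add: norm_power power_mono)
    have nr: "norm (r t) \<le> 4 / c" for t
    proof -
      have "norm (p t) * norm (r t) \<le> 1 + norm (w t ^ l)"
        unfolding norm_mult[symmetric] pr using norm_triangle_ineq4[of 1 "w t ^ l"] by simp
      also have "\<dots> \<le> 2" using wl[of t] power_le_one[of \<rho> l] \<rho>(1) \<rho>1 by simp
      finally have "(c / 2) * norm (r t) \<le> 2" using mult_right_mono[OF pc[of t], of "norm (r t)"] by simp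
      thus ?thesis using c by (simp add: field_simps)
    qed
    have fr: "norm (1 - f t * r t) \<le> \<theta>" for t
    proof -
      have "1 - f t * r t = w t ^ l - (f t - p t) * r t" using pr[of t] by (simp add: algebra_simps)
      hence "norm (1 - f t * r t) \<le> norm (w t ^ l) + norm (f t - p t) * norm (r t)"
        by (metis norm_mult norm_triangle_ineq4)
      also have "\<dots> \<le> \<theta> / 2 + (\<theta> * c / 8) * (4 / c)"
        using wl[of t] l fp(2)[of t] nr[of t] c \<theta> by (intro add_mono mult_mono) auto
      also have "\<dots> = \<theta>" using c by simp
      finally show ?thesis .
    qed
    define P where "P = (\<lambda>n e. \<exists>q. trig_poly n q \<and> (\<forall>t. norm (1 / f t - q t) \<le> e))"
    have mono: "P m' e'" if "P n e" "n \<le> m'" "e \<le> e'" for n m' e e'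
      using that unfolding P_def by (meson order_trans trig_poly_mono)
    have base: "P n (1 / c)" for n
      unfolding P_def using if1 by (intro exI[of _ "\<lambda>t. 0"]) (simp add: trig_poly_zero)
    have "1 / (c * rate \<alpha> n0) \<le> D" using C0 by (simp add: D_def)
    hence cD: "1 / c \<le> D * rate \<alpha> n0"
      using c by (simp add: field_simps)
    have start: "P n0 (D * rate \<alpha> n0)" using mono[OF base _ cD] by blast
    have step: "P (3 * n) (D * rate \<alpha> (3 * n))" if n: "n0 \<le> n" and Pn: "P n (D * rate \<alpha> n)" for n
    proof -
      define e where "e = D * rate \<alpha> n"
      have e0: "0 \<le> e" using D by (simp add: e_def)
      obtain q where q: "trig_poly n q" "\<And>t. norm (1 / f t - q t) \<le> e"
        using Pn unfolding P_def e_def by blast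
      obtain s where s: "trig_poly n s" "\<And>t. norm (f t - s t) \<le> K * rate \<alpha> n" using lip_boundE[OF f] by blast
      have sm: "K * rate \<alpha> n \<le> \<theta> * c / 8" using m[of n] n by (simp add: n0_def)
      define q' where "q' = (\<lambda>t. q t + r t * (1 - s t * q t))"
      have "trig_poly (3 * n) q'"
      proof -
        have "trig_poly (m * l + (n + n)) (\<lambda>t. r t * (1 - s t * q t))"
          by (intro trig_poly_mult trig_poly_diff trig_poly_const tr s(1) q(1))
        moreover have "m * l + (n + n) \<le> 3 * n" using n by (simp add: n0_def)
        ultimately show ?thesis unfolding q'_def
          by (intro trig_poly_add) (auto intro: trig_poly_mono[OF q(1)] elim: trig_poly_mono)
      qed
      moreover have "norm (1 / f t - q' t) \<le> D * rate \<alpha> (3 * n)" for t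
      proof -
        \<comment> \<open>By 1 - s q = f (1/f - q) + (f - s) q the new error splits into the
          contracted old error, the approximation error of \<open>f\<close>, and a product of the
          two.\<close>
        have "1 / f t - q' t = (1 / f t - q t) * (1 - f t * r t) - r t * (f t - s t) * (1 / f t)
              + r t * (f t - s t) * (1 / f t - q t)"
          unfolding q'_def using f0[of t] by (simp add: field_simps)
        hence "norm (1 / f t - q' t) \<le> norm ((1 / f t - q t) * (1 - f t * r t)) + norm (r t * (f t - s t) * (1 / f t))
             + norm (r t * (f t - s t) * (1 / f t - q t))"
          by (metis (no_types, lifting) add_right_mono norm_triangle_ineq norm_triangle_ineq4 order_trans)
        also have "\<dots> \<le> e * \<theta> + (4 / c) * (K * rate \<alpha> n) * (1 / c) + (4 / c) * (\<theta> * c / 8) * e"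
          unfolding norm_mult using q(2)[of t] fr[of t] nr[of t] s(2)[of t] if1[of t] sm c \<theta> e0 K
          by (intro add_mono mult_mono) (auto intro: order_trans)
        also have "\<dots> \<le> (2 * \<theta>) * e + C * rate \<alpha> n"
          using c \<theta> e0 by (simp add: C_def power2_eq_square field_simps)
        also have "\<dots> = (3 powr (-\<alpha>) * D / 2 + C) * rate \<alpha> n"
          by (simp add: \<theta>_def e_def algebra_simps)
        also have "\<dots> \<le> (3 powr (-\<alpha>) * D) * rate \<alpha> n"
        proof (rule mult_right_mono)
          have "2 * 3 powr \<alpha> * C \<le> D" using c by (simp add: D_def)
          hence "3 powr (-\<alpha>) * (2 * 3 powr \<alpha> * C) \<le> 3 powr (-\<alpha>) * D" by (intro mult_left_mono) auto
          thus "3 powr (-\<alpha>) * D / 2 + C \<le> 3 powr (-\<alpha>) * D" by (simp add: powr_minus field_simps)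
        qed simp
        also have "\<dots> \<le> D * rate \<alpha> (3 * n)"
        proof -
          have "rate \<alpha> n \<le> 3 powr \<alpha> * rate \<alpha> (3 * n)" using \<alpha> by (intro rate_scale) auto
          hence "3 powr (-\<alpha>) * rate \<alpha> n \<le> rate \<alpha> (3 * n)" by (simp add: powr_minus field_simps)
          hence "D * (3 powr (-\<alpha>) * rate \<alpha> n) \<le> D * rate \<alpha> (3 * n)" using D by (rule mult_left_mono)
          thus ?thesis by (simp add: mult_ac)
        qed
        finally show ?thesis .
      qed
      ultimately show ?thesis unfolding P_def by blast
    qed
    have m3: "1 \<le> 3 powr \<alpha>" using \<alpha> by (simp add: ge_one_powr_ge_zero)
    have D3: "D \<le> D * 3 powr \<alpha>" using D m3 by (simp add: mult_le_cancel_left1)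
    show ?thesis
    proof (rule lip_boundI)
      have "D * rate \<alpha> n0 \<le> D" using rate_le_1[of \<alpha> n0] \<alpha> D by (simp add: mult_left_le)
      thus "norm (1 / f t) \<le> D * real 3 powr \<alpha>" for t using if1[of t] cD D3 by simp
      fix n
      have "P n (D * real 3 powr \<alpha> * rate \<alpha> n)"
      proof (cases "n0 \<le> n")
        case True
        show ?thesis by (rule rate_from_geometric_steps[of P \<alpha> 3 n0 D])
          (use mono \<alpha> D start step True in \<open>auto simp: n0_def\<close>)
      next
        case False
        have "1 / c \<le> D * rate \<alpha> n0" by (rule cD)
        also have "\<dots> \<le> (D * 3 powr \<alpha>) * rate \<alpha> n"
          using False D D3 \<alpha> by (intro mult_mono rate_antimono) auto
        finally show ?thesis using mono[OF base order_refl] by simp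
      qed
      thus "\<exists>p. trig_poly n p \<and> (\<forall>t. norm (1 / f t - p t) \<le> D * real 3 powr \<alpha> * rate \<alpha> n)"
        unfolding P_def .
    qed
  qed
  thus ?thesis by blast
qed

section \<open>Loops near the identity\<close>

lemma prod_one_plus_expansion:
  assumes "finite I"
  shows "\<exists>C\<ge>0. \<forall>(z :: 'i \<Rightarrow> complex) d. d \<le> 1 \<longrightarrow> (\<forall>i\<in>I. norm (z i) \<le> d) \<longrightarrow>
    norm ((\<Prod>i\<in>I. 1 + z i) - (1 + (\<Sum>i\<in>I. z i))) \<le> C * d\<^sup>2"
  using assms
proof (induction I rule: finite_induct)
  case empty show ?case by (intro exI[of _ 0]) simp
next
  case (insert x I)
  then obtain C where C: "0 \<le> C" "\<forall>(z :: 'i \<Rightarrow> complex) d. d \<le> 1 \<longrightarrow> (\<forall>i\<in>I. norm (z i) \<le> d) \<longrightarrow>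
    norm ((\<Prod>i\<in>I. 1 + z i) - (1 + (\<Sum>i\<in>I. z i))) \<le> C * d\<^sup>2" by blast
  have "norm ((\<Prod>i\<in>insert x I. 1 + z i) - (1 + (\<Sum>i\<in>insert x I. z i))) \<le> (real (card I) + 2 * C) * d\<^sup>2"
    if d: "d \<le> 1" and z: "\<forall>i\<in>insert x I. norm (z i) \<le> d" for z :: "'i \<Rightarrow> complex" and d
  proof -
    let ?S = "\<Sum>i\<in>I. z i"
    let ?R = "(\<Prod>i\<in>I. 1 + z i) - (1 + ?S)"
    have zx: "norm (z x) \<le> d" and d0: "0 \<le> d" using z norm_ge_zero[of "z x"] by (auto simp del: norm_ge_zero)
    have R: "norm ?R \<le> C * d\<^sup>2" using C(2) d z by auto
    have S: "norm ?S \<le> real (card I) * d" using z sum_norm_bound[of I z d] by auto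
    have "(\<Prod>i\<in>insert x I. 1 + z i) - (1 + (\<Sum>i\<in>insert x I. z i)) = z x * ?S + (1 + z x) * ?R"
      using insert.hyps by (simp add: algebra_simps)
    also have "norm \<dots> \<le> norm (z x) * norm ?S + norm (1 + z x) * norm ?R"
      by (metis norm_mult norm_triangle_ineq)
    also have "\<dots> \<le> d * (real (card I) * d) + 2 * (C * d\<^sup>2)"
      using zx S R d d0 C(1) norm_triangle_ineq[of 1 "z x"] by (intro add_mono mult_mono) auto
    also have "\<dots> = (real (card I) + 2 * C) * d\<^sup>2" by (simp add: algebra_simps power2_eq_square)
    finally show ?thesis .
  qed
  thus ?case using C(1) by (intro exI[of _ "real (card I) + 2 * C"]) auto
qed

text \<open>In the Leibniz formula the identity permutation gives 1 + trace up to second order. Any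
  other permutation p moves some i and then also p i, and both factors are off-diagonal entries of
  Z.\<close>

lemma det_one_plus_expansion:
  "\<exists>C\<ge>0. \<forall>Z :: complex^'n^'n. norm Z \<le> 1 \<longrightarrow>
     norm (det (mat 1 + Z) - (1 + (\<Sum>k\<in>UNIV. Z $ k $ k))) \<le> C * (norm Z)\<^sup>2"
proof -
  obtain C where C: "0 \<le> C" "\<forall>(z :: 'n \<Rightarrow> complex) d. d \<le> 1 \<longrightarrow> (\<forall>i\<in>UNIV. norm (z i) \<le> d) \<longrightarrow>
    norm ((\<Prod>i\<in>UNIV. 1 + z i) - (1 + (\<Sum>i\<in>UNIV. z i))) \<le> C * d\<^sup>2"
    using prod_one_plus_expansion[of "UNIV :: 'n set"] by auto
  define Ps where "Ps = {p. p permutes (UNIV :: 'n set)}"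
  have fin: "finite Ps" unfolding Ps_def by (rule finite_permutations) simp
  have idP: "id \<in> Ps" unfolding Ps_def by (simp add: permutes_id)
  define N where "N = CARD('n)"
  have "norm (det (mat 1 + Z) - (1 + (\<Sum>k\<in>UNIV. Z $ k $ k))) \<le> (C + real (card (Ps - {id})) * 2 ^ N) * (norm Z)\<^sup>2"
    if Z: "norm Z \<le> 1" for Z :: "complex^'n^'n"
  proof -
    define T where "T = (\<lambda>p. of_int (sign p) * (\<Prod>i\<in>UNIV. (mat 1 + Z) $ i $ p i))"
    have e: "norm (Z $ i $ j) \<le> norm Z" for i j by (rule norm_entry_le)
    have "det (mat 1 + Z) = T id + (\<Sum>p\<in>Ps - {id}. T p)"
      unfolding det_def T_def Ps_def[symmetric] using fin idP by (rule sum.remove)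
    moreover have "T id = (\<Prod>i\<in>UNIV. 1 + Z $ i $ i)" by (simp add: T_def mat_def)
    moreover have "norm (T id - (1 + (\<Sum>k\<in>UNIV. Z $ k $ k))) \<le> C * (norm Z)\<^sup>2"
      unfolding \<open>T id = _\<close> using C(2)[rule_format, OF Z, of "\<lambda>k. Z $ k $ k"] e by auto
    moreover have "norm (\<Sum>p\<in>Ps - {id}. T p) \<le> real (card (Ps - {id})) * (2 ^ N * (norm Z)\<^sup>2)"
    proof (rule sum_norm_bound)
      fix p assume p: "p \<in> Ps - {id}"
      then obtain i where i: "p i \<noteq> i" by (auto simp: fun_eq_iff)
      have "inj p" using p unfolding Ps_def by (auto dest: permutes_inj)
      hence pj: "p (p i) \<noteq> p i" using i by (auto dest: injD)
      let ?f = "\<lambda>k. norm ((mat 1 + Z) $ k $ p k)"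
      have f2: "?f k \<le> 2" for k
        using e[of k "p k"] Z norm_triangle_ineq[of "mat 1 $ k $ p k" "Z $ k $ p k"] by (auto simp: mat_def)
      have fo: "?f k \<le> norm Z" if "p k \<noteq> k" for k using that e[of k "p k"] by (simp add: mat_def)
      have "norm (T p) = (\<Prod>k\<in>UNIV. ?f k)" by (simp add: T_def norm_mult prod_norm sign_def)
      also have "\<dots> = (\<Prod>k\<in>- {i, p i}. ?f k) * (\<Prod>k\<in>{i, p i}. ?f k)"
        unfolding Compl_eq_Diff_UNIV by (rule prod.subset_diff) auto
      also have "\<dots> \<le> 2 ^ N * (norm Z)\<^sup>2"
      proof (rule mult_mono)
        have "(\<Prod>k\<in>- {i, p i}. ?f k) \<le> (\<Prod>k\<in>- {i, p i}. 2)"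
          using f2 by (intro prod_mono) auto
        also have "\<dots> = 2 ^ card (- {i, p i})" by simp
        also have "\<dots> \<le> 2 ^ N" unfolding N_def by (intro power_increasing card_mono) auto
        finally show "(\<Prod>k\<in>- {i, p i}. ?f k) \<le> 2 ^ N" .
        have "(\<Prod>k\<in>{i, p i}. ?f k) = ?f i * ?f (p i)" using i by simp
        also have "\<dots> \<le> norm Z * norm Z" using fo[OF i] fo[OF pj] by (intro mult_mono) auto
        finally show "(\<Prod>k\<in>{i, p i}. ?f k) \<le> (norm Z)\<^sup>2" by (simp add: power2_eq_square)
      qed (auto intro: prod_nonneg)
      finally show "norm (T p) \<le> 2 ^ N * (norm Z)\<^sup>2" .
    qed
    ultimately show ?thesis
      using norm_triangle_ineq[of "T id - (1 + (\<Sum>k\<in>UNIV. Z $ k $ k))" "\<Sum>p\<in>Ps - {id}. T p"]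
      by (simp add: algebra_simps)
  qed
  thus ?thesis using C(1) by (intro exI[of _ "C + real (card (Ps - {id})) * 2 ^ N"]) auto
qed

section \<open>Projection to su(N) and the correction step\<close>

definition approx_within :: "(real \<Rightarrow> complex^'n^'n) \<Rightarrow> nat \<Rightarrow> real \<Rightarrow> bool" where
  "approx_within R n e \<longleftrightarrow> (\<exists>P. poly_loop n P \<and> (\<forall>t. P t \<in> SU) \<and> (\<forall>t. norm (R t - P t) \<le> e))"

lemma approx_within_mono:
  "approx_within R n e \<Longrightarrow> n \<le> m \<Longrightarrow> e \<le> e' \<Longrightarrow> approx_within R m e'"
  unfolding approx_within_def by (meson order_trans poly_loop_mono)

text \<open>Equal to 2 i Im (trace Y), twice the trace of the skew-hermitian part of Y.\<close>

definition skew_trace :: "complex^'n^'n \<Rightarrow> complex" where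
  "skew_trace Y = (\<Sum>j\<in>UNIV. Y $ j $ j - cnj (Y $ j $ j))"

text \<open>The real-orthogonal projection onto su(N): the skew-hermitian part minus its mean
  diagonal value. Being real-linear in the entries and their conjugates, it preserves polynomial
  degrees.\<close>

definition su_part :: "complex^'n^'n \<Rightarrow> complex^'n^'n" where
  "su_part Y = (\<chi> k l. (Y $ k $ l - cnj (Y $ l $ k)) / 2
     - (if k = l then skew_trace Y / (2 * of_nat CARD('n)) else 0))"

lemma cnj_skew_trace: "cnj (skew_trace Y) = - skew_trace Y"
  by (simp add: skew_trace_def sum_negf[symmetric])

lemma su_part_skew: "su_part Y $ k $ l = - cnj (su_part Y $ l $ k)"
  by (simp add: su_part_def cnj_skew_trace diff_divide_distrib)

lemma su_part_trace: "(\<Sum>k\<in>UNIV. su_part (Y :: complex^'n^'n) $ k $ k) = 0"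
proof -
  have "(\<Sum>k\<in>UNIV. su_part Y $ k $ k) = skew_trace Y / 2 - of_nat CARD('n) * (skew_trace Y / (2 * of_nat CARD('n)))"
    by (simp add: su_part_def sum_subtractf[of "\<lambda>k. (Y $ k $ k - cnj (Y $ k $ k)) / 2"]
        sum_divide_distrib[symmetric] skew_trace_def[of Y])
  thus ?thesis by simp
qed

lemma poly_loop_su_part:
  fixes Y :: "real \<Rightarrow> complex^'n^'n"
  assumes "poly_loop n Y" shows "poly_loop n (\<lambda>t. su_part (Y t))"
  unfolding poly_loop_def
proof (intro allI)
  fix k l :: 'n
  have tp: "trig_poly n (\<lambda>t. Y t $ i $ j)" for i j using assms by (simp add: poly_loop_def)
  let ?c = "if k = l then 1 / (2 * of_nat CARD('n)) else 0 :: complex"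
  have "trig_poly n (\<lambda>t. (1/2) * (Y t $ k $ l - cnj (Y t $ l $ k)) - ?c * (\<Sum>j\<in>UNIV. Y t $ j $ j - cnj (Y t $ j $ j)))"
    by (intro trig_poly_diff trig_poly_cmul trig_poly_sum trig_poly_cnj tp)
  moreover have "(\<lambda>t. (1/2) * (Y t $ k $ l - cnj (Y t $ l $ k)) - ?c * (\<Sum>j\<in>UNIV. Y t $ j $ j - cnj (Y t $ j $ j)))
      = (\<lambda>t. su_part (Y t) $ k $ l)"
    by (rule ext) (cases "k = l"; simp add: su_part_def skew_trace_def)
  ultimately show "trig_poly n (\<lambda>t. su_part (Y t) $ k $ l)" by (rule subst[rotated])
qed

lemma su_part_diff: "su_part (A - B) = su_part A - su_part B"
proof -
  have "skew_trace (A - B) = skew_trace A - skew_trace B"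
    by (simp add: skew_trace_def flip: sum_subtractf) (simp add: algebra_simps)
  thus ?thesis by (simp add: su_part_def vec_eq_iff diff_divide_distrib)
qed

lemma norm_su_part_le:
  fixes Y :: "complex^'n^'n" shows "norm (su_part Y) \<le> 2 * dim2 TYPE('n) * norm Y"
proof -
  have e: "norm (Y $ i $ j) \<le> norm Y" for i j by (rule norm_entry_le)
  have d: "norm (Y $ i $ j - cnj (Y $ j $ i)) \<le> 2 * norm Y" for i j
    using norm_triangle_ineq4[of "Y $ i $ j" "cnj (Y $ j $ i)"] e[of i j] e[of j i] by simp
  have "norm (skew_trace Y) \<le> real CARD('n) * (2 * norm Y)"
    unfolding skew_trace_def by (rule sum_norm_bound) (rule d)
  hence s: "norm (skew_trace Y / (2 * of_nat CARD('n))) \<le> norm Y"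
    by (simp add: norm_divide norm_mult field_simps)
  have "norm (su_part Y $ k $ l) \<le> 2 * norm Y" for k l
  proof -
    have "norm (su_part Y $ k $ l) \<le> norm ((Y $ k $ l - cnj (Y $ l $ k)) / 2) + norm Y"
      unfolding su_part_def vec_lambda_beta using s
      by (intro order_trans[OF norm_triangle_ineq4] add_left_mono) auto
    thus ?thesis using d[of k l] by (simp add: norm_divide)
  qed
  hence "norm (su_part Y) \<le> real (CARD('n) * CARD('n)) * (2 * norm Y)" by (rule norm_le_entries)
  thus ?thesis by (simp add: dim2_def)
qed

text \<open>\<open>Z + Z\<^sup>* = - Z\<^sup>* Z\<close> controls the hermitian part of \<open>Z\<close>, and \<open>det (I + Z) = 1\<close> its trace.\<close>

lemma su_part_near_SU:
  "\<exists>C\<ge>0. \<forall>Z :: complex^'n^'n. norm Z \<le> 1 \<longrightarrow> mat 1 + Z \<in> SU \<longrightarrow> norm (su_part Z - Z) \<le> C * (norm Z)\<^sup>2"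
proof -
  obtain C where C: "0 \<le> C" "\<And>Z :: complex^'n^'n. norm Z \<le> 1 \<Longrightarrow>
     norm (det (mat 1 + Z) - (1 + (\<Sum>k\<in>UNIV. Z $ k $ k))) \<le> C * (norm Z)\<^sup>2"
    using det_one_plus_expansion by blast
  have "norm (su_part Z - Z) \<le> dim2 TYPE('n) * (1 + C) * (norm Z)\<^sup>2"
    if Z: "norm Z \<le> 1" "mat 1 + Z \<in> SU" for Z :: "complex^'n^'n"
  proof -
    have tr: "norm (\<Sum>k\<in>UNIV. Z $ k $ k) \<le> C * (norm Z)\<^sup>2"
      using C(2)[OF Z(1)] Z(2) by (simp add: SU_def)
    have "cadjoint (mat 1 + Z) ** (mat 1 + Z) = mat 1" using Z(2) by (simp add: SU_def)
    hence zz: "Z + cadjoint Z = - (cadjoint Z ** Z)"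
      by (simp add: cadjoint_add matrix_add_ldistrib matrix_add_rdistrib algebra_simps)
         (metis eq_neg_iff_add_eq_0 group_cancel.add1)
    have h: "norm (Z $ k $ l + cnj (Z $ l $ k)) \<le> (norm Z)\<^sup>2" for k l
    proof -
      have "Z $ k $ l + cnj (Z $ l $ k) = (Z + cadjoint Z) $ k $ l" by simp
      also have "norm \<dots> \<le> norm (Z + cadjoint Z)" by (rule norm_entry_le)
      also have "\<dots> \<le> norm Z * norm Z" unfolding zz using norm_matrix_mult_le[of "cadjoint Z" Z] by simp
      finally show ?thesis by (simp add: power2_eq_square)
    qed
    have e: "norm ((su_part Z - Z) $ k $ l) \<le> (1 + C) * (norm Z)\<^sup>2" for k l
    proof -
      let ?s = "skew_trace Z / (2 * of_nat CARD('n))"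
      have "skew_trace Z = (\<Sum>k\<in>UNIV. Z $ k $ k) - cnj (\<Sum>k\<in>UNIV. Z $ k $ k)"
        by (simp add: skew_trace_def sum_subtractf)
      hence "norm (skew_trace Z) \<le> 2 * (C * (norm Z)\<^sup>2)"
        using norm_triangle_ineq4[of "\<Sum>k\<in>UNIV. Z $ k $ k" "cnj (\<Sum>k\<in>UNIV. Z $ k $ k)"] tr
        unfolding complex_mod_cnj by (simp del: cnj_sum)
      also have "\<dots> = 2 * (C * (norm Z)\<^sup>2) * 1" by simp
      also have "\<dots> \<le> 2 * (C * (norm Z)\<^sup>2) * real CARD('n)"
        using C(1) by (intro mult_left_mono) (auto simp: Suc_leI)
      finally have "norm (skew_trace Z) \<le> 2 * (C * (norm Z)\<^sup>2) * real CARD('n)" .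
      hence s: "norm ?s \<le> C * (norm Z)\<^sup>2"
        by (simp add: norm_divide norm_mult field_simps)
      have "(su_part Z - Z) $ k $ l = - (Z $ k $ l + cnj (Z $ l $ k)) / 2 - (if k = l then ?s else 0)"
        by (simp add: su_part_def field_simps)
      also have "norm \<dots> \<le> norm (- (Z $ k $ l + cnj (Z $ l $ k)) / 2) + C * (norm Z)\<^sup>2"
        using s C(1) by (intro order_trans[OF norm_triangle_ineq4] add_left_mono) auto
      also have "norm (- (Z $ k $ l + cnj (Z $ l $ k)) / 2) \<le> (norm Z)\<^sup>2"
        unfolding norm_divide norm_minus_cancel norm_numeral using h[of k l] zero_le_power2[of "norm Z"] by linarith
      finally show ?thesis by (simp add: algebra_simps)
    qed
    show ?thesis using norm_le_entries[OF e] by (simp add: dim2_def mult_ac)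
  qed
  thus ?thesis using C(1) dim2_ge_1[where 'n='n] by (intro exI[of _ "dim2 TYPE('n) * (1 + C)"]) auto
qed

text \<open>Newton step. The exact missing factor I + Z = P* R is not polynomial. Its substitute Y
  uses the polynomial \<open>Q\<close> at a cost of order kappa, projecting to su(N) adds O(e^2),
  and \<open>realizable_su\<close> turns the resulting I + X into a polynomial loop.
  \<open>Q\<close> need not be unitary, which is why kappa is kept apart from e.\<close>

lemma approximation_step:
  "\<exists>M C c. 2 \<le> M \<and> 1 \<le> C \<and> 0 < c \<and> (\<forall>(R :: real \<Rightarrow> complex^'n^'n) n e \<kappa>.
     (\<forall>t. R t \<in> SU) \<longrightarrow> (\<exists>Q. poly_loop n Q \<and> (\<forall>t. norm (R t - Q t) \<le> \<kappa>)) \<longrightarrow>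
     (real n + 1) * (e + \<kappa>) \<le> c \<longrightarrow> approx_within R n e \<longrightarrow>
     approx_within R (M * n) (C * ((real n + 1) * e\<^sup>2 + \<kappa>)))"
proof -
  let ?D = "dim2 TYPE('n)"
  have D1: "?D \<ge> 1" by (rule dim2_ge_1)
  obtain C1 where C1: "0 \<le> C1" "\<And>Z :: complex^'n^'n. norm Z \<le> 1 \<Longrightarrow> mat 1 + Z \<in> SU \<Longrightarrow>
      norm (su_part Z - Z) \<le> C1 * (norm Z)\<^sup>2" using su_part_near_SU by blast
  obtain M0 C0 where C0: "0 \<le> C0" "\<And>n d (X :: real \<Rightarrow> complex^'n^'n). 0 \<le> d \<Longrightarrow> 16 * (real n + 1) * d \<le> 1 \<Longrightarrow>
     poly_loop n X \<Longrightarrow> (\<forall>t k l. X t $ k $ l = - cnj (X t $ l $ k)) \<Longrightarrow> (\<forall>t. (\<Sum>k\<in>UNIV. X t $ k $ k) = 0) \<Longrightarrow>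
     (\<forall>t. norm (X t) \<le> d) \<Longrightarrow> realizable n d M0 C0 X" using realizable_su[where 'n='n] by blast
  define C2 where "C2 = C1 * ?D\<^sup>2 + 2 * ?D * ?D"
  define C3 where "C3 = ?D + C2"
  define C where "C = 1 + ?D * (C2 + 4 * C0 * C3\<^sup>2)"
  have C2: "0 \<le> C2" using C1 D1 by (simp add: C2_def)
  have C3: "1 \<le> C3" "?D \<le> C3" using C2 D1 by (auto simp: C3_def)
  have C: "1 \<le> C" using C0(1) C2 D1 by (simp add: C_def)
  have main: "approx_within R ((2 + 2 * M0) * n) (C * ((real n + 1) * e\<^sup>2 + \<kappa>))"
    if RSU: "\<forall>t. R t \<in> SU" and exQ: "\<exists>Q. poly_loop n Q \<and> (\<forall>t. norm (R t - Q t) \<le> \<kappa>)"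
      and small: "(real n + 1) * (e + \<kappa>) \<le> 1 / (32 * C3)" and ap: "approx_within R n e"
    for R :: "real \<Rightarrow> complex^'n^'n" and n e \<kappa>
  proof -
    obtain Q where Q: "poly_loop n Q" "\<And>t. norm (R t - Q t) \<le> \<kappa>" using exQ by blast
    obtain P where P: "poly_loop n P" "\<And>t. P t \<in> SU" "\<And>t. norm (R t - P t) \<le> e"
      using ap unfolding approx_within_def by blast
    have e0: "0 \<le> e" "0 \<le> \<kappa>" using P(3) Q(2) norm_ge_zero order_trans by blast+
    have sm: "32 * C3 * ((real n + 1) * (e + \<kappa>)) \<le> 1"
      using small C3(1) by (simp add: field_simps)
    have nek: "(real n + 1) * (e + \<kappa>) \<le> 1 / 32"
    proof -
      have "32 * 1 * ((real n + 1) * (e + \<kappa>)) \<le> 32 * C3 * ((real n + 1) * (e + \<kappa>))"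
        using C3 e0 by (intro mult_right_mono) auto
      thus ?thesis using sm by linarith
    qed
    have ek: "e + \<kappa> \<le> (real n + 1) * (e + \<kappa>)" using e0 by (simp add: distrib_right)
    hence e1: "e \<le> 1" "\<kappa> \<le> 1" using nek e0 by auto
    have De: "?D * e \<le> 1"
    proof -
      have "?D * e \<le> C3 * ((real n + 1) * (e + \<kappa>))"
        using C3 e0 ek by (intro mult_mono) auto
      also have "\<dots> \<le> 32 * (C3 * ((real n + 1) * (e + \<kappa>)))" using C3 e0 by simp
      finally show ?thesis using sm by linarith
    qed
    define Z where "Z = (\<lambda>t. cadjoint (P t) ** R t - mat 1)"
    define Y where "Y = (\<lambda>t. cadjoint (P t) ** Q t - mat 1)"
    define X where "X = (\<lambda>t. su_part (Y t))"
    have nPa: "norm (cadjoint (P t)) \<le> ?D" for t using SU_norm_le[OF P(2)] by simp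
    have Z: "norm (Z t) \<le> ?D * e" for t
    proof -
      have "Z t = cadjoint (P t) ** (R t - P t)"
        using P(2)[of t] by (simp add: Z_def matrix_diff_ldistrib SU_def)
      also have "norm \<dots> \<le> ?D * e"
        using D1 by (intro order_trans[OF norm_matrix_mult_le] mult_mono nPa P(3)) auto
      finally show ?thesis .
    qed
    have ZSU: "mat 1 + Z t \<in> SU" for t
      using SU_mult[OF SU_cadjoint[OF P(2)] RSU[rule_format], of t t] by (simp add: Z_def)
    have YZ: "norm (Y t - Z t) \<le> ?D * \<kappa>" for t
    proof -
      have "Y t - Z t = cadjoint (P t) ** (Q t - R t)"
        by (simp add: Z_def Y_def matrix_diff_ldistrib)
      also have "norm \<dots> \<le> ?D * \<kappa>"
        using D1 Q(2)[of t]
        by (intro order_trans[OF norm_matrix_mult_le] mult_mono nPa) (auto simp: norm_minus_commute)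
      finally show ?thesis .
    qed
    have XZ: "norm (X t - Z t) \<le> C2 * (e\<^sup>2 + \<kappa>)" for t
    proof -
      have "X t - Z t = su_part (Y t - Z t) + (su_part (Z t) - Z t)"
        by (simp add: X_def su_part_diff)
      hence "norm (X t - Z t) \<le> norm (su_part (Y t - Z t)) + norm (su_part (Z t) - Z t)"
        by (metis norm_triangle_ineq)
      also have "\<dots> \<le> 2 * ?D * (?D * \<kappa>) + C1 * (?D * e)\<^sup>2"
      proof (rule add_mono)
        show "norm (su_part (Y t - Z t)) \<le> 2 * ?D * (?D * \<kappa>)"
          using D1 YZ[of t] by (intro order_trans[OF norm_su_part_le] mult_left_mono) auto
        have "norm (su_part (Z t) - Z t) \<le> C1 * (norm (Z t))\<^sup>2"
          using Z[of t] De ZSU by (intro C1(2)) auto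
        also have "\<dots> \<le> C1 * (?D * e)\<^sup>2"
          using C1(1) Z[of t] by (intro mult_left_mono power_mono) auto
        finally show "norm (su_part (Z t) - Z t) \<le> C1 * (?D * e)\<^sup>2" .
      qed
      also have "\<dots> = (2 * ?D * ?D) * \<kappa> + (C1 * ?D\<^sup>2) * e\<^sup>2" by (simp add: power_mult_distrib)
      also have "\<dots> \<le> C2 * \<kappa> + C2 * e\<^sup>2"
        using C1 D1 e0 by (intro add_mono mult_right_mono) (auto simp: C2_def)
      finally show ?thesis by (simp add: algebra_simps)
    qed
    define d where "d = C3 * (e + \<kappa>)"
    have d0: "0 \<le> d" using C3 e0 by (simp add: d_def)
    have e2: "e\<^sup>2 \<le> e" using e0 e1 by (simp add: power2_eq_square mult_left_le)
    have Xd: "norm (X t) \<le> d" for t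
    proof -
      have "norm (X t) \<le> norm (Z t) + norm (X t - Z t)"
        using norm_triangle_ineq[of "Z t" "X t - Z t"] by simp
      also have "\<dots> \<le> ?D * (e + \<kappa>) + C2 * (e + \<kappa>)"
      proof (rule add_mono)
        show "norm (Z t) \<le> ?D * (e + \<kappa>)" using Z[of t] D1 e0 by (smt (verit) mult_left_mono)
        show "norm (X t - Z t) \<le> C2 * (e + \<kappa>)"
          using C2 e2 by (intro order_trans[OF XZ] mult_left_mono) auto
      qed
      finally show ?thesis by (simp add: d_def C3_def algebra_simps)
    qed
    \<comment> \<open>X has degree 2 n, so \<open>realizable_su\<close> asks for 16 (2 n + 1) d <=
      1; with d = C3 (e + kappa) this is the origin of the threshold 1 / (32 C3).\<close>
    have "16 * (real (2 * n) + 1) * d \<le> 16 * (2 * (real n + 1)) * d"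
      using d0 by (intro mult_right_mono) auto
    also have "\<dots> = 32 * C3 * ((real n + 1) * (e + \<kappa>))" by (simp add: d_def)
    finally have d16: "16 * (real (2 * n) + 1) * d \<le> 1" using sm by linarith
    have "poly_loop (n + n) Y" unfolding Y_def
      by (intro poly_loop_diff poly_loop_mult poly_loop_cadjoint P Q poly_loop_const)
    hence "poly_loop (2 * n) X" unfolding X_def by (intro poly_loop_su_part) (simp add: mult_2)
    from C0(2)[OF d0 d16 this] have "realizable (2 * n) d M0 C0 X"
      using su_part_skew su_part_trace Xd unfolding X_def by blast
    then obtain P' where P': "poly_loop (M0 * (2 * n)) P'" "\<And>t. P' t \<in> SU"
      "\<And>t. norm (P' t - (mat 1 + X t)) \<le> C0 * (real (2 * n) + 1) * d\<^sup>2"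
      unfolding realizable_def by blast
    have "norm (R t - P t ** P' t) \<le> C * ((real n + 1) * e\<^sup>2 + \<kappa>)" for t
    proof -
      have "R t - P t ** P' t = P t ** ((Z t - X t) - (P' t - (mat 1 + X t)))"
        using P(2)[of t] by (simp add: Z_def matrix_diff_ldistrib matrix_add_ldistrib matrix_mul_assoc SU_def)
      also have "norm \<dots> \<le> ?D * (norm (X t - Z t) + norm (P' t - (mat 1 + X t)))"
        using D1 norm_triangle_ineq4[of "Z t - X t" "P' t - (mat 1 + X t)"]
        by (intro order_trans[OF norm_matrix_mult_le] mult_mono SU_norm_le P) (auto simp: norm_minus_commute)
      also have "\<dots> \<le> ?D * (C2 * ((real n + 1) * e\<^sup>2 + \<kappa>) + 4 * C0 * C3\<^sup>2 * ((real n + 1) * e\<^sup>2 + \<kappa>))"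
      proof (intro mult_left_mono add_mono)
        have "e\<^sup>2 \<le> (real n + 1) * e\<^sup>2" by (simp add: distrib_right)
        thus "norm (X t - Z t) \<le> C2 * ((real n + 1) * e\<^sup>2 + \<kappa>)"
          using C2 by (intro order_trans[OF XZ] mult_left_mono) auto
        have "norm (P' t - (mat 1 + X t)) \<le> C0 * (real (2 * n) + 1) * d\<^sup>2" by (rule P')
        also have "\<dots> \<le> C0 * (2 * (real n + 1)) * d\<^sup>2"
          using C0(1) by (intro mult_right_mono mult_left_mono) auto
        also have "\<dots> = 2 * C0 * C3\<^sup>2 * ((real n + 1) * (e + \<kappa>)\<^sup>2)" by (simp add: d_def power_mult_distrib)
        also have "\<dots> \<le> 2 * C0 * C3\<^sup>2 * (2 * ((real n + 1) * e\<^sup>2 + \<kappa>))"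
        proof (rule mult_left_mono)
          have "(e + \<kappa>)\<^sup>2 \<le> 2 * e\<^sup>2 + 2 * \<kappa>\<^sup>2"
            using sum_squares_bound[of e \<kappa>] by (simp add: power2_sum)
          hence "(real n + 1) * (e + \<kappa>)\<^sup>2 \<le> (real n + 1) * (2 * e\<^sup>2 + 2 * \<kappa>\<^sup>2)" by (rule mult_left_mono) simp
          \<comment> \<open>The factor n is lost on the kappa^2 term because n * kappa is already
            small; only e^2 keeps it.\<close>
          moreover have "(real n + 1) * \<kappa>\<^sup>2 \<le> \<kappa>"
          proof -
            have "(real n + 1) * \<kappa> \<le> (real n + 1) * (e + \<kappa>)" using e0 by (intro mult_left_mono) auto
            hence "(real n + 1) * \<kappa> \<le> 1" using nek by linarith
            hence "((real n + 1) * \<kappa>) * \<kappa> \<le> 1 * \<kappa>" using e0 by (intro mult_right_mono) auto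
            thus ?thesis by (simp add: power2_eq_square mult_ac)
          qed
          ultimately show "(real n + 1) * (e + \<kappa>)\<^sup>2 \<le> 2 * ((real n + 1) * e\<^sup>2 + \<kappa>)"
            by (simp add: algebra_simps)
        qed (use C0(1) in auto)
        finally show "norm (P' t - (mat 1 + X t)) \<le> 4 * C0 * C3\<^sup>2 * ((real n + 1) * e\<^sup>2 + \<kappa>)" by (simp add: algebra_simps)
      qed (use D1 in auto)
      also have "\<dots> = (C - 1) * ((real n + 1) * e\<^sup>2 + \<kappa>)" by (simp add: C_def algebra_simps)
      also have "\<dots> \<le> C * ((real n + 1) * e\<^sup>2 + \<kappa>)" using e0 by (intro mult_right_mono) auto
      finally show ?thesis .
    qed
    moreover have "poly_loop ((2 + 2 * M0) * n) (\<lambda>t. P t ** P' t)"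
      by (rule poly_loop_mono[OF poly_loop_mult[OF P(1) P'(1)]]) simp
    ultimately show ?thesis unfolding approx_within_def
      by (intro exI[of _ "\<lambda>t. P t ** P' t"]) (use P(2) P'(2) in \<open>auto intro: SU_mult\<close>)
  qed
  show ?thesis
  proof (rule exI[of _ "2 + 2 * M0"], rule exI[of _ C], rule exI[of _ "1 / (32 * C3)"], intro conjI allI impI)
    show "2 \<le> 2 + 2 * M0" "1 \<le> C" "0 < 1 / (32 * C3)" using C C3 by auto
  qed (rule main)
qed

definition approximable :: "real \<Rightarrow> (real \<Rightarrow> complex^'n^'n) \<Rightarrow> bool" where
  "approximable \<alpha> U \<longleftrightarrow> (\<exists>D. \<forall>n. approx_within U n (D * rate \<alpha> n))"

definition lip_bound_mat :: "real \<Rightarrow> real \<Rightarrow> (real \<Rightarrow> complex^'n^'n) \<Rightarrow> bool" where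
  "lip_bound_mat \<alpha> K U \<longleftrightarrow> (\<forall>i j. lip_bound \<alpha> K (\<lambda>t. U t $ i $ j))"

lemma lip_bound_mat_approx:
  fixes U :: "real \<Rightarrow> complex^'n^'n"
  assumes "lip_bound_mat \<alpha> K U"
  shows "\<exists>Q. poly_loop n Q \<and> (\<forall>t. norm (U t - Q t) \<le> dim2 TYPE('n) * K * rate \<alpha> n)"
proof -
  have "\<forall>i j. \<exists>p. trig_poly n p \<and> (\<forall>t. norm (U t $ i $ j - p t) \<le> K * rate \<alpha> n)"
    using assms unfolding lip_bound_mat_def lip_bound_def by blast
  then obtain p where p: "\<And>i j. trig_poly n (p i j)" "\<And>i j t. norm (U t $ i $ j - p i j t) \<le> K * rate \<alpha> n"
    by metis
  have "norm (U t - (\<chi> i j. p i j t)) \<le> real (CARD('n) * CARD('n)) * (K * rate \<alpha> n)" for t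
    by (rule norm_le_entries) (simp add: p)
  thus ?thesis
    by (intro exI[of _ "\<lambda>t. \<chi> i j. p i j t"]) (simp add: poly_loop_def p dim2_def mult.assoc)
qed

text \<open>Starting from the constant loop, repeated correction squares the error up to a factor \<open>n\<close>;
  the rate \<open>n\<^bsup>-\<alpha>\<^esup>\<close> with \<open>\<alpha> > 1\<close> beats this factor once the initial distance is small enough.\<close>

lemma approximable_near_identity:
  assumes \<alpha>: "1 < \<alpha>"
  shows "\<exists>\<delta>>0. \<forall>R :: real \<Rightarrow> complex^'n^'n. lip_bound_mat \<alpha> K R \<longrightarrow> (\<forall>t. R t \<in> SU) \<longrightarrow>
     (\<forall>t. norm (R t - mat 1) \<le> \<delta>) \<longrightarrow> approximable \<alpha> R"
proof -
  obtain M C c where M: "2 \<le> M" and C: "1 \<le> C" and c: "0 < c"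
    and step: "\<And>(R :: real \<Rightarrow> complex^'n^'n) n e \<kappa>.
     (\<forall>t. R t \<in> SU) \<Longrightarrow> (\<exists>Q. poly_loop n Q \<and> (\<forall>t. norm (R t - Q t) \<le> \<kappa>)) \<Longrightarrow>
     (real n + 1) * (e + \<kappa>) \<le> c \<Longrightarrow> approx_within R n e \<Longrightarrow>
     approx_within R (M * n) (C * ((real n + 1) * e\<^sup>2 + \<kappa>))"
    using approximation_step[where 'n='n] by blast
  define K1 where "K1 = max 1 (dim2 TYPE('n) * K)"
  have K1: "1 \<le> K1" by (simp add: K1_def)
  \<comment> \<open>Makes C * K1 equal to half of D / M^alpha, the error allowed at degree M
    n.\<close>
  define D where "D = 2 * C * K1 * real M powr \<alpha>"
  have Mp: "0 < real M powr \<alpha>" using M by simp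
  have D: "0 < D" using C K1 Mp by (simp add: D_def)
  \<comment> \<open>The first bound meets the threshold of \<open>step\<close>; the second keeps the
    quadratic term within the remaining half of D / M^alpha.\<close>
  define \<eta> where "\<eta> = min (c / (D + K1)) (1 / (real M powr \<alpha> * (2 * C * D)))"
  have \<eta>: "0 < \<eta>" using c D K1 C Mp by (simp add: \<eta>_def)
  obtain m where m: "\<And>n. m \<le> n \<Longrightarrow> rate (\<alpha> - 1) n \<le> \<eta>"
    using rate_eventually_le[of "\<alpha> - 1" \<eta> 1] \<alpha> \<eta> by auto
  have r1: "(real n + 1) * rate \<alpha> n = rate (\<alpha> - 1) n" for n
    using powr_add[of "real n + 1" 1 "- \<alpha>"] by (simp add: powr_diff add.commute)
  define n0 where "n0 = Suc m"
  have "approximable \<alpha> R" if R: "lip_bound_mat \<alpha> K R" "\<forall>t. R t \<in> SU"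
    and near: "\<forall>t. norm (R t - mat 1) \<le> D * rate \<alpha> n0" for R :: "real \<Rightarrow> complex^'n^'n"
  proof -
    have Q: "\<exists>Q. poly_loop n Q \<and> (\<forall>t. norm (R t - Q t) \<le> K1 * rate \<alpha> n)" for n
    proof -
      obtain Q where Q: "poly_loop n Q" "\<And>t. norm (R t - Q t) \<le> dim2 TYPE('n) * K * rate \<alpha> n"
        using lip_bound_mat_approx[OF R(1)] by blast
      have "dim2 TYPE('n) * K * rate \<alpha> n \<le> K1 * rate \<alpha> n"
        by (intro mult_right_mono) (auto simp: K1_def)
      thus ?thesis using Q by (meson order_trans)
    qed
    have start: "approx_within R n (D * rate \<alpha> n0)" for n
      unfolding approx_within_def using near
      by (intro exI[of _ "\<lambda>t. mat 1"]) (simp add: poly_loop_const SU_mat_1)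
    have st: "approx_within R (M * n) (D * rate \<alpha> (M * n))"
      if n: "n0 \<le> n" and an: "approx_within R n (D * rate \<alpha> n)" for n
    proof -
      have rn: "(real n + 1) * rate \<alpha> n \<le> \<eta>" unfolding r1 using n by (intro m) (simp add: n0_def)
      have "(real n + 1) * (D * rate \<alpha> n + K1 * rate \<alpha> n) = (D + K1) * ((real n + 1) * rate \<alpha> n)"
        by (simp add: algebra_simps)
      also have "\<dots> \<le> (D + K1) * (c / (D + K1))"
        using rn D K1 by (intro mult_left_mono) (auto simp: \<eta>_def)
      also have "\<dots> = c" using D K1 by simp
      finally have "(real n + 1) * (D * rate \<alpha> n + K1 * rate \<alpha> n) \<le> c" .
      from step[OF R(2) Q this an]
      have ap: "approx_within R (M * n) (C * ((real n + 1) * (D * rate \<alpha> n)\<^sup>2 + K1 * rate \<alpha> n))" .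
      have "C * ((real n + 1) * (D * rate \<alpha> n)\<^sup>2 + K1 * rate \<alpha> n)
          = C * D\<^sup>2 * ((real n + 1) * rate \<alpha> n) * rate \<alpha> n + C * K1 * rate \<alpha> n"
        by (simp add: power2_eq_square algebra_simps)
      also have "\<dots> \<le> C * D\<^sup>2 * (1 / (real M powr \<alpha> * (2 * C * D))) * rate \<alpha> n + C * K1 * rate \<alpha> n"
        using rn C by (intro add_right_mono mult_right_mono mult_left_mono) (auto simp: \<eta>_def)
      also have "\<dots> = D / real M powr \<alpha> * rate \<alpha> n"
        using C D Mp by (simp add: D_def power2_eq_square field_simps)
      also have "\<dots> \<le> D / real M powr \<alpha> * (real M powr \<alpha> * rate \<alpha> (M * n))"
        using D \<alpha> M by (intro mult_left_mono rate_scale) (auto simp: algebra_simps)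
      also have "\<dots> = D * rate \<alpha> (M * n)" using Mp by simp
      finally show ?thesis using approx_within_mono[OF ap order_refl] by blast
    qed
    have "approx_within R n ((D * real M powr \<alpha>) * rate \<alpha> n)" for n
    proof (cases "n0 \<le> n")
      case True
      show ?thesis
        by (rule rate_from_geometric_steps[of "approx_within R" \<alpha> M n0 D, OF approx_within_mono _ M _ _ start st True])
           (use \<alpha> D in \<open>auto simp: n0_def\<close>)
    next
      case False
      have "1 \<le> real M powr \<alpha>" using M \<alpha> by (intro ge_one_powr_ge_zero) auto
      hence "D * 1 \<le> D * real M powr \<alpha>" using D by (intro mult_left_mono) auto
      hence "D * rate \<alpha> n0 \<le> (D * real M powr \<alpha>) * rate \<alpha> n"
        using False D \<alpha> by (intro mult_mono rate_antimono) auto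
      thus ?thesis using approx_within_mono[OF start order_refl] by blast
    qed
    thus ?thesis unfolding approximable_def by blast
  qed
  \<comment> \<open>This is the radius. \<open>D\<close> and \<open>n0\<close> were fixed before
    \<open>R\<close>, so it depends on \<open>R\<close> only through K.\<close>
  moreover have "0 < D * rate \<alpha> n0" using D by simp
  ultimately show ?thesis by blast
qed

section \<open>Homotopies\<close>

lemma approximable_mult:
  fixes U V :: "real \<Rightarrow> complex^'n^'n"
  assumes U: "approximable \<alpha> U" and V: "approximable \<alpha> V" and VSU: "\<And>t. V t \<in> SU" and \<alpha>: "0 \<le> \<alpha>"
  shows "approximable \<alpha> (\<lambda>t. U t ** V t)"
proof -
  let ?d = "dim2 TYPE('n)"
  obtain D E where D: "\<And>n. approx_within U n (D * rate \<alpha> n)" and E: "\<And>n. approx_within V n (E * rate \<alpha> n)"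
    using U V unfolding approximable_def by blast
  have nn: "0 \<le> D" "0 \<le> E"
    using D[of 0] E[of 0] unfolding approx_within_def by (auto dest!: spec[of _ 0] intro: order_trans[OF norm_ge_zero])
  have "approx_within (\<lambda>t. U t ** V t) n (?d * (D + E) * 2 powr \<alpha> * rate \<alpha> n)" for n
  proof -
    define m where "m = n div 2"
    obtain P where P: "poly_loop m P" "\<And>t. P t \<in> SU" "\<And>t. norm (U t - P t) \<le> D * rate \<alpha> m"
      using D[of m] unfolding approx_within_def by blast
    obtain Q where Q: "poly_loop m Q" "\<And>t. Q t \<in> SU" "\<And>t. norm (V t - Q t) \<le> E * rate \<alpha> m"
      using E[of m] unfolding approx_within_def by blast
    have "norm (U t ** V t - P t ** Q t) \<le> ?d * (D + E) * 2 powr \<alpha> * rate \<alpha> n" for t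
    proof -
      have "U t ** V t - P t ** Q t = (U t - P t) ** V t + P t ** (V t - Q t)"
        by (simp add: matrix_diff_ldistrib matrix_diff_rdistrib)
      also have "norm \<dots> \<le> norm (U t - P t) * norm (V t) + norm (P t) * norm (V t - Q t)"
        by (intro order_trans[OF norm_triangle_ineq] add_mono norm_matrix_mult_le)
      also have "\<dots> \<le> (D * rate \<alpha> m) * ?d + ?d * (E * rate \<alpha> m)"
        using nn dim2_ge_1[where 'n='n] by (intro add_mono mult_mono SU_norm_le P Q VSU) auto
      also have "\<dots> = ?d * (D + E) * rate \<alpha> m" by (simp add: algebra_simps)
      also have "\<dots> \<le> ?d * (D + E) * (2 powr \<alpha> * rate \<alpha> n)"
        unfolding m_def using nn dim2_ge_1[where 'n='n] by (intro mult_left_mono rate_half \<alpha>) auto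
      finally show ?thesis by (simp add: mult_ac)
    qed
    moreover have "poly_loop n (\<lambda>t. P t ** Q t)"
      by (rule poly_loop_mono[OF poly_loop_mult[OF P(1) Q(1)]]) (simp add: m_def)
    ultimately show ?thesis unfolding approx_within_def
      by (intro exI[of _ "\<lambda>t. P t ** Q t"]) (use P(2) Q(2) in \<open>auto intro: SU_mult\<close>)
  qed
  thus ?thesis unfolding approximable_def by blast
qed

lemma approximable_const: "A \<in> SU \<Longrightarrow> approximable \<alpha> (\<lambda>t. A)"
  unfolding approximable_def approx_within_def
  by (intro exI[of _ 0] allI exI[of _ "\<lambda>t. A"]) (simp add: poly_loop_const)

lemma lip_bound_mat_mult:
  fixes U V :: "real \<Rightarrow> complex^'n^'n"
  assumes "lip_bound_mat \<alpha> K U" "lip_bound_mat \<alpha> L V" "0 \<le> \<alpha>"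
  shows "lip_bound_mat \<alpha> (real CARD('n) * (3 * 2 powr \<alpha> * K * L)) (\<lambda>t. U t ** V t)"
  using assms unfolding lip_bound_mat_def matrix_matrix_mult_def
  by (auto intro!: lip_bound_sum lip_bound_mult)

lemma lip_bound_mat_cadjoint: "lip_bound_mat \<alpha> K U \<Longrightarrow> lip_bound_mat \<alpha> K (\<lambda>t. cadjoint (U t))"
  unfolding lip_bound_mat_def by (auto intro: lip_bound_cnj)

lemma lip_bound_mat_const: "lip_bound_mat \<alpha> (norm A) (\<lambda>t. A)"
  unfolding lip_bound_mat_def by (auto intro!: lip_bound_const norm_entry_le)

lemma lip_bound_det:
  assumes "0 \<le> \<alpha>"
  shows "\<exists>L. \<forall>U :: real \<Rightarrow> complex^'n^'n. lip_bound_mat \<alpha> K U \<longrightarrow> lip_bound \<alpha> L (\<lambda>t. det (U t))"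
proof -
  obtain L where L: "\<And>f :: 'n \<Rightarrow> real \<Rightarrow> complex. (\<forall>i. lip_bound \<alpha> K (f i)) \<Longrightarrow> lip_bound \<alpha> L (\<lambda>t. \<Prod>i\<in>UNIV. f i t)"
    using lip_bound_prod[OF finite assms, of "UNIV :: 'n set" K] by auto
  have "lip_bound \<alpha> (real (card {p. p permutes (UNIV :: 'n set)}) * (1 * L)) (\<lambda>t. det (U t))"
    if "lip_bound_mat \<alpha> K U" for U :: "real \<Rightarrow> complex^'n^'n"
    unfolding det_def
  proof (intro lip_bound_sum lip_bound_cmul L allI)
    show "finite {p. p permutes (UNIV :: 'n set)}" by (rule finite_permutations) simp
  qed (use that in \<open>auto simp: lip_bound_mat_def sign_def\<close>)
  thus ?thesis by blast
qed

lemma det_lipschitz: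
  "\<exists>C\<ge>0. \<forall>(A :: complex^'n^'n) B e. (\<forall>i j. norm (A $ i $ j) \<le> 1) \<longrightarrow> (\<forall>i j. norm (B $ i $ j) \<le> 1) \<longrightarrow>
     (\<forall>i j. norm (A $ i $ j - B $ i $ j) \<le> e) \<longrightarrow> norm (det A - det B) \<le> C * e"
proof (intro exI[of _ "real (card {p. p permutes (UNIV :: 'n set)}) * real CARD('n)"] conjI allI impI)
  fix A B :: "complex^'n^'n" and e
  assume AB: "\<forall>i j. norm (A $ i $ j) \<le> 1" "\<forall>i j. norm (B $ i $ j) \<le> 1"
    and e: "\<forall>i j. norm (A $ i $ j - B $ i $ j) \<le> e"
  have "norm (det A - det B) = norm (\<Sum>p\<in>{p. p permutes (UNIV :: 'n set)}.
      of_int (sign p) * ((\<Prod>i\<in>UNIV. A $ i $ p i) - (\<Prod>i\<in>UNIV. B $ i $ p i)))"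
    by (simp add: det_def sum_subtractf right_diff_distrib)
  also have "\<dots> \<le> real (card {p. p permutes (UNIV :: 'n set)}) * (real CARD('n) * e)"
  proof (rule sum_norm_bound)
    fix p :: "'n \<Rightarrow> 'n"
    have "norm ((\<Prod>i\<in>UNIV. A $ i $ p i) - (\<Prod>i\<in>UNIV. B $ i $ p i)) \<le> (\<Sum>i\<in>UNIV. norm (A $ i $ p i - B $ i $ p i))"
      by (rule norm_prod_diff) (use AB in auto)
    also have "\<dots> \<le> (\<Sum>i\<in>(UNIV :: 'n set). e)" using e by (intro sum_mono) auto
    finally show "norm (of_int (sign p) * ((\<Prod>i\<in>UNIV. A $ i $ p i) - (\<Prod>i\<in>UNIV. B $ i $ p i))) \<le> real CARD('n) * e"
      by (simp add: norm_mult sign_def)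
  qed
  finally show "norm (det A - det B) \<le> real (card {p. p permutes (UNIV :: 'n set)}) * real CARD('n) * e"
    by simp
qed simp

text \<open>V 1 is the telescoping product of the quotients V(s)* V(s'). One constant of order K^2
  bounds them for every subdivision, so the radius \<open>\<delta>\<close> is fixed first and the
  number of steps is then chosen to bring each quotient that close to I.\<close>

lemma approximable_homotopy:
  fixes V :: "real \<Rightarrow> real \<Rightarrow> complex^'n^'n"
  assumes \<alpha>: "1 < \<alpha>"
    and lip: "\<And>s. 0 \<le> s \<Longrightarrow> s \<le> 1 \<Longrightarrow> lip_bound_mat \<alpha> K (V s)"
    and SU: "\<And>s t. 0 \<le> s \<Longrightarrow> s \<le> 1 \<Longrightarrow> V s t \<in> SU"
    and cont: "\<And>s s' t. 0 \<le> s \<Longrightarrow> s \<le> 1 \<Longrightarrow> 0 \<le> s' \<Longrightarrow> s' \<le> 1 \<Longrightarrow> norm (V s t - V s' t) \<le> L * \<bar>s - s'\<bar>"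
    and V0: "\<And>t. V 0 t = mat 1"
  shows "approximable \<alpha> (V 1)"
proof -
  let ?d = "dim2 TYPE('n)"
  have d1: "1 \<le> ?d" by (rule dim2_ge_1)
  obtain \<delta> where \<delta>: "0 < \<delta>" "\<And>R :: real \<Rightarrow> complex^'n^'n.
     lip_bound_mat \<alpha> (real CARD('n) * (3 * 2 powr \<alpha> * K * K)) R \<Longrightarrow> (\<forall>t. R t \<in> SU) \<Longrightarrow>
     (\<forall>t. norm (R t - mat 1) \<le> \<delta>) \<Longrightarrow> approximable \<alpha> R"
    using approximable_near_identity[OF \<alpha>] by blast
  obtain m0 :: nat where m0: "?d * L / \<delta> \<le> real m0" using real_arch_simple by blast
  define m where "m = Suc m0"
  have mL: "?d * (L / real m) \<le> \<delta>"
  proof -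
    have "?d * L \<le> \<delta> * real m" using m0 \<delta>(1) by (simp add: m_def field_simps)
    thus ?thesis by (simp add: m_def field_simps)
  qed
  have "k \<le> m \<Longrightarrow> approximable \<alpha> (V (real k / real m))" for k
  proof (induction k)
    case 0
    have "V 0 = (\<lambda>t. mat 1)" by (rule ext) (rule V0)
    thus ?case using approximable_const[OF SU_mat_1] by simp
  next
    case (Suc k)
    define s where "s = real k / real m"
    define s' where "s' = real (Suc k) / real m"
    have s: "0 \<le> s" "s \<le> 1" "0 \<le> s'" "s' \<le> 1" using Suc.prems by (auto simp: s_def s'_def m_def)
    have ss: "\<bar>s' - s\<bar> = 1 / real m" by (simp add: s_def s'_def m_def field_simps)
    define R where "R = (\<lambda>t. cadjoint (V s t) ** V s' t)"
    have RSU: "R t \<in> SU" for t unfolding R_def by (intro SU_mult SU_cadjoint SU s)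
    have "approximable \<alpha> R"
    proof (rule \<delta>(2))
      show "lip_bound_mat \<alpha> (real CARD('n) * (3 * 2 powr \<alpha> * K * K)) R"
        unfolding R_def using \<alpha> s by (intro lip_bound_mat_mult lip_bound_mat_cadjoint lip) auto
      have "norm (R t - mat 1) \<le> \<delta>" for t
      proof -
        have "R t - mat 1 = cadjoint (V s t) ** (V s' t - V s t)"
          using SU[OF s(1,2), of t] by (simp add: R_def matrix_diff_ldistrib SU_def)
        also have "norm \<dots> \<le> ?d * (L / real m)"
          using cont[OF s(3,4) s(1,2), of t] SU_norm_le[OF SU[OF s(1,2), of t]] d1 unfolding ss
          by (intro order_trans[OF norm_matrix_mult_le] mult_mono) auto
        finally show ?thesis using mL by linarith
      qed
      thus "\<forall>t. norm (R t - mat 1) \<le> \<delta>" by blast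
    qed (use RSU in blast)
    hence "approximable \<alpha> (\<lambda>t. V s t ** R t)"
      using Suc \<alpha> RSU by (intro approximable_mult) (auto simp: s_def)
    moreover have "V s t ** R t = V s' t" for t
      unfolding R_def by (rule SU_cancel_left[OF SU[OF s(1,2)]])
    ultimately show ?case by (simp add: s'_def)
  qed
  from this[of m] show ?thesis by (simp add: m_def)
qed

section \<open>Unitaries carrying a basis vector to a moving vector\<close>

text \<open>A complex reflection I - h w w*. For fixed nonzero w the values of h that make it
  unitary form a circle through 0, which is the room in which the path to I is found.\<close>

definition rank1_unitary :: "complex \<Rightarrow> complex^'n \<Rightarrow> complex^'n^'n" where
  "rank1_unitary h w = (\<chi> k l. (if k = l then 1 else 0) - h * (w $ k * cnj (w $ l)))"

text \<open>Repairs the determinant by a phase in column j, leaving the prescribed column i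
  untouched when i and j differ.\<close>

definition scale_column :: "'n \<Rightarrow> complex \<Rightarrow> complex^'n^'n \<Rightarrow> complex^'n^'n" where
  "scale_column j \<mu> A = (\<chi> k l. A $ k $ l * (if l = j then \<mu> else 1))"

lemma rank1_unitary_unitary:
  fixes w :: "complex^'n"
  assumes "h + cnj h = h * cnj h * of_real (\<Sum>k\<in>UNIV. (norm (w $ k))\<^sup>2)"
  shows "rank1_unitary h w ** cadjoint (rank1_unitary h w) = mat 1"
proof -
  let ?s = "of_real (\<Sum>k\<in>UNIV. (norm (w $ k))\<^sup>2) :: complex"
  have s: "?s = (\<Sum>p\<in>UNIV. cnj (w $ p) * w $ p)"
    by (simp only: of_real_sum complex_norm_square mult.commute)
  define \<delta> :: "'n \<Rightarrow> 'n \<Rightarrow> complex" where "\<delta> = (\<lambda>k p. if k = p then 1 else 0)"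
  have \<delta>: "cnj (\<delta> k p) = \<delta> k p" "(\<Sum>p\<in>UNIV. \<delta> k p * f p) = f k" for k p f
    by (auto simp: \<delta>_def if_distrib[of "\<lambda>x. x * _"] cong: if_cong)
  have "(\<Sum>p\<in>UNIV. rank1_unitary h w $ k $ p * cnj (rank1_unitary h w $ l $ p)) = \<delta> l k" for k l
  proof -
    have "(\<Sum>p\<in>UNIV. rank1_unitary h w $ k $ p * cnj (rank1_unitary h w $ l $ p))
       = (\<Sum>p\<in>UNIV. \<delta> k p * \<delta> l p - \<delta> k p * (cnj h * cnj (w $ l) * w $ p) - \<delta> l p * (h * w $ k * cnj (w $ p))
            + (h * cnj h * w $ k * cnj (w $ l)) * (cnj (w $ p) * w $ p))"
    proof (rule sum.cong[OF refl])
      fix p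
      have r: "rank1_unitary h w $ a $ p = \<delta> a p - h * (w $ a * cnj (w $ p))" for a
        by (simp add: rank1_unitary_def \<delta>_def)
      show "rank1_unitary h w $ k $ p * cnj (rank1_unitary h w $ l $ p) =
         \<delta> k p * \<delta> l p - \<delta> k p * (cnj h * cnj (w $ l) * w $ p) - \<delta> l p * (h * w $ k * cnj (w $ p))
            + (h * cnj h * w $ k * cnj (w $ l)) * (cnj (w $ p) * w $ p)"
        unfolding r by (simp add: \<delta>(1) algebra_simps)
    qed
    also have "\<dots> = \<delta> l k - (cnj h * cnj (w $ l) * w $ k) - (h * w $ k * cnj (w $ l))
        + (h * cnj h * w $ k * cnj (w $ l)) * ?s"
      unfolding s sum.distrib sum_subtractf \<delta>(2) sum_distrib_left ..
    also have "\<dots> = \<delta> l k - w $ k * cnj (w $ l) * ((h + cnj h) - h * cnj h * ?s)"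
      by (simp add: algebra_simps del: of_real_sum)
    also have "\<dots> = \<delta> l k" unfolding assms by simp
    finally show ?thesis .
  qed
  thus ?thesis by (auto simp: vec_eq_iff matrix_matrix_mult_def mat_def \<delta>_def)
qed

lemma unitary_scale_column_SU:
  fixes A :: "complex^'n^'n"
  assumes A: "A ** cadjoint A = mat 1"
  shows "scale_column j (cnj (det A)) A \<in> SU"
proof (rule SU_I)
  have dd: "det A * cnj (det A) = 1"
    using arg_cong[OF A, of det] by (simp add: det_mul det_cadjoint)
  define S :: "complex^'n^'n" where "S = (\<chi> k l. if k = l then if l = j then cnj (det A) else 1 else 0)"
  have "scale_column j (cnj (det A)) A = A ** S"
    by (simp add: vec_eq_iff scale_column_def S_def matrix_matrix_mult_def if_distrib[of "(*) _"] cong: if_cong)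
  moreover have "det S = cnj (det A)"
  proof -
    have "det S = (\<Prod>k\<in>UNIV. S $ k $ k)" by (rule det_diagonal) (simp add: S_def)
    also have "\<dots> = (\<Prod>k\<in>UNIV. if k = j then cnj (det A) else 1)" by (simp add: S_def)
    also have "\<dots> = cnj (det A)" by simp
    finally show ?thesis .
  qed
  ultimately show "det (scale_column j (cnj (det A)) A) = 1" by (metis dd det_mul)
  have "scale_column j (cnj (det A)) A $ k $ p * cnj (scale_column j (cnj (det A)) A $ l $ p)
      = A $ k $ p * cnj (A $ l $ p)" for k l p
  proof (cases "p = j")
    case True
    have "A $ k $ p * cnj (det A) * cnj (A $ l $ p * cnj (det A))
        = A $ k $ p * cnj (A $ l $ p) * (det A * cnj (det A))"
      by (simp only: complex_cnj_mult complex_cnj_cnj mult_ac)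
    thus ?thesis using True unfolding dd by (simp add: scale_column_def)
  qed (simp add: scale_column_def)
  hence "scale_column j (cnj (det A)) A ** cadjoint (scale_column j (cnj (det A)) A) = A ** cadjoint A"
    by (simp add: matrix_matrix_mult_def vec_eq_iff)
  thus "scale_column j (cnj (det A)) A ** cadjoint (scale_column j (cnj (det A)) A) = mat 1"
    using A by simp
qed

text \<open>The unitaries \<open>I - h w w\<^sup>*\<close> with \<open>w = e\<^sub>i - u\<close> and \<open>1/h = (1 - cnj u\<^sub>i) + \<i> y\<close>, \<open>y\<close> real,
  join the one with \<open>y = 0\<close>, which maps \<open>e\<^sub>i\<close> to \<open>u\<close>, to the identity as \<open>y \<rightarrow> \<infinity>\<close>;
  the parameter is \<open>s = 1 / (1 + y)\<close>.\<close>

definition unitary_path :: "'n \<Rightarrow> 'n \<Rightarrow> complex^'n \<Rightarrow> real \<Rightarrow> complex^'n^'n" where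
  "unitary_path i j u s = (let A = rank1_unitary
      (of_real s / (of_real s * (1 - cnj (u $ i)) + \<i> * of_real (1 - s))) (axis i 1 - u)
    in scale_column j (cnj (det A)) A)"

text \<open>\<open>lip_bound_inverse\<close> wants a real part bounded below, but q runs from i at s
  = 0 to 1 - cnj z at s = 1. Multiplied by 1 - i c/2 it has real part Re q + (c/2) Im q >= s c +
  (c/2) (1 - 2 s) = c/2; the tilt c/2 is the one that cancels s.\<close>

lemma path_denominator:
  fixes z :: complex and s c :: real
  assumes z: "norm z \<le> 1" "Re z \<le> 1 - c" and c: "0 < c" and s: "0 \<le> s" "s \<le> 1"
  defines "q \<equiv> of_real s * (1 - cnj z) + \<i> * of_real (1 - s)"
  shows "c / 2 \<le> Re ((1 - \<i> * of_real (c / 2)) * q)" "c / (2 + c) \<le> norm q"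
proof -
  have im: "- 1 \<le> Im z" using abs_Im_le_cmod[of z] z(1) by linarith
  have "Re ((1 - \<i> * of_real (c / 2)) * q) = s * (1 - Re z) + c / 2 * (s * Im z + (1 - s))"
  proof -
    have "Re q = s * (1 - Re z)" "Im q = s * Im z + (1 - s)" by (simp_all add: q_def)
    moreover have "Re ((1 - \<i> * of_real b) * q) = Re q + b * Im q" for b
      by (simp add: left_diff_distrib)
    ultimately show ?thesis by metis
  qed
  moreover have "s * c \<le> s * (1 - Re z)" using s z by (intro mult_left_mono) auto
  moreover have "s * (- 1) \<le> s * Im z" using s im by (intro mult_left_mono) auto
  hence "c / 2 * (s * (- 1) + (1 - s)) \<le> c / 2 * (s * Im z + (1 - s))"
    using c by (intro mult_left_mono) auto
  ultimately show 1: "c / 2 \<le> Re ((1 - \<i> * of_real (c / 2)) * q)"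
    by (simp add: algebra_simps)
  have "norm (1 - \<i> * of_real (c / 2)) \<le> 1 + c / 2"
    using norm_triangle_ineq4[of 1 "\<i> * of_real (c / 2)"] c by (simp add: norm_mult)
  hence "norm ((1 - \<i> * of_real (c / 2)) * q) \<le> (1 + c / 2) * norm q"
    unfolding norm_mult by (intro mult_right_mono) auto
  hence "c / 2 \<le> (1 + c / 2) * norm q"
    using 1 complex_Re_le_cmod[of "(1 - \<i> * of_real (c / 2)) * q"] by linarith
  thus "c / (2 + c) \<le> norm q" using c by (simp add: field_simps)
qed

text \<open>For h = s/q the condition follows from q + cnj q = s |e_i - u|^2, and both sides equal s
  (2 - 2 Re u_i).\<close>

lemma path_coefficient_unitary:
  fixes u :: "complex^'n" and s :: real and i :: 'n
  assumes u: "(\<Sum>k\<in>UNIV. (norm (u $ k))\<^sup>2) = 1"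
  defines "q \<equiv> of_real s * (1 - cnj (u $ i)) + \<i> * of_real (1 - s)"
  assumes q: "q \<noteq> 0"
  shows "of_real s / q + cnj (of_real s / q) = (of_real s / q) * cnj (of_real s / q)
     * of_real (\<Sum>k\<in>UNIV. (norm ((axis i 1 - u) $ k))\<^sup>2)"
proof -
  have "(norm ((axis i 1 - u) $ k))\<^sup>2 = (norm (u $ k))\<^sup>2 + (if k = i then 1 - 2 * Re (u $ k) else 0)" for k
    unfolding cmod_power2 by (simp add: axis_def power2_eq_square algebra_simps)
  hence w: "(\<Sum>k\<in>UNIV. (norm ((axis i 1 - u) $ k))\<^sup>2) = 2 - 2 * Re (u $ i)"
    using u by (simp add: sum.distrib)
  have "of_real s * (q + cnj q) = of_real s * of_real s * of_real (2 - 2 * Re (u $ i))"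
    by (simp add: q_def complex_eq_iff algebra_simps)
  hence "of_real s * (q + cnj q) / (q * cnj q) = of_real s * of_real s * of_real (2 - 2 * Re (u $ i)) / (q * cnj q)"
    by simp
  moreover have "of_real s / q + cnj (of_real s / q) = of_real s * (q + cnj q) / (q * cnj q)"
    using q by (simp add: field_simps)
  moreover have "(of_real s / q) * cnj (of_real s / q) * of_real (2 - 2 * Re (u $ i))
     = of_real s * of_real s * of_real (2 - 2 * Re (u $ i)) / (q * cnj q)" by simp
  ultimately show ?thesis unfolding w by metis
qed

text \<open>At s = 1, h = 1 / (1 - cnj u_i) is the inverse of cnj w_i, so column i is e_i - w = u.
  If u_l = 0 for l other than i and j, then w_l = 0 and column l stays a basis vector, which
  protects coordinates already split off.\<close>

lemma unitary_path_properties: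
  fixes u :: "complex^'n"
  assumes u: "(\<Sum>k\<in>UNIV. (norm (u $ k))\<^sup>2) = 1" and c: "0 < c" "Re (u $ i) \<le> 1 - c"
    and ij: "i \<noteq> j" and s: "0 \<le> s" "s \<le> 1"
  shows "unitary_path i j u s \<in> SU" "unitary_path i j u 0 = mat 1"
    "unitary_path i j u 1 $ k $ i = u $ k"
    "l \<noteq> i \<Longrightarrow> l \<noteq> j \<Longrightarrow> u $ l = 0 \<Longrightarrow> unitary_path i j u s $ k $ l = (if k = l then 1 else 0)"
proof -
  have "(norm (u $ i))\<^sup>2 \<le> (\<Sum>k\<in>UNIV. (norm (u $ k))\<^sup>2)" by (rule member_le_sum) auto
  hence ui: "norm (u $ i) \<le> 1" unfolding u by (simp add: power_le_one_iff)
  have "0 < norm (of_real s * (1 - cnj (u $ i)) + \<i> * of_real (1 - s))"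
    using path_denominator(2)[OF ui c(2,1) s] c by (smt (verit) divide_pos_pos)
  thus "unitary_path i j u s \<in> SU" unfolding unitary_path_def Let_def
    by (intro unitary_scale_column_SU rank1_unitary_unitary path_coefficient_unitary u) auto
  have "rank1_unitary 0 w = mat 1" for w :: "complex^'n"
    by (simp add: rank1_unitary_def mat_def)
  hence "unitary_path i j u 0 = scale_column j 1 (mat 1)" by (simp add: unitary_path_def)
  thus "unitary_path i j u 0 = mat 1" by (simp add: scale_column_def vec_eq_iff)
  have "1 - cnj (u $ i) \<noteq> 0" using c by (auto simp: complex_eq_iff)
  thus "unitary_path i j u 1 $ k $ i = u $ k"
    using ij by (simp add: unitary_path_def scale_column_def rank1_unitary_def axis_def Let_def)
  show "unitary_path i j u s $ k $ l = (if k = l then 1 else 0)" if "l \<noteq> i" "l \<noteq> j" "u $ l = 0"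
    using that by (simp add: unitary_path_def scale_column_def rank1_unitary_def axis_def Let_def)
qed

lemma unit_vector_entry_le:
  fixes u :: "complex^'n"
  assumes "(\<Sum>k\<in>UNIV. (norm (u $ k))\<^sup>2) = 1" shows "norm (u $ k) \<le> 1"
proof -
  have "(norm (u $ k))\<^sup>2 \<le> (\<Sum>k\<in>UNIV. (norm (u $ k))\<^sup>2)" by (rule member_le_sum) auto
  thus ?thesis unfolding assms by (simp add: power_le_one_iff)
qed

lemma unitary_det_norm:
  assumes "A ** cadjoint A = mat 1" shows "norm (det A) = 1"
proof -
  have "det A * cnj (det A) = 1" using arg_cong[OF assms, of det] by (simp add: det_mul det_cadjoint)
  hence "(norm (det A))\<^sup>2 = 1" by (metis complex_norm_square of_real_eq_1_iff)
  thus ?thesis by (simp add: power2_eq_1_iff) (smt (verit) norm_ge_zero)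
qed

lemma unitary_path_lipschitz:
  fixes i j :: "'n::finite"
  assumes c: "0 < c"
  shows "\<exists>L. \<forall>(u :: complex^'n) s s'. (\<Sum>k\<in>UNIV. (norm (u $ k))\<^sup>2) = 1 \<longrightarrow> Re (u $ i) \<le> 1 - c \<longrightarrow>
     0 \<le> s \<longrightarrow> s \<le> 1 \<longrightarrow> 0 \<le> s' \<longrightarrow> s' \<le> 1 \<longrightarrow>
     norm (unitary_path i j u s - unitary_path i j u s') \<le> L * \<bar>s - s'\<bar>"
proof -
  obtain C where C: "0 \<le> C" "\<And>(A :: complex^'n^'n) B e. (\<forall>i j. norm (A $ i $ j) \<le> 1) \<Longrightarrow> (\<forall>i j. norm (B $ i $ j) \<le> 1) \<Longrightarrow>
     (\<forall>i j. norm (A $ i $ j - B $ i $ j) \<le> e) \<Longrightarrow> norm (det A - det B) \<le> C * e"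
    using det_lipschitz[where 'n='n] by blast
  define b where "b = c / (2 + c)"
  have b: "0 < b" using c by (simp add: b_def)
  have "norm (unitary_path i j u s - unitary_path i j u s') \<le> dim2 TYPE('n) * ((1 + C) * (4 / b\<^sup>2)) * \<bar>s - s'\<bar>"
    if u: "(\<Sum>k\<in>UNIV. (norm (u $ k))\<^sup>2) = 1" "Re (u $ i) \<le> 1 - c"
      and s: "0 \<le> s" "s \<le> 1" "0 \<le> s'" "s' \<le> 1" for u :: "complex^'n" and s s'
  proof -
    define q where "q = (\<lambda>s. of_real s * (1 - cnj (u $ i)) + \<i> * of_real (1 - s) :: complex)"
    define w where "w = axis i 1 - u"
    define A where "A = (\<lambda>s. rank1_unitary (of_real s / q s) w)"
    have ue: "norm (u $ k) \<le> 1" for k by (rule unit_vector_entry_le[OF u(1)])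
    have qb: "b \<le> norm (q s)" if "0 \<le> s" "s \<le> 1" for s
      unfolding b_def q_def by (rule path_denominator(2)[OF ue u(2) c that])
    have q0: "q s \<noteq> 0" if "0 \<le> s" "s \<le> 1" for s using qb[OF that] b by auto
    have uA: "A s ** cadjoint (A s) = mat 1" if "0 \<le> s" "s \<le> 1" for s
      unfolding A_def w_def q_def
      by (intro rank1_unitary_unitary path_coefficient_unitary u) (use q0[OF that] in \<open>simp add: q_def\<close>)
    have we: "norm (w $ k) \<le> 2" for k
      using norm_triangle_ineq4[of "axis i 1 $ k" "u $ k"] ue[of k] by (auto simp: w_def axis_def split: if_splits)
    have hd: "norm (of_real s / q s - of_real s' / q s') \<le> \<bar>s - s'\<bar> / b\<^sup>2"
    proof -
      \<comment> \<open>The cross difference is exactly i (s - s'), so s/q is Lipschitz in s given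
        only the lower bound for |q|.\<close>
      have "of_real s * q s' - of_real s' * q s = \<i> * of_real (s - s')"
        by (simp add: q_def algebra_simps)
      hence "of_real s / q s - of_real s' / q s' = \<i> * of_real (s - s') / (q s * q s')"
        using q0 s by (simp add: diff_frac_eq mult.commute)
      also have "norm \<dots> = \<bar>s - s'\<bar> / (norm (q s) * norm (q s'))"
        by (simp add: norm_divide norm_mult del: of_real_diff)
      also have "\<dots> \<le> \<bar>s - s'\<bar> / (b * b)"
        using qb s b by (intro divide_left_mono mult_mono) (auto intro!: mult_pos_pos simp: q0)
      finally show ?thesis by (simp add: power2_eq_square)
    qed
    define e where "e = 4 / b\<^sup>2 * \<bar>s - s'\<bar>"
    have Ad: "norm (A s $ k $ l - A s' $ k $ l) \<le> e" for k l
    proof -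
      have "A s $ k $ l - A s' $ k $ l = - ((of_real s / q s - of_real s' / q s') * (w $ k * cnj (w $ l)))"
        by (simp add: A_def rank1_unitary_def algebra_simps)
      hence "norm (A s $ k $ l - A s' $ k $ l) = norm (of_real s / q s - of_real s' / q s') * (norm (w $ k) * norm (w $ l))"
        by (simp only: norm_minus_cancel norm_mult complex_mod_cnj)
      also have "\<dots> \<le> \<bar>s - s'\<bar> / b\<^sup>2 * (2 * 2)" by (intro mult_mono hd we) auto
      finally show ?thesis by (simp add: e_def mult.commute)
    qed
    have Ae: "norm (A s $ k $ l) \<le> 1" if "0 \<le> s" "s \<le> 1" for s k l
      by (rule unitary_entry_le[OF uA[OF that]])
    have dd: "norm (det (A s) - det (A s')) \<le> C * e" using Ae s Ad by (intro C(2)) auto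
    have e0: "0 \<le> e" using b by (simp add: e_def)
    have "norm ((unitary_path i j u s - unitary_path i j u s') $ k $ l) \<le> (1 + C) * e" for k l
    proof (cases "l = j")
      case True
      have "(unitary_path i j u s - unitary_path i j u s') $ k $ l
          = (A s $ k $ l - A s' $ k $ l) * cnj (det (A s)) + A s' $ k $ l * cnj (det (A s) - det (A s'))"
        using True by (simp add: unitary_path_def scale_column_def A_def w_def q_def Let_def algebra_simps)
      also have "norm \<dots> \<le> norm (A s $ k $ l - A s' $ k $ l) * norm (det (A s))
          + norm (A s' $ k $ l) * norm (det (A s) - det (A s'))"
        by (metis complex_mod_cnj norm_mult norm_triangle_ineq)
      also have "\<dots> \<le> e * 1 + 1 * (C * e)"
        using Ad dd Ae s e0 unitary_det_norm[OF uA[OF s(1,2)]] by (intro add_mono mult_mono) auto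
      finally show ?thesis by (simp add: algebra_simps)
    next
      case False
      have "(unitary_path i j u s - unitary_path i j u s') $ k $ l = A s $ k $ l - A s' $ k $ l"
        using False by (simp add: unitary_path_def scale_column_def A_def w_def q_def Let_def)
      moreover have "e \<le> (1 + C) * e" using C(1) e0 by (simp add: distrib_right)
      ultimately show ?thesis using Ad[of k l] by simp
    qed
    from norm_le_entries[OF this] show ?thesis unfolding dim2_def e_def mult.assoc .
  qed
  thus ?thesis by blast
qed

text \<open>The constant has to be uniform in s for \<open>approximable_homotopy\<close>. The path
  is built from sums, products, conjugates, one quotient and a determinant, and
  \<open>lip_bound\<close> is closed under all of these with explicit control.\<close>

lemma unitary_path_lip_bound:
  fixes i j :: "'n::finite"
  assumes \<alpha>: "0 < \<alpha>" and c: "0 < c"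
  shows "\<exists>K'. \<forall>(u :: real \<Rightarrow> complex^'n) s. (\<forall>k. lip_bound \<alpha> K (\<lambda>t. u t $ k)) \<longrightarrow>
     (\<forall>t. (\<Sum>k\<in>UNIV. (norm (u t $ k))\<^sup>2) = 1) \<longrightarrow> (\<forall>t. Re (u t $ i) \<le> 1 - c) \<longrightarrow>
     0 \<le> s \<longrightarrow> s \<le> 1 \<longrightarrow> lip_bound_mat \<alpha> K' (\<lambda>t. unitary_path i j (u t) s)"
proof -
  \<comment> \<open>These constants keep the unsimplified shape in which the closure rules return
    them, hence factors such as \<open>1 * K\<close>.\<close>
  define K1 where "K1 = (1 + c / 2) * (1 * (1 + 1 * K) + 1)"
  obtain L where L: "\<And>f. lip_bound \<alpha> K1 f \<Longrightarrow> (\<forall>t. c / 2 \<le> Re (f t)) \<Longrightarrow> lip_bound \<alpha> L (\<lambda>t. 1 / f t)"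
    using lip_bound_inverse[OF \<alpha>, of "c / 2" K1] c by auto
  define Kw where "Kw = 1 + 1 * K"
  define K2 where "K2 = 1 + 1 * (3 * 2 powr \<alpha> * ((1 + c / 2) * L) * (3 * 2 powr \<alpha> * Kw * Kw))"
  obtain Ld where Ld: "\<And>U :: real \<Rightarrow> complex^'n^'n. lip_bound_mat \<alpha> K2 U \<Longrightarrow> lip_bound \<alpha> Ld (\<lambda>t. det (U t))"
    using lip_bound_det[of \<alpha> K2] \<alpha> by auto
  have "lip_bound_mat \<alpha> (3 * 2 powr \<alpha> * K2 * max 1 Ld) (\<lambda>t. unitary_path i j (u t) s)"
    if u: "\<forall>k. lip_bound \<alpha> K (\<lambda>t. u t $ k)" "\<forall>t. (\<Sum>k\<in>UNIV. (norm (u t $ k))\<^sup>2) = 1"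
      "\<forall>t. Re (u t $ i) \<le> 1 - c" and s: "0 \<le> s" "s \<le> 1" for u :: "real \<Rightarrow> complex^'n" and s
  proof -
    define \<zeta> where "\<zeta> = 1 - \<i> * complex_of_real (c / 2)"
    have n\<zeta>: "norm \<zeta> \<le> 1 + c / 2"
      unfolding \<zeta>_def using norm_triangle_ineq4[of 1 "\<i> * of_real (c / 2)"] c by (simp add: norm_mult)
    have \<zeta>0: "\<zeta> \<noteq> 0" by (auto simp: \<zeta>_def complex_eq_iff)
    define q where "q = (\<lambda>t. of_real s * (1 - cnj (u t $ i)) + \<i> * of_real (1 - s))"
    define A where "A = (\<lambda>t. rank1_unitary (of_real s / q t) (axis i 1 - u t))"
    have ue: "norm (u t $ k) \<le> 1" for t k using unit_vector_entry_le u(2) by blast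
    have "lip_bound \<alpha> K1 (\<lambda>t. \<zeta> * (of_real s * (1 + (-1) * cnj (u t $ i)) + \<i> * of_real (1 - s)))"
      unfolding K1_def using s n\<zeta> u(1)
      by (intro lip_bound_cmul lip_bound_add lip_bound_const lip_bound_cnj)
         (auto simp: norm_mult simp del: of_real_diff)
    hence f1: "lip_bound \<alpha> K1 (\<lambda>t. \<zeta> * q t)" by (simp add: q_def)
    have "lip_bound \<alpha> L (\<lambda>t. 1 / (\<zeta> * q t))"
      by (rule L[OF f1]) (use path_denominator(1)[OF ue _ c s] u(3) in \<open>auto simp: \<zeta>_def q_def\<close>)
    moreover have "norm (of_real s * \<zeta>) \<le> 1 + c / 2"
      using s n\<zeta> c by (simp add: norm_mult) (smt (verit) mult_left_le_one_le norm_ge_zero)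
    ultimately have "lip_bound \<alpha> ((1 + c / 2) * L) (\<lambda>t. (of_real s * \<zeta>) * (1 / (\<zeta> * q t)))"
      by (rule lip_bound_cmul)
    hence h: "lip_bound \<alpha> ((1 + c / 2) * L) (\<lambda>t. of_real s / q t)" using \<zeta>0 by simp
    have "lip_bound \<alpha> Kw (\<lambda>t. axis i 1 $ k + (-1) * u t $ k)" for k
      unfolding Kw_def using u(1) by (intro lip_bound_cmul lip_bound_add lip_bound_const) (auto simp: axis_def)
    hence w: "lip_bound \<alpha> Kw (\<lambda>t. (axis i 1 - u t) $ k)" for k by simp
    have A: "lip_bound \<alpha> K2 (\<lambda>t. A t $ k $ l)" for k l
    proof -
      have "lip_bound \<alpha> K2 (\<lambda>t. (if k = l then 1 else 0) + (-1) * ((of_real s / q t) * ((axis i 1 - u t) $ k * cnj ((axis i 1 - u t) $ l))))"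
        unfolding K2_def using \<alpha>
        by (intro lip_bound_add lip_bound_const lip_bound_cmul lip_bound_mult h w lip_bound_cnj) auto
      thus ?thesis by (simp add: A_def rank1_unitary_def)
    qed
    have d: "lip_bound \<alpha> (max 1 Ld) (\<lambda>t. if l = j then cnj (det (A t)) else 1)" for l
    proof (cases "l = j")
      case True
      have "lip_bound \<alpha> Ld (\<lambda>t. det (A t))" by (rule Ld) (simp add: lip_bound_mat_def A)
      thus ?thesis using True by (auto intro: lip_bound_mono lip_bound_cnj)
    qed (auto intro: lip_bound_const)
    have "lip_bound \<alpha> (3 * 2 powr \<alpha> * K2 * max 1 Ld) (\<lambda>t. A t $ k $ l * (if l = j then cnj (det (A t)) else 1))" for k l
      using \<alpha> by (intro lip_bound_mult A d) auto
    moreover have "unitary_path i j (u t) s $ k $ l = A t $ k $ l * (if l = j then cnj (det (A t)) else 1)" for t k l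
      unfolding unitary_path_def scale_column_def A_def q_def Let_def vec_lambda_beta ..
    ultimately show ?thesis unfolding lip_bound_mat_def by simp
  qed
  thus ?thesis by blast
qed

lemma unitary_path_approximable:
  fixes u :: "real \<Rightarrow> complex^'n" and i j :: 'n
  assumes \<alpha>: "1 < \<alpha>" and c: "0 < c" and ij: "i \<noteq> j"
    and lip: "\<And>k. lip_bound \<alpha> K (\<lambda>t. u t $ k)"
    and u: "\<And>t. (\<Sum>k\<in>UNIV. (norm (u t $ k))\<^sup>2) = 1" "\<And>t. Re (u t $ i) \<le> 1 - c"
  shows "approximable \<alpha> (\<lambda>t. unitary_path i j (u t) 1)"
    "\<exists>K'. lip_bound_mat \<alpha> K' (\<lambda>t. unitary_path i j (u t) 1)"
proof -
  obtain K' where K': "\<And>s. 0 \<le> s \<Longrightarrow> s \<le> 1 \<Longrightarrow> lip_bound_mat \<alpha> K' (\<lambda>t. unitary_path i j (u t) s)"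
    using unitary_path_lip_bound[OF order_less_trans[OF zero_less_one \<alpha>] c, of K i j] lip u by blast
  obtain L where L: "\<And>s s' t. 0 \<le> s \<Longrightarrow> s \<le> 1 \<Longrightarrow> 0 \<le> s' \<Longrightarrow> s' \<le> 1 \<Longrightarrow>
     norm (unitary_path i j (u t) s - unitary_path i j (u t) s') \<le> L * \<bar>s - s'\<bar>"
    using unitary_path_lipschitz[OF c, of i j] u by blast
  show "approximable \<alpha> (\<lambda>t. unitary_path i j (u t) 1)"
    by (rule approximable_homotopy[where V = "\<lambda>s t. unitary_path i j (u t) s", OF \<alpha> K' _ L])
       (auto intro: unitary_path_properties[OF u(1) c u(2) ij])
  show "\<exists>K'. lip_bound_mat \<alpha> K' (\<lambda>t. unitary_path i j (u t) 1)" using K'[of 1] by auto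
qed

section \<open>Missing a point of the sphere\<close>

lemma ek_lipschitz: "norm (ek k s - ek k t) \<le> \<bar>real_of_int k\<bar> * \<bar>s - t\<bar>"
proof -
  have "ek k s - ek k t = ek k t * (exp (\<i> * of_real (of_int k * (s - t))) - 1)"
    unfolding right_diff_distrib mult_exp_exp by (simp add: algebra_simps)
  hence "norm (ek k s - ek k t) = norm (exp (\<i> * of_real (of_int k * (s - t))) - 1)"
    by (simp only: norm_mult norm_ek mult_1)
  also have "\<dots> = 2 * \<bar>sin (of_int k * (s - t) / 2)\<bar>" by (rule dist_exp_i_1)
  also have "\<dots> \<le> \<bar>of_int k * (s - t)\<bar>"
    using abs_sin_x_le_abs_x[of "of_int k * (s - t) / 2"] by simp
  finally show ?thesis by (simp add: abs_mult)
qed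

text \<open>A crude Bernstein inequality: every coefficient is at most B by Parseval, and 2 n + 1 of
  them with frequency at most n give order n^2 instead of n. Using three real coordinates below
  leaves room for this loss.\<close>

lemma trig_poly_lipschitz:
  assumes p: "trig_poly n p" and B: "\<And>t. norm (p t) \<le> B"
  shows "norm (p s - p t) \<le> real (2 * n + 1) * (B * real n * \<bar>s - t\<bar>)"
proof -
  obtain c where c: "\<And>t. p t = ek (- int n) t * (\<Sum>k\<le>2*n. c k * ek (int k) t)"
    using trig_poly_nat[OF p] by blast
  have B0: "0 \<le> B" using B norm_ge_zero order_trans by blast
  have "norm (\<Sum>k\<le>2*n. c k * ek (int k) t) \<le> B" for t
  proof -
    have "norm (p t) = norm (\<Sum>k\<le>2*n. c k * ek (int k) t)" by (simp only: c norm_mult norm_ek mult_1)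
    thus ?thesis using B[of t] by simp
  qed
  hence ps: "(\<Sum>k\<le>2*n. (norm (c k))\<^sup>2) \<le> B\<^sup>2" by (rule parseval_le)
  have cB: "norm (c k) \<le> B" if "k \<le> 2 * n" for k
  proof (rule power2_le_imp_le[OF _ B0])
    have "(norm (c k))\<^sup>2 \<le> (\<Sum>k\<le>2*n. (norm (c k))\<^sup>2)" using that by (intro member_le_sum) auto
    thus "(norm (c k))\<^sup>2 \<le> B\<^sup>2" using ps by linarith
  qed
  have pe: "p t = (\<Sum>k\<le>2*n. c k * ek (int k - int n) t)" for t
    unfolding c sum_distrib_left
    by (rule sum.cong) (auto simp: ring_distribs exp_diff exp_minus divide_inverse mult_ac)
  have "norm (p s - p t) = norm (\<Sum>k\<le>2*n. c k * (ek (int k - int n) s - ek (int k - int n) t))"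
    unfolding pe by (simp only: sum_subtractf right_diff_distrib)
  also have "\<dots> \<le> real (card {..2*n}) * (B * real n * \<bar>s - t\<bar>)"
  proof (rule sum_norm_bound)
    fix k assume k: "k \<in> {..2*n}"
    have "norm (ek (int k - int n) s - ek (int k - int n) t) \<le> \<bar>real_of_int (int k - int n)\<bar> * \<bar>s - t\<bar>"
      by (rule ek_lipschitz)
    also have "\<dots> \<le> real n * \<bar>s - t\<bar>" using k by (intro mult_right_mono) auto
    finally show "norm (c k * (ek (int k - int n) s - ek (int k - int n) t)) \<le> B * real n * \<bar>s - t\<bar>"
      unfolding norm_mult mult.assoc using cB[of k] k B0 by (intro mult_mono) auto
  qed
  finally show ?thesis by simp
qed

lemma trig_poly_periodic:
  assumes "trig_poly n p" shows "p (t - 2 * pi * of_int m) = p t"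
proof -
  have "ek k (t - 2 * pi * of_int m) = ek k t" for k
  proof -
    have "\<i> * of_int k * of_real (t - 2 * pi * of_int m)
        = \<i> * of_int k * of_real t - of_int (k * m) * (of_real (2 * pi) * \<i>)"
      by (simp add: algebra_simps)
    thus ?thesis using exp_integer_2pi[of "of_int (k * m)"] by (simp add: exp_diff mult_ac)
  qed
  thus ?thesis using assms unfolding trig_poly_def by (metis (no_types, lifting) sum.cong)
qed

text \<open>A loop of order \<open>\<alpha> > 1\<close> cannot fill a three-dimensional cube: among \<open>(m + 1)\<^sup>3\<close> grid points of mesh
  \<open>1/m\<close>, two would be visited at times \<open>O(m\<^sup>-\<^sup>3)\<close> apart, while an approximating polynomial of degree
  \<open>n\<close> proportional to \<open>m\<close> moves by at most \<open>O(n\<^sup>2 m\<^sup>-\<^sup>3)\<close> in that time.\<close>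

lemma lip_bound_misses_ball:
  assumes \<alpha>: "1 < \<alpha>" and f: "lip_bound \<alpha> K f" and g: "lip_bound \<alpha> K g"
  shows "\<exists>x y z r. 0 \<le> x \<and> x \<le> 1/2 \<and> 0 \<le> y \<and> y \<le> 1/2 \<and> 0 \<le> z \<and> z \<le> 1/2 \<and> 0 < r \<and>
    (\<forall>t. r \<le> \<bar>Re (f t) - x\<bar> \<or> r \<le> \<bar>Im (f t) - y\<bar> \<or> r \<le> \<bar>Re (g t) - z\<bar>)"
proof (rule ccontr)
  assume none: "\<not> ?thesis"
  have hit: "\<exists>t. \<bar>Re (f t) - x\<bar> < r \<and> \<bar>Im (f t) - y\<bar> < r \<and> \<bar>Re (g t) - z\<bar> < r"
    if "0 \<le> x" "x \<le> 1/2" "0 \<le> y" "y \<le> 1/2" "0 \<le> z" "z \<le> 1/2" "0 < r" for x y z r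
    using that none by (meson not_le)
  define K1 where "K1 = max 1 K"
  have K1: "1 \<le> K1" by (simp add: K1_def)
  have f1: "lip_bound \<alpha> K1 f" and g1: "lip_bound \<alpha> K1 g" using f g by (auto intro: lip_bound_mono simp: K1_def)
  \<comment> \<open>The ratio m / n. Since 384 = 8 * 48, it makes the displacement 48 K1 n^2 / m^3
    of the polynomial at most 1 / (8 m).\<close>
  obtain L :: nat where L: "max 1 (384 * K1) \<le> real L" using real_arch_simple by blast
  hence L1: "1 \<le> real L" "384 * K1 \<le> real L" by auto
  obtain n1 where n1: "\<And>n. n1 \<le> n \<Longrightarrow> K1 * rate (\<alpha> - 1) n \<le> 1 / (16 * real L)"
    using rate_eventually_le[of "\<alpha> - 1" "1 / (16 * real L)" K1] \<alpha> L1 by auto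
  define n where "n = Suc n1"
  define m where "m = L * n"
  have n: "1 \<le> real n" by (simp add: n_def)
  have rm: "real m = real L * real n" by (simp add: m_def)
  have "1 * 1 \<le> real L * real n" using L1 n by (intro mult_mono) auto
  hence m: "1 \<le> real m" by (simp add: rm)
  hence m0: "0 < m" by (cases m) auto
  define \<kappa> where "\<kappa> = K1 * rate \<alpha> n"
  have \<kappa>: "\<kappa> \<le> 1 / (16 * real m)"
  proof -
    have r1: "(real n + 1) * rate \<alpha> n = rate (\<alpha> - 1) n"
      using powr_add[of "real n + 1" 1 "- \<alpha>"] by (simp add: powr_diff add.commute)
    have "real n * \<kappa> \<le> K1 * ((real n + 1) * rate \<alpha> n)"
      using K1 by (simp add: \<kappa>_def distrib_right distrib_left)
    also have "\<dots> \<le> 1 / (16 * real L)" unfolding r1 by (rule n1) (simp add: n_def)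
    finally show ?thesis using n L1 by (simp add: rm field_simps)
  qed
  \<comment> \<open>Grid points are 1 / (2 m) apart in each coordinate, while 2 r plus the distance
    2 / (8 m) between two values adds up to 3 / (8 m) only.\<close>
  define r where "r = 1 / (16 * real m)"
  have r: "0 < r" using m by (simp add: r_def)
  define G where "G = {0..m} \<times> {0..m} \<times> {0..m}"
  define h where "h = (\<lambda>a::nat. real a / (2 * real m))"
  have hb: "0 \<le> h a \<and> h a \<le> 1/2" if "a \<in> {0..m}" for a
    using that m by (auto simp: h_def field_simps)
  define T where "T = (\<lambda>(a, b, c). SOME t. \<bar>Re (f t) - h a\<bar> < r \<and> \<bar>Im (f t) - h b\<bar> < r \<and> \<bar>Re (g t) - h c\<bar> < r)"
  have T: "\<bar>Re (f (T (a,b,c))) - h a\<bar> < r \<and> \<bar>Im (f (T (a,b,c))) - h b\<bar> < r \<and> \<bar>Re (g (T (a,b,c))) - h c\<bar> < r"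
    if "(a, b, c) \<in> G" for a b c
    unfolding T_def prod.case by (rule someI_ex, rule hit) (use that hb r in \<open>auto simp: G_def\<close>)
  \<comment> \<open>\<open>lip_bound\<close> records no periodicity, so times are reduced modulo 2
    pi in the approximating polynomial only, through p (tau a) = p (T a).\<close>
  define \<tau> where "\<tau> = (\<lambda>a. T a - 2 * pi * of_int \<lfloor>T a / (2 * pi)\<rfloor>)"
  have \<tau>: "0 \<le> \<tau> a" "\<tau> a < 2 * pi" for a
  proof -
    define x where "x = T a / (2 * pi) - of_int \<lfloor>T a / (2 * pi)\<rfloor>"
    have x: "0 \<le> x" "x < 1" unfolding x_def by linarith+
    have "\<tau> a = 2 * pi * x" by (simp add: \<tau>_def x_def right_diff_distrib)
    thus "0 \<le> \<tau> a" "\<tau> a < 2 * pi" using x by simp_all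
  qed
  \<comment> \<open>There are m^3 bins of length 2 pi / m^3 for (m + 1)^3 grid points.\<close>
  define bin where "bin = (\<lambda>a. nat \<lfloor>\<tau> a * real (m ^ 3) / (2 * pi)\<rfloor>)"
  have bin: "real (bin a) \<le> \<tau> a * real (m ^ 3) / (2 * pi)" "\<tau> a * real (m ^ 3) / (2 * pi) < real (bin a) + 1" for a
  proof -
    have "0 \<le> \<tau> a * real (m ^ 3) / (2 * pi)" using \<tau>[of a] by simp
    thus "real (bin a) \<le> \<tau> a * real (m ^ 3) / (2 * pi)" "\<tau> a * real (m ^ 3) / (2 * pi) < real (bin a) + 1"
      unfolding bin_def by linarith+
  qed
  have "\<not> inj_on bin G"
  proof
    assume "inj_on bin G"
    moreover have "bin ` G \<subseteq> {..<m ^ 3}"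
    proof
      fix b assume "b \<in> bin ` G"
      then obtain a where a: "b = bin a" by blast
      have "\<tau> a * real (m ^ 3) / (2 * pi) < real (m ^ 3)" using \<tau>[of a] m by (simp add: field_simps)
      hence "real (bin a) < real (m ^ 3)" using bin(1)[of a] by linarith
      thus "b \<in> {..<m ^ 3}" unfolding a by (simp only: of_nat_less_iff lessThan_iff)
    qed
    ultimately have "card G \<le> card {..<m ^ 3}" by (rule card_inj_on_le) simp
    moreover have "card G = (m + 1) ^ 3" by (simp add: G_def card_cartesian_product power3_eq_cube)
    moreover have "m ^ 3 < (m + 1) ^ 3" by (intro power_strict_mono) auto
    ultimately show False by simp
  qed
  then obtain A A' where A: "A \<in> G" "A' \<in> G" "A \<noteq> A'" "bin A = bin A'" unfolding inj_on_def by blast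
  obtain a b c a' b' c' where abc: "A = (a, b, c)" "A' = (a', b', c')" by (metis prod.collapse)
  have td: "\<bar>\<tau> A - \<tau> A'\<bar> \<le> 8 / real (m ^ 3)"
  proof -
    have "\<bar>\<tau> A * real (m ^ 3) / (2 * pi) - \<tau> A' * real (m ^ 3) / (2 * pi)\<bar> \<le> 1"
      using bin[of A] bin[of A'] A(4) by linarith
    also have "\<tau> A * real (m ^ 3) / (2 * pi) - \<tau> A' * real (m ^ 3) / (2 * pi)
        = (\<tau> A - \<tau> A') * (real (m ^ 3) / (2 * pi))"
      by (simp add: left_diff_distrib diff_divide_distrib)
    finally have "\<bar>\<tau> A - \<tau> A'\<bar> * (real (m ^ 3) / (2 * pi)) \<le> 1"
      by (simp add: abs_mult)
    hence "\<bar>\<tau> A - \<tau> A'\<bar> \<le> 2 * pi / real (m ^ 3)" using m by (simp add: field_simps)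
    also have "\<dots> \<le> 8 / real (m ^ 3)" using pi_less_4 m by (intro divide_right_mono) auto
    finally show ?thesis .
  qed
  have close: "norm (F (T A) - F (T A')) \<le> 2 / (8 * real m)" if F: "lip_bound \<alpha> K1 F" for F
  proof -
    obtain p where p: "trig_poly n p" "\<And>t. norm (F t - p t) \<le> \<kappa>" using lip_boundE[OF F] unfolding \<kappa>_def by blast
    have "\<kappa> \<le> K1" unfolding \<kappa>_def using rate_le_1[of \<alpha> n] K1 \<alpha> by (simp add: mult_left_le)
    hence pb: "norm (p t) \<le> 2 * K1" for t
      using p(2)[of t] lip_bound_norm[OF F, of t] norm_triangle_ineq2[of "p t" "F t"]
      by (simp add: norm_minus_commute)
    have pt: "p (\<tau> a) = p (T a)" for a unfolding \<tau>_def by (rule trig_poly_periodic[OF p(1)])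
    have "norm (p (T A) - p (T A')) \<le> real (2 * n + 1) * (2 * K1 * real n * \<bar>\<tau> A - \<tau> A'\<bar>)"
      unfolding pt[symmetric] by (rule trig_poly_lipschitz[OF p(1) pb])
    also have "\<dots> \<le> (3 * real n) * (2 * K1 * real n * (8 / real (m ^ 3)))"
      using n K1 td by (intro mult_mono) auto
    also have "\<dots> = 48 * K1 * (real n)\<^sup>2 / real (m ^ 3)" by (simp add: power2_eq_square)
    also have "\<dots> \<le> 1 / (8 * real m)"
    proof -
      have "384 * K1 * 1 \<le> real L * real L" using L1 K1 by (intro mult_mono) auto
      hence "384 * K1 * (real n)\<^sup>2 \<le> (real L * real L) * (real n)\<^sup>2" by (intro mult_right_mono) auto
      also have "\<dots> = (real m)\<^sup>2" by (simp add: rm power2_eq_square)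
      finally have "384 * K1 * (real n)\<^sup>2 * real m \<le> (real m)\<^sup>2 * real m" by (intro mult_right_mono) auto
      thus ?thesis using m by (simp add: field_simps power2_eq_square power3_eq_cube)
    qed
    finally have "norm (p (T A) - p (T A')) \<le> 1 / (8 * real m)" .
    moreover have "norm (F (T A) - F (T A')) \<le> norm (F (T A) - p (T A)) + norm (p (T A) - p (T A')) + norm (F (T A') - p (T A'))"
      using norm_triangle_ineq[of "F (T A) - p (T A)" "p (T A) - p (T A')"]
        norm_triangle_ineq4[of "F (T A) - p (T A')" "F (T A') - p (T A')"] by simp
    moreover have "1 / (16 * real m) + 1 / (8 * real m) + 1 / (16 * real m) = 2 / (8 * real m)"
      using m by (simp add: field_simps)
    ultimately show ?thesis using p(2)[of "T A"] p(2)[of "T A'"] \<kappa> by linarith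
  qed
  have sep: "x = y" if "\<bar>X - h x\<bar> < r" "\<bar>Y - h y\<bar> < r" "\<bar>X - Y\<bar> \<le> 2 / (8 * real m)" for x y X Y
  proof (rule ccontr)
    assume "x \<noteq> y"
    hence "1 \<le> \<bar>real x - real y\<bar>" by linarith
    hence "1 / (2 * real m) \<le> \<bar>real x - real y\<bar> / (2 * real m)" using m by (intro divide_right_mono) auto
    also have "\<dots> = \<bar>h x - h y\<bar>" using m by (simp add: h_def abs_divide flip: diff_divide_distrib)
    also have "\<dots> < r + 2 / (8 * real m) + r" using that by linarith
    also have "\<dots> \<le> 1 / (2 * real m)" using m by (simp add: r_def field_simps)
    finally show False by simp
  qed
  have TA: "\<bar>Re (f (T A)) - h a\<bar> < r" "\<bar>Im (f (T A)) - h b\<bar> < r" "\<bar>Re (g (T A)) - h c\<bar> < r"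
    using T[of a b c] A(1) abc by auto
  have TA': "\<bar>Re (f (T A')) - h a'\<bar> < r" "\<bar>Im (f (T A')) - h b'\<bar> < r" "\<bar>Re (g (T A')) - h c'\<bar> < r"
    using T[of a' b' c'] A(2) abc by auto
  have "a = a'" by (rule sep[OF TA(1) TA'(1)])
    (use close[OF f1] abs_Re_le_cmod[of "f (T A) - f (T A')"] in auto)
  moreover have "b = b'" by (rule sep[OF TA(2) TA'(2)])
    (use close[OF f1] abs_Im_le_cmod[of "f (T A) - f (T A')"] in auto)
  moreover have "c = c'" by (rule sep[OF TA(3) TA'(3)])
    (use close[OF g1] abs_Re_le_cmod[of "g (T A) - g (T A')"] in auto)
  ultimately show False using A(3) abc by simp
qed

section \<open>Reduction to fewer coordinates\<close>

definition fixes_axis :: "complex^'n^'n \<Rightarrow> 'n \<Rightarrow> bool" where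
  "fixes_axis A l \<longleftrightarrow> (\<forall>k. A $ k $ l = (if k = l then 1 else 0))"

lemma cadjoint_mult_fixes_axis:
  assumes A: "A \<in> SU" and eq: "\<And>k. A $ k $ l = B $ k $ l"
  shows "fixes_axis (cadjoint A ** B) l"
proof -
  have "(cadjoint A ** B) $ k $ l = (cadjoint A ** A) $ k $ l" for k
    by (simp add: matrix_matrix_mult_def eq)
  thus ?thesis using A by (simp add: fixes_axis_def SU_def mat_def)
qed

text \<open>Entry (l, k) of A* A = I, where column l contributes a single term.\<close>

lemma fixes_axis_row:
  assumes A: "A \<in> SU" and l: "fixes_axis A l"
  shows "A $ l $ k = (if l = k then 1 else 0)"
proof -
  have "(cadjoint A ** A) $ l $ k = (\<Sum>p\<in>UNIV. (if p = l then A $ p $ k else 0))"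
    unfolding matrix_matrix_mult_def vec_lambda_beta cadjoint_nth
    by (rule sum.cong) (use l in \<open>auto simp: fixes_axis_def\<close>)
  thus ?thesis using A by (simp add: SU_def mat_def)
qed

lemma SU_column_unit:
  assumes "A \<in> SU" shows "(\<Sum>k\<in>UNIV. (norm (A $ k $ i))\<^sup>2) = 1"
proof -
  have "(cadjoint A ** A) $ i $ i = 1" using assms by (simp add: SU_def mat_def)
  hence "(\<Sum>k\<in>UNIV. of_real ((norm (A $ k $ i))\<^sup>2)) = (1 :: complex)"
    by (simp only: complex_norm_square) (simp add: matrix_matrix_mult_def mult.commute)
  thus ?thesis by (metis of_real_eq_1_iff of_real_sum)
qed

text \<open>The matrix is diagonal, and its one free diagonal entry is the determinant.\<close>

lemma SU_fixes_axes_imp_id: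
  assumes A: "A \<in> SU" and f: "\<And>l. l \<noteq> i \<Longrightarrow> fixes_axis A l"
  shows "A = mat 1"
proof -
  have off: "A $ k $ l = 0" if "k \<noteq> l" for k l
    using fixes_axis_row[OF A f, of k l] f[of l] that by (cases "k = i") (auto simp: fixes_axis_def)
  have dg: "A $ k $ k = 1" if "k \<noteq> i" for k using f[OF that] by (simp add: fixes_axis_def)
  have "1 = (\<Prod>k\<in>UNIV. A $ k $ k)" using A det_diagonal[of A] off by (simp add: SU_def)
  also have "\<dots> = (\<Prod>k\<in>{i}. A $ k $ k)" using dg by (intro prod.mono_neutral_right) auto
  finally have "A $ k $ k = 1" for k using dg by (cases "k = i") auto
  thus ?thesis using off by (simp add: vec_eq_iff mat_def)
qed

text \<open>The matrix size is a type and cannot shrink, so the induction runs over the set of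
  coordinates outside which U fixes the basis vectors.\<close>

lemma approximable_fixing_complement:
  fixes S :: "'n::finite set"
  assumes \<alpha>: "1 < \<alpha>"
  shows "lip_bound_mat \<alpha> K U \<Longrightarrow> (\<And>t. U t \<in> SU) \<Longrightarrow> (\<And>t l. l \<notin> S \<Longrightarrow> fixes_axis (U t) l) \<Longrightarrow> approximable \<alpha> U"
  using finite[of S]
proof (induction S arbitrary: U K rule: finite_induct)
  case empty
  have "U t = mat 1" for t using SU_fixes_axes_imp_id[OF empty(2)] empty(3) by blast
  hence "U = (\<lambda>t. mat 1)" by blast
  thus ?case using approximable_const[OF SU_mat_1] by simp
next
  case (insert i S)
  show ?case
  proof (cases "S = {}")
    case True
    have "U t = mat 1" for t
      using SU_fixes_axes_imp_id[OF insert.prems(2)] insert.prems(3) True by blast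
    hence "U = (\<lambda>t. mat 1)" by blast
    thus ?thesis using approximable_const[OF SU_mat_1] by simp
  next
    case False
    \<comment> \<open>A second free coordinate. It takes the determinant correction and the
      remaining part of the vector \<open>v\<close>.\<close>
    then obtain j where j: "j \<in> S" by blast
    have ij: "i \<noteq> j" using j insert.hyps by blast
    have "lip_bound \<alpha> K (\<lambda>t. U t $ i $ i)" "lip_bound \<alpha> K (\<lambda>t. U t $ j $ i)"
      using insert.prems(1) by (auto simp: lip_bound_mat_def)
    from lip_bound_misses_ball[OF \<alpha> this] obtain x y z r where xyz: "0 \<le> x" "x \<le> 1/2" "0 \<le> y" "y \<le> 1/2" "0 \<le> z" "z \<le> 1/2"
      and r: "0 < r" and miss: "\<And>t. r \<le> \<bar>Re (U t $ i $ i) - x\<bar> \<or> r \<le> \<bar>Im (U t $ i $ i) - y\<bar> \<or> r \<le> \<bar>Re (U t $ j $ i) - z\<bar>"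
      by blast
    \<comment> \<open>The cube [0, 1/2]^3 lies in the unit ball, so the missed point completes to a
      unit vector through the imaginary part at j.\<close>
    have "x\<^sup>2 \<le> (1/2)\<^sup>2" "y\<^sup>2 \<le> (1/2)\<^sup>2" "z\<^sup>2 \<le> (1/2)\<^sup>2" using xyz by (intro power_mono; simp)+
    hence xyz1: "0 \<le> 1 - x\<^sup>2 - y\<^sup>2 - z\<^sup>2" by (simp add: power2_eq_square)
    define v :: "complex^'n" where
      "v = (\<chi> k. if k = i then Complex x y else if k = j then Complex z (sqrt (1 - x\<^sup>2 - y\<^sup>2 - z\<^sup>2)) else 0)"
    have v: "v $ i = Complex x y" "v $ j = Complex z (sqrt (1 - x\<^sup>2 - y\<^sup>2 - z\<^sup>2))"
      "\<And>l. l \<noteq> i \<Longrightarrow> l \<noteq> j \<Longrightarrow> v $ l = 0" using ij by (auto simp: v_def)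
    have v1: "(\<Sum>k\<in>UNIV. (norm (v $ k))\<^sup>2) = 1"
    proof -
      have "(\<Sum>k\<in>- {i, j}. (norm (v $ k))\<^sup>2) = 0" by (rule sum.neutral) (simp add: v(3))
      thus ?thesis unfolding sum_split2[OF ij] v(1,2) using xyz1 by (simp add: cmod_power2)
    qed
    have vi: "0 < (1/2 :: real)" "Re (v $ i) \<le> 1 - 1/2" using xyz v(1) by auto
    \<comment> \<open>\<open>C\<close> sends e_i to \<open>v\<close>; it exists because Re v_i <=
      1/2. Passing to C* U moves the missed vector to e_i, the one place where the path for the
      column breaks down.\<close>
    define C where "C = unitary_path i j v 1"
    note C = unitary_path_properties[OF v1 vi ij zero_le_one order_refl, folded C_def]
    define U1 where "U1 = (\<lambda>t. cadjoint C ** U t)"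
    have U1: "U1 t \<in> SU" for t unfolding U1_def by (intro SU_mult SU_cadjoint C(1) insert.prems(2))
    obtain K1 where K1: "lip_bound_mat \<alpha> K1 U1"
      using lip_bound_mat_mult[OF lip_bound_mat_cadjoint[OF lip_bound_mat_const] insert.prems(1), of C] \<alpha>
      unfolding U1_def by auto
    have U1f: "fixes_axis (U1 t) l" if "l \<notin> insert i S" for t l
    proof -
      have "l \<noteq> i" "l \<noteq> j" using that j by auto
      thus ?thesis unfolding U1_def
        by (intro cadjoint_mult_fixes_axis[OF C(1)])
           (use insert.prems(3)[OF that, of t] C(4)[OF \<open>l \<noteq> i\<close> \<open>l \<noteq> j\<close> v(3)] in \<open>simp add: fixes_axis_def\<close>)
    qed
    \<comment> \<open>The entry is the inner product of \<open>v\<close> with column i of U, whose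
      real part is 1 - |U e_i - v|^2 / 2, and the distance is at least r.\<close>
    have U1r: "Re (U1 t $ i $ i) \<le> 1 - r\<^sup>2 / 2" for t
    proof -
      have "U1 t $ i $ i = (\<Sum>p\<in>UNIV. cnj (v $ p) * U t $ p $ i)"
        by (simp add: U1_def matrix_matrix_mult_def C(3))
      hence re: "Re (U1 t $ i $ i) = (\<Sum>p\<in>UNIV. Re (cnj (v $ p) * U t $ p $ i))" by simp
      have "(norm (U t $ p $ i - v $ p))\<^sup>2
          = (norm (U t $ p $ i))\<^sup>2 + (norm (v $ p))\<^sup>2 - 2 * Re (cnj (v $ p) * U t $ p $ i)" for p
        unfolding cmod_power2 by (simp add: power2_eq_square algebra_simps)
      hence s: "(\<Sum>p\<in>UNIV. (norm (U t $ p $ i - v $ p))\<^sup>2) = 2 - 2 * Re (U1 t $ i $ i)"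
        unfolding re using SU_column_unit[OF insert.prems(2), of t i] v1
        by (simp add: sum.distrib sum_subtractf sum_distrib_left)
      have "r \<le> norm (U t $ i $ i - v $ i) \<or> r \<le> norm (U t $ j $ i - v $ j)"
        using miss[of t] abs_Re_le_cmod[of "U t $ i $ i - v $ i"] abs_Im_le_cmod[of "U t $ i $ i - v $ i"]
          abs_Re_le_cmod[of "U t $ j $ i - v $ j"] v(1,2) by auto
      then obtain p where "r \<le> norm (U t $ p $ i - v $ p)" by blast
      hence "r\<^sup>2 \<le> (norm (U t $ p $ i - v $ p))\<^sup>2" using r by (intro power_mono) auto
      also have "\<dots> \<le> (\<Sum>p\<in>UNIV. (norm (U t $ p $ i - v $ p))\<^sup>2)" by (rule member_le_sum) auto
      finally show ?thesis unfolding s by simp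
    qed
    define u where "u = (\<lambda>t. \<chi> k. U1 t $ k $ i)"
    have u: "(\<Sum>k\<in>UNIV. (norm (u t $ k))\<^sup>2) = 1" "Re (u t $ i) \<le> 1 - r\<^sup>2 / 2" for t
      using SU_column_unit[OF U1] U1r by (auto simp: u_def)
    have r2: "0 < r\<^sup>2 / 2" using r by simp
    have ul: "lip_bound \<alpha> K1 (\<lambda>t. u t $ k)" for k using K1 by (simp add: u_def lip_bound_mat_def)
    define V where "V = (\<lambda>t. unitary_path i j (u t) 1)"
    have Va: "approximable \<alpha> V" and "\<exists>K'. lip_bound_mat \<alpha> K' V"
      using unitary_path_approximable[OF \<alpha> r2 ij ul u] by (simp_all add: V_def)
    then obtain K2 where K2: "lip_bound_mat \<alpha> K2 V" by blast
    have VSU: "V t \<in> SU" for t unfolding V_def by (rule unitary_path_properties[OF u(1) r2 u(2) ij zero_le_one order_refl])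
    have Vi: "V t $ k $ i = U1 t $ k $ i" for t k
      unfolding V_def using unitary_path_properties(3)[OF u(1) r2 u(2) ij zero_le_one order_refl, of t k] by (simp add: u_def)
    have Vl: "V t $ k $ l = U1 t $ k $ l" if "l \<notin> insert i S" for t k l
    proof -
      have l: "l \<noteq> i" "l \<noteq> j" using that j by auto
      have "u t $ l = 0" using fixes_axis_row[OF U1 U1f[OF that], of t i] l(1) by (simp add: u_def)
      hence "V t $ k $ l = (if k = l then 1 else 0)" unfolding V_def
        by (rule unitary_path_properties(4)[OF u(1) r2 u(2) ij zero_le_one order_refl l])
      thus ?thesis using U1f[OF that, of t] by (simp add: fixes_axis_def)
    qed
    \<comment> \<open>\<open>V\<close> and \<open>U1\<close> agree in column i and in all columns
      outside \<open>insert i S\<close>, so this quotient fixes one axis more.\<close>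
    define U2 where "U2 = (\<lambda>t. cadjoint (V t) ** U1 t)"
    have U2: "U2 t \<in> SU" for t unfolding U2_def by (intro SU_mult SU_cadjoint VSU U1)
    have "approximable \<alpha> U2"
    proof (rule insert.IH)
      show "lip_bound_mat \<alpha> (real CARD('n) * (3 * 2 powr \<alpha> * K2 * K1)) U2"
        unfolding U2_def using \<alpha> by (intro lip_bound_mat_mult lip_bound_mat_cadjoint K1 K2) auto
      show "fixes_axis (U2 t) l" if "l \<notin> S" for t l
        unfolding U2_def by (rule cadjoint_mult_fixes_axis[OF VSU]) (use that Vi Vl in \<open>cases "l = i"; simp\<close>)
    qed (rule U2)
    hence "approximable \<alpha> (\<lambda>t. V t ** U2 t)" using Va U2 \<alpha> by (intro approximable_mult) auto
    moreover have "V t ** U2 t = U1 t" for t unfolding U2_def by (rule SU_cancel_left[OF VSU])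
    ultimately have "approximable \<alpha> U1" by simp
    hence "approximable \<alpha> (\<lambda>t. C ** U1 t)"
      using U1 \<alpha> by (intro approximable_mult approximable_const C(1)) auto
    moreover have "C ** U1 t = U t" for t unfolding U1_def by (rule SU_cancel_left[OF C(1)])
    ultimately show ?thesis by simp
  qed
qed

section \<open>Passage to the spectral norm and conclusion\<close>

lemma norm_matrix_vector_le:
  fixes A :: "complex^'n^'n" shows "norm (A *v x) \<le> norm A * norm x"
proof -
  have "norm ((A *v x) $ i) \<le> norm (A $ i) * norm x" for i
  proof -
    have "norm ((A *v x) $ i) \<le> (\<Sum>k\<in>UNIV. \<bar>norm (A $ i $ k)\<bar> * \<bar>norm (x $ k)\<bar>)"
      unfolding matrix_vector_mult_def vec_lambda_beta by (rule sum_norm_le) (simp add: norm_mult)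
    also have "\<dots> \<le> norm (A $ i) * norm x"
      unfolding norm_vec_def[of "A $ i"] norm_vec_def[of x] by (rule L2_set_mult_ineq)
    finally show ?thesis .
  qed
  hence "norm (A *v x) \<le> L2_set (\<lambda>i. norm (A $ i) * norm x) UNIV"
    unfolding norm_vec_def[of "A *v x"] by (intro L2_set_mono) auto
  also have "\<dots> = norm A * norm x" unfolding norm_vec_def[of A] by (simp add: L2_set_left_distrib)
  finally show ?thesis .
qed

lemma spec_norm_le_norm: "spec_norm A \<le> norm A"
  unfolding spec_norm_def by (rule onorm_bound) (auto simp: norm_matrix_vector_le)

theorem theorem1:
  fixes U :: "real \<Rightarrow> complex^'n^'n" and \<alpha> \<epsilon> :: real
  assumes "CARD('n) \<ge> 2"
    and "\<alpha> > 1" and "\<epsilon> > 0"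
    and "Lip_loop \<alpha> U"
    and "\<forall>t. U t \<in> SU"
  shows "\<exists>C. \<exists>Us :: nat \<Rightarrow> real \<Rightarrow> complex^'n^'n.
           \<forall>n. poly_loop n (Us n) \<and> (\<forall>t. Us n t \<in> SU) \<and>
               (\<forall>t. spec_norm (U t - Us n t) \<le> C * (real n + 1) powr (-(\<alpha> - \<epsilon>)))"
proof -
  have "\<forall>i j. \<exists>K. lip_bound \<alpha> K (\<lambda>t. U t $ i $ j)"
    using assms(4) Lip_imp_lip_bound unfolding Lip_loop_def by metis
  then obtain K where K: "\<And>i j. lip_bound \<alpha> (K i j) (\<lambda>t. U t $ i $ j)" by metis
  have K0: "0 \<le> K i j" for i j by (rule lip_bound_nonneg[OF K])
  have "K i j \<le> (\<Sum>i\<in>UNIV. \<Sum>j\<in>UNIV. K i j)" for i j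
  proof -
    have "K i j \<le> (\<Sum>j\<in>UNIV. K i j)" using K0 by (intro member_le_sum) auto
    also have "\<dots> \<le> (\<Sum>i\<in>UNIV. \<Sum>j\<in>UNIV. K i j)"
      using K0 by (intro member_le_sum[of i UNIV "\<lambda>i. \<Sum>j\<in>UNIV. K i j"]) (auto intro: sum_nonneg)
    finally show ?thesis .
  qed
  hence "lip_bound_mat \<alpha> (\<Sum>i\<in>UNIV. \<Sum>j\<in>UNIV. K i j) U"
    unfolding lip_bound_mat_def using K lip_bound_mono by blast
  \<comment> \<open>With all coordinates free, the condition on fixed axes is void.\<close>
  from approximable_fixing_complement[OF assms(2) this, of UNIV] assms(5)
  obtain D where D: "\<And>n. approx_within U n (D * rate \<alpha> n)" unfolding approximable_def by auto
  then obtain Us where Us: "\<And>n. poly_loop n (Us n)" "\<And>n t. Us n t \<in> SU"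
    "\<And>n t. norm (U t - Us n t) \<le> D * rate \<alpha> n"
    unfolding approx_within_def by metis
  have "0 \<le> D" using order_trans[OF norm_ge_zero Us(3)[of _ 0]] by simp
  have "spec_norm (U t - Us n t) \<le> D * (real n + 1) powr (-(\<alpha> - \<epsilon>))" for n t
  proof -
    have "spec_norm (U t - Us n t) \<le> D * rate \<alpha> n" using spec_norm_le_norm Us(3) order_trans by blast
    also have "\<dots> \<le> D * (real n + 1) powr (-(\<alpha> - \<epsilon>))"
      using \<open>0 \<le> D\<close> assms(3) by (intro mult_left_mono powr_mono) auto
    finally show ?thesis .
  qed
  thus ?thesis using Us by blast
qed

end
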